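(* Let $H$ be a separable Hilbert space and let $\mathcal{L}\subset B(H)$ be a Lie algebra of operators containing a maximal abelian selfadjoint subalgebra $\mathcal{D}$ of $B(H)$. Then either $\mathcal{L}$ has a non-trivial (closed) invariant subspace or $\mathcal{L}$ is dense in $B(H)$ in the ultra-weak topology.
   Context: $B(H)$ is the algebra of all bounded operators on $H$. A Lie algebra of operators is a linear subspace of $B(H)$ closed under the commutator $[S,T]=ST-TS$. An invariant subspace of $\mathcal{L}$ is a closed subspace of $H$ invariant under every operator in $\mathcal{L}$; it is non-trivial if it differs from $\{0\}$ and $H$. *)

theory Defs
  imports "HOL-Analysis.Analysis"
begin

text \<open>Complex Hilbert spaces. The norm, metric and topology are inherited from the underlying real
  inner product space, whose inner product is the real part of the complex one; in particular
  \<open>norm x = sqrt (Re (cinner x x))\<close>. The complex inner product is linear in its first argument.\<close>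

class complex_inner = real_inner +
  fixes scaleC :: "complex \<Rightarrow> 'a \<Rightarrow> 'a"  (infixr \<open>*\<^sub>C\<close> 75)
    and cinner :: "'a \<Rightarrow> 'a \<Rightarrow> complex"
  assumes scaleC_add_right: "c *\<^sub>C (x + y) = c *\<^sub>C x + c *\<^sub>C y"
    and scaleC_add_left: "(c + d) *\<^sub>C x = c *\<^sub>C x + d *\<^sub>C x"
    and scaleC_scaleC: "c *\<^sub>C d *\<^sub>C x = (c * d) *\<^sub>C x"
    and scaleC_one: "1 *\<^sub>C x = x"
    and scaleR_eq_scaleC: "r *\<^sub>R x = complex_of_real r *\<^sub>C x"
    and cinner_commute: "cinner x y = cnj (cinner y x)"
    and cinner_add_left: "cinner (x + y) z = cinner x z + cinner y z"
    and cinner_scaleC_left: "cinner (c *\<^sub>C x) y = c * cinner x y"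
    and inner_eq_Re_cinner: "inner x y = Re (cinner x y)"

class complex_hilbert_space = complex_inner + complete_space

global_interpretation complex_vector:
  vector_space "scaleC :: complex \<Rightarrow> 'a \<Rightarrow> 'a::complex_inner"
  by unfold_locales (rule scaleC_add_right scaleC_add_left scaleC_scaleC scaleC_one)+

instantiation complex :: complex_hilbert_space
begin

definition "scaleC_complex = (\<lambda>c x :: complex. c * x)"
definition "cinner_complex = (\<lambda>x y :: complex. x * cnj y)"

instance
  by standard
    (auto simp: scaleC_complex_def cinner_complex_def algebra_simps scaleR_conv_of_real
      inner_complex_def)

end

text \<open>Operators are plain functions, and \<open>bounded_ops\<close> is the algebra \<open>B(H)\<close>.\<close>

definition bounded_ops :: "('a::complex_inner \<Rightarrow> 'a) set" where
  "bounded_ops = {T. Vector_Spaces.linear scaleC scaleC T \<and> (\<exists>K. \<forall>x. norm (T x) \<le> K * norm x)}"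

definition operator_subspace :: "('a::complex_inner \<Rightarrow> 'a) set \<Rightarrow> bool" where
  "operator_subspace L \<longleftrightarrow>
     L \<subseteq> bounded_ops \<and> (\<lambda>x. 0) \<in> L \<and>
     (\<forall>S\<in>L. \<forall>T\<in>L. (\<lambda>x. S x + T x) \<in> L) \<and>
     (\<forall>c. \<forall>T\<in>L. (\<lambda>x. c *\<^sub>C T x) \<in> L)"

definition commutator :: "('a::complex_inner \<Rightarrow> 'a) \<Rightarrow> ('a \<Rightarrow> 'a) \<Rightarrow> 'a \<Rightarrow> 'a" where
  "commutator S T = (\<lambda>x. S (T x) - T (S x))"

definition operator_lie_algebra :: "('a::complex_inner \<Rightarrow> 'a) set \<Rightarrow> bool" where
  "operator_lie_algebra L \<longleftrightarrow>
     operator_subspace L \<and> (\<forall>S\<in>L. \<forall>T\<in>L. commutator S T \<in> L)"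

definition operator_subalgebra :: "('a::complex_inner \<Rightarrow> 'a) set \<Rightarrow> bool" where
  "operator_subalgebra A \<longleftrightarrow> operator_subspace A \<and> (\<forall>S\<in>A. \<forall>T\<in>A. S \<circ> T \<in> A)"

definition is_adjoint :: "('a::complex_inner \<Rightarrow> 'a) \<Rightarrow> ('a \<Rightarrow> 'a) \<Rightarrow> bool" where
  "is_adjoint S T \<longleftrightarrow> (\<forall>x y. cinner (T x) y = cinner x (S y))"

definition selfadjoint_set :: "('a::complex_inner \<Rightarrow> 'a) set \<Rightarrow> bool" where
  "selfadjoint_set A \<longleftrightarrow> (\<forall>T\<in>A. \<exists>S\<in>A. is_adjoint S T)"

definition abelian_selfadjoint_subalgebra :: "('a::complex_inner \<Rightarrow> 'a) set \<Rightarrow> bool" where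
  "abelian_selfadjoint_subalgebra A \<longleftrightarrow>
     operator_subalgebra A \<and> selfadjoint_set A \<and> (\<forall>S\<in>A. \<forall>T\<in>A. S \<circ> T = T \<circ> S)"

definition masa :: "('a::complex_inner \<Rightarrow> 'a) set \<Rightarrow> bool" where
  "masa D \<longleftrightarrow>
     abelian_selfadjoint_subalgebra D \<and>
     (\<forall>A. abelian_selfadjoint_subalgebra A \<and> D \<subseteq> A \<longrightarrow> A = D)"

definition invariant_subspace :: "('a::complex_inner \<Rightarrow> 'a) set \<Rightarrow> 'a set \<Rightarrow> bool" where
  "invariant_subspace L M \<longleftrightarrow>
     complex_vector.subspace M \<and> closed M \<and> (\<forall>T\<in>L. T ` M \<subseteq> M)"

text \<open>The ultra-weak topology is the locally convex topology on \<open>B(H)\<close> given by the seminorms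
  \<open>T \<mapsto> \<bar>\<Sum>n. \<langle>T (x n), y n\<rangle>\<bar>\<close> with \<open>x\<close>, \<open>y\<close> square-summable sequences of vectors; equivalently
  the coarsest topology making the corresponding linear functionals continuous. The series converge
  absolutely by the Cauchy-Schwarz inequality.\<close>

definition square_summable :: "(nat \<Rightarrow> 'a::complex_inner) \<Rightarrow> bool" where
  "square_summable x \<longleftrightarrow> summable (\<lambda>n. (norm (x n))\<^sup>2)"

definition ultraweak_topology :: "('a::complex_inner \<Rightarrow> 'a) topology" where
  "ultraweak_topology = topology_generated_by
     {{T \<in> bounded_ops. (\<Sum>n. cinner (T (x n)) (y n)) \<in> U} | x y U.
        square_summable x \<and> square_summable y \<and> open U}"

lemma topspace_ultraweak_topology [simp]: "topspace ultraweak_topology = bounded_ops"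
proof -
  have "square_summable (\<lambda>_. 0 :: 'a)"
    by (simp add: square_summable_def)
  then have "bounded_ops \<in>
      {{T \<in> bounded_ops. (\<Sum>n. cinner (T (x n)) (y n)) \<in> U} | x y U.
        square_summable x \<and> square_summable (y :: nat \<Rightarrow> 'a) \<and> open U}"
    by (intro CollectI exI[of _ "\<lambda>_. 0"] exI[of _ UNIV]) auto
  then show ?thesis
    unfolding ultraweak_topology_def topology_generated_by_topspace by blast
qed

end

theory Submission
  imports Defs
begin

text \<open>Let \<open>A\<close> be the set of bounded operators killed by every ultra-weakly continuous functional that
  kills \<open>L\<close>; it is a Lie algebra with \<open>L \<subseteq> A\<close>, and it equals \<open>B(H)\<close> iff \<open>L\<close> is dense. For a
  projection \<open>P\<close> in \<open>D\<close> and \<open>X \<in> A\<close>, brackets with projections show \<open>P X Q \<in> A\<close> whenever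
  \<open>P Q = 0\<close>. Conversely \<open>X\<close> is in \<open>A\<close> as soon as all these corners are: pinching \<open>X\<close> by finitely many
  projections of \<open>D\<close> changes it only by corners, and by weak compactness the pinchings accumulate at
  an operator commuting with \<open>D\<close>, that is, at an element of \<open>D\<close>. Since
  \<open>P X Y Q = [P X, Y Q]\<close> when \<open>P Q = 0\<close>, it follows that \<open>A\<close> is an associative algebra.

  It remains to prove Arveson's theorem that a transitive algebra \<open>A\<close> containing \<open>D\<close> has zero
  annihilator. Write a functional in the annihilator as \<open>T \<mapsto> \<langle>(T \<otimes> 1) w, z\<rangle>\<close> with \<open>w\<close>, \<open>z\<close> in
  \<open>H \<otimes> \<ell>\<^sup>2\<close>, and let \<open>p\<close> be the projection onto the closure of \<open>(A \<otimes> 1) w\<close>. Its compressions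
  \<open>f\<close> to copies of \<open>H\<close> lie in \<open>D\<close> and satisfy
  \<open>\<bar>\<langle>T f h, k\<rangle>\<bar>\<^sup>2 \<le> \<parallel>T\<parallel>\<^sup>2 \<langle>f h, h\<rangle> \<langle>f k, k\<rangle>\<close> for \<open>T \<in> A\<close>. Comparing the spectral
  subspaces of \<open>f\<close> near the top and near the bottom of its spectrum, which are linked by some \<open>T \<in> A\<close>
  by transitivity, forces \<open>f\<close> to be scalar. Hence \<open>p\<close> commutes with \<open>B \<otimes> 1\<close> for every bounded
  \<open>B\<close>, and \<open>z\<close>, being orthogonal to the range of \<open>p\<close>, is orthogonal to \<open>(B \<otimes> 1) w\<close>.\<close>

subsection \<open>Complex inner product spaces\<close>

context complex_inner
begin

lemma cinner_add_right: "cinner x (y + z) = cinner x y + cinner x z"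
  by (metis cinner_add_left cinner_commute complex_cnj_add)

lemma cinner_scaleC_right: "cinner x (c *\<^sub>C y) = cnj c * cinner x y"
  by (metis cinner_commute cinner_scaleC_left complex_cnj_mult)

lemma cinner_zero_left [simp]: "cinner 0 x = 0"
  using cinner_add_left[of 0 0 x] by simp

lemma cinner_zero_right [simp]: "cinner x 0 = 0"
  using cinner_add_right[of x 0 0] by simp

lemma cinner_diff_left: "cinner (x - y) z = cinner x z - cinner y z"
  using cinner_add_left[of "x - y" y z] by simp

lemma cinner_diff_right: "cinner x (y - z) = cinner x y - cinner x z"
  using cinner_add_right[of x "y - z" z] by simp

lemma cinner_scaleR_left: "cinner (r *\<^sub>R x) y = complex_of_real r * cinner x y"
  by (simp add: cinner_scaleC_left scaleR_eq_scaleC)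

lemma cinner_scaleR_right: "cinner x (r *\<^sub>R y) = complex_of_real r * cinner x y"
  by (simp add: cinner_scaleC_right scaleR_eq_scaleC)

lemma cinner_self: "cinner x x = complex_of_real ((norm x)\<^sup>2)"
proof (rule complex_eqI)
  show "Im (cinner x x) = Im (complex_of_real ((norm x)\<^sup>2))"
    using cinner_commute[of x x] by (simp add: complex_eq_iff)
qed (simp add: power2_norm_eq_inner inner_eq_Re_cinner)

lemma norm_scaleC: "norm (c *\<^sub>C x) = cmod c * norm x"
proof -
  have "complex_of_real ((norm (c *\<^sub>C x))\<^sup>2) = c * cnj c * cinner x x"
    by (simp add: cinner_self[symmetric] cinner_scaleC_left cinner_scaleC_right mult_ac
        del: of_real_power)
  also have "\<dots> = complex_of_real ((cmod c * norm x)\<^sup>2)"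
    by (simp only: cinner_self complex_norm_square[symmetric] power_mult_distrib of_real_mult
        of_real_power)
  finally have "complex_of_real ((norm (c *\<^sub>C x))\<^sup>2) = complex_of_real ((cmod c * norm x)\<^sup>2)" .
  then have "(norm (c *\<^sub>C x))\<^sup>2 = (cmod c * norm x)\<^sup>2"
    using of_real_eq_iff by blast
  then show ?thesis
    by simp
qed

text \<open>Multiplying \<open>x\<close> by a unimodular scalar makes \<open>cinner x y\<close> real
  and nonnegative, so the real Cauchy-Schwarz inequality applies.\<close>

lemma cmod_cinner_le: "cmod (cinner x y) \<le> norm x * norm y"
proof (cases "cinner x y = 0")
  case False
  define c where "c = cnj (sgn (cinner x y))"
  have "cinner (c *\<^sub>C x) y = complex_of_real (cmod (cinner x y))"
    using False complex_norm_square[of "cinner x y"] unfolding c_def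
    by (simp add: cinner_scaleC_left sgn_eq field_simps power2_eq_square)
  then have "cmod (cinner x y) = inner (c *\<^sub>C x) y"
    by (simp add: inner_eq_Re_cinner)
  also have "\<dots> \<le> norm (c *\<^sub>C x) * norm y"
    by (rule norm_cauchy_schwarz)
  also have "norm (c *\<^sub>C x) = norm x"
    using False by (simp add: norm_scaleC c_def norm_sgn)
  finally show ?thesis .
qed simp

lemma cinner_left_eqI:
  assumes "\<And>y. cinner x y = cinner x' y"
  shows "x = x'"
proof -
  have "cinner (x - x') (x - x') = 0"
    by (simp add: cinner_diff_left assms)
  then show ?thesis
    by (simp add: cinner_self)
qed

end

lemma bounded_bilinear_cinner: "bounded_bilinear cinner"
proof
  show "\<exists>K. \<forall>a b. norm (cinner a b) \<le> norm a * norm b * K"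
    using cmod_cinner_le by (metis mult.right_neutral)
qed (simp_all add: cinner_add_left cinner_add_right cinner_scaleR_left cinner_scaleR_right
    scaleR_conv_of_real)

lemmas tendsto_cinner [tendsto_intros] = bounded_bilinear.tendsto[OF bounded_bilinear_cinner]
lemmas continuous_on_cinner [continuous_intros] =
  bounded_bilinear.continuous_on[OF bounded_bilinear_cinner]

lemma closed_cinner_eq_0: "closed {x :: 'a::complex_inner. cinner x y = 0}"
  by (intro closed_Collect_eq continuous_intros)

lemma bounded_linear_scaleC: "bounded_linear (\<lambda>x :: 'a::complex_inner. c *\<^sub>C x)"
  by (intro bounded_linear_intro[of _ "cmod c"])
    (auto simp: scaleC_add_right scaleR_eq_scaleC scaleC_scaleC norm_scaleC mult.commute)

lemmas tendsto_scaleC [tendsto_intros] = bounded_linear.tendsto[OF bounded_linear_scaleC]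

lemma cinner_eq_0_iff_commute: "cinner x y = 0 \<longleftrightarrow> cinner y x = 0"
  by (metis cinner_commute complex_cnj_zero)

lemma norm_add_Pythagorean:
  fixes x y :: "'a::complex_inner"
  assumes "cinner x y = 0"
  shows "(norm (x + y))\<^sup>2 = (norm x)\<^sup>2 + (norm y)\<^sup>2"
  using assms cinner_eq_0_iff_commute[of x y]
  by (simp add: power2_norm_eq_inner inner_eq_Re_cinner cinner_add_left cinner_add_right)

subsection \<open>Projection theorem, Riesz representation and adjoints\<close>

text \<open>A minimizing sequence for the distance from \<open>x\<close> to \<open>M\<close> is
  Cauchy by the parallelogram law. Its limit is a nearest point, and a component of
  \<open>x - p\<close> along \<open>M\<close> could be removed to come nearer still.\<close>

theorem exists_orthogonal_projection:
  fixes M :: "'a::complex_hilbert_space set"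
  assumes M: "complex_vector.subspace M" and "closed M"
  shows "\<exists>p\<in>M. \<forall>y\<in>M. cinner (x - p) y = 0"
proof -
  define d where "d = (INF y\<in>M. norm (x - y))"
  have bdd: "bdd_below ((\<lambda>y. norm (x - y)) ` M)"
    by (rule bdd_belowI2[of _ 0]) simp
  have ne: "M \<noteq> {}"
    using complex_vector.subspace_0[OF M] by blast
  have d_le: "d \<le> norm (x - y)" if "y \<in> M" for y
    unfolding d_def using that by (intro cINF_lower bdd)
  have d0: "d \<ge> 0"
    unfolding d_def using ne by (intro cINF_greatest) auto
  have "\<exists>y\<in>M. norm (x - y) < d + 1 / real (Suc n)" for n
    using cINF_less_iff[OF ne bdd, of "d + 1 / real (Suc n)"] by (simp add: d_def)
  then obtain y where y: "\<And>n. y n \<in> M" "\<And>n. norm (x - y n) < d + 1 / real (Suc n)"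
    by metis
  \<comment> \<open>The midpoint of \<open>u\<close> and \<open>v\<close> lies in \<open>M\<close>,
    hence at distance at least \<open>d\<close> from \<open>x\<close>; by the parallelogram identity
    two near-minimizers are close to each other.\<close>
  have par: "(norm (u - v))\<^sup>2 \<le> 2 * ((norm (x - u))\<^sup>2 - d\<^sup>2) + 2 * ((norm (x - v))\<^sup>2 - d\<^sup>2)"
    if "u \<in> M" "v \<in> M" for u v
  proof -
    have mid: "(1/2) *\<^sub>R (u + v) \<in> M"
      by (simp add: scaleR_eq_scaleC complex_vector.subspace_scale[OF M]
          complex_vector.subspace_add[OF M] that)
    have "(norm (u - v))\<^sup>2 = 2 * (norm (x - u))\<^sup>2 + 2 * (norm (x - v))\<^sup>2
        - 4 * (norm (x - (1/2) *\<^sub>R (u + v)))\<^sup>2"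
      by (simp add: power2_norm_eq_inner inner_diff inner_add algebra_simps inner_commute)
    moreover have "d\<^sup>2 \<le> (norm (x - (1/2) *\<^sub>R (u + v)))\<^sup>2"
      using d_le[OF mid] d0 by (rule power_mono)
    ultimately show ?thesis
      by simp
  qed
  have sq: "(\<lambda>n. (d + 1 / real (Suc n))\<^sup>2 - d\<^sup>2) \<longlonglongrightarrow> 0"
    by (rule tendsto_eq_intros LIMSEQ_Suc[OF lim_1_over_n] | simp)+
  have "Cauchy y"
  proof (rule metric_CauchyI)
    fix e :: real assume "e > 0"
    then obtain N where N: "\<And>n. n \<ge> N \<Longrightarrow> norm ((d + 1 / real (Suc n))\<^sup>2 - d\<^sup>2) < e\<^sup>2 / 4"
      using LIMSEQ_D[OF sq, of "e\<^sup>2 / 4"] by auto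
    have *: "(norm (x - y n))\<^sup>2 - d\<^sup>2 < e\<^sup>2 / 4" if "n \<ge> N" for n
    proof -
      have "(norm (x - y n))\<^sup>2 \<le> (d + 1 / real (Suc n))\<^sup>2"
        using y(2)[of n] by (intro power_mono) auto
      then show ?thesis
        using N[OF that] unfolding real_norm_def by linarith
    qed
    have "dist (y m) (y n) < e" if "m \<ge> N" "n \<ge> N" for m n
    proof -
      have "(norm (y m - y n))\<^sup>2 < e\<^sup>2"
        using par[OF y(1) y(1), of m n] *[OF that(1)] *[OF that(2)] by simp
      then show ?thesis
        using \<open>e > 0\<close> by (simp add: dist_norm power2_less_imp_less)
    qed
    then show "\<exists>N. \<forall>m\<ge>N. \<forall>n\<ge>N. dist (y m) (y n) < e"
      by blast
  qed
  then obtain p where p: "y \<longlonglongrightarrow> p"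
    using Cauchy_convergent convergent_def by blast
  have pM: "p \<in> M"
    using \<open>closed M\<close> y(1) p by (rule closed_sequentially)
  have "norm (x - p) \<le> d"
  proof (rule LIMSEQ_le)
    show "(\<lambda>n. norm (x - y n)) \<longlonglongrightarrow> norm (x - p)"
      by (intro tendsto_intros p)
    show "(\<lambda>n. d + 1 / real (Suc n)) \<longlonglongrightarrow> d"
      by (rule tendsto_eq_intros LIMSEQ_Suc[OF lim_1_over_n] | simp)+
    show "\<exists>N. \<forall>n\<ge>N. norm (x - y n) \<le> d + 1 / real (Suc n)"
      using y(2) less_imp_le by blast
  qed
  then have min: "norm (x - p) \<le> norm (x - z)" if "z \<in> M" for z
    using d_le[OF that] by simp
  have "cinner (x - p) v = 0" if "v \<in> M" for v
  proof (cases "v = 0")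
    case False
    \<comment> \<open>\<open>q\<close> is the component of \<open>x - p\<close> along
      \<open>v\<close>. By Pythagoras, moving from \<open>p\<close> to \<open>p + q\<close> lowers
      the squared distance by \<open>(norm q)^2\<close>, so minimality forces
      \<open>q = 0\<close>.\<close>
    define c where "c = cinner (x - p) v / complex_of_real ((norm v)\<^sup>2)"
    define q where "q = c *\<^sub>C v"
    have "p + q \<in> M"
      unfolding q_def
      by (intro complex_vector.subspace_add[OF M] complex_vector.subspace_scale[OF M] pM that)
    then have le: "(norm (x - p))\<^sup>2 \<le> (norm (x - p - q))\<^sup>2"
      using min[of "p + q"] by (simp add: diff_diff_add)
    have "cinner (x - p - q) v = 0"
      using False by (simp add: q_def c_def cinner_diff_left cinner_scaleC_left cinner_self)
    then have "cinner (x - p - q) q = 0"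
      by (simp add: q_def cinner_scaleC_right)
    from norm_add_Pythagorean[OF this] le have "(norm q)\<^sup>2 \<le> 0"
      by simp
    then have "q = 0"
      by simp
    then show ?thesis
      using \<open>cinner (x - p - q) v = 0\<close> by simp
  qed simp
  then show ?thesis
    using pM by blast
qed

definition ortho_proj :: "'a::complex_hilbert_space set \<Rightarrow> 'a \<Rightarrow> 'a" where
  "ortho_proj M x = (SOME p. p \<in> M \<and> (\<forall>y\<in>M. cinner (x - p) y = 0))"

context
  fixes M :: "'a::complex_hilbert_space set"
  assumes M: "complex_vector.subspace M" and cl: "closed M"
begin

lemma ortho_proj_in: "ortho_proj M x \<in> M"
  and ortho_proj_orthogonal: "y \<in> M \<Longrightarrow> cinner (x - ortho_proj M x) y = 0"
  using someI_ex[of "\<lambda>p. p \<in> M \<and> (\<forall>y\<in>M. cinner (x - p) y = 0)"]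
    exists_orthogonal_projection[OF M cl, of x]
  unfolding ortho_proj_def by blast+

lemma ortho_proj_unique:
  assumes "p \<in> M" and "\<And>y. y \<in> M \<Longrightarrow> cinner (x - p) y = 0"
  shows "ortho_proj M x = p"
proof -
  let ?d = "ortho_proj M x - p"
  have "?d \<in> M"
    by (intro complex_vector.subspace_diff[OF M] ortho_proj_in assms(1))
  then have "cinner (x - p) ?d - cinner (x - ortho_proj M x) ?d = 0"
    using assms(2) ortho_proj_orthogonal by simp
  then have "cinner ?d ?d = 0"
    by (simp add: cinner_diff_left)
  then show ?thesis
    by (simp add: cinner_self)
qed

lemma ortho_proj_ident: "x \<in> M \<Longrightarrow> ortho_proj M x = x"
  by (rule ortho_proj_unique) auto

lemma cinner_ortho_proj: "cinner (ortho_proj M x) y = cinner (ortho_proj M x) (ortho_proj M y)"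
  using ortho_proj_orthogonal[OF ortho_proj_in, of y x]
  by (metis cinner_commute cinner_diff_left right_minus_eq)

lemma is_adjoint_ortho_proj: "is_adjoint (ortho_proj M) (ortho_proj M)"
  unfolding is_adjoint_def by (metis cinner_commute cinner_ortho_proj)

lemma norm_ortho_proj_le: "norm (ortho_proj M x) \<le> norm x"
proof -
  have "(norm x)\<^sup>2 = (norm (x - ortho_proj M x))\<^sup>2 + (norm (ortho_proj M x))\<^sup>2"
    using norm_add_Pythagorean[OF ortho_proj_orthogonal[OF ortho_proj_in], of x x] by simp
  then have "(norm (ortho_proj M x))\<^sup>2 \<le> (norm x)\<^sup>2"
    by simp
  then show ?thesis
    by simp
qed

end

section \<open>Bounded operators: linearity, continuity and closure properties\<close>

lemma linear_scaleC_iff: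
  "Vector_Spaces.linear scaleC scaleC T \<longleftrightarrow>
    (\<forall>x y. T (x + y) = T x + T y) \<and> (\<forall>c x. T (c *\<^sub>C x) = c *\<^sub>C T x)"
  by (simp add: Vector_Spaces.linear_def module_hom_def module_hom_axioms_def
      complex_vector.vector_space_axioms complex_vector.module_axioms)

lemma bounded_opsI:
  assumes "\<And>x y. T (x + y) = T x + T y" "\<And>c x. T (c *\<^sub>C x) = c *\<^sub>C T x"
    and "\<And>x. norm (T x) \<le> K * norm x"
  shows "T \<in> bounded_ops"
  using assms unfolding bounded_ops_def linear_scaleC_iff by blast

lemma bounded_ops_add: "T \<in> bounded_ops \<Longrightarrow> T (x + y) = T x + T y"
  and bounded_ops_scaleC: "T \<in> bounded_ops \<Longrightarrow> T (c *\<^sub>C x) = c *\<^sub>C T x"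
  by (simp_all add: bounded_ops_def linear_scaleC_iff)

lemma bounded_ops_bound:
  assumes "T \<in> bounded_ops"
  obtains K where "K > 0" and "\<And>x. norm (T x) \<le> K * norm x"
proof -
  from assms obtain K where K: "\<And>x. norm (T x) \<le> K * norm x"
    by (auto simp: bounded_ops_def)
  have "norm (T x) \<le> (\<bar>K\<bar> + 1) * norm x" for x
    by (rule order_trans[OF K]) (intro mult_right_mono, auto)
  then show thesis
    by (intro that[of "\<bar>K\<bar> + 1"]) auto
qed

lemma bounded_ops_imp_bounded_linear:
  assumes "T \<in> bounded_ops"
  shows "bounded_linear T"
proof -
  obtain K where "\<And>x. norm (T x) \<le> K * norm x"
    using assms bounded_ops_bound by blast
  then have "norm (T x) \<le> norm x * K" for x
    by (simp add: mult.commute)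
  then show ?thesis
    by (rule bounded_linear_intro[rotated 2])
      (simp_all add: bounded_ops_add bounded_ops_scaleC scaleR_eq_scaleC assms)
qed

lemma bounded_ops_scaleR: "T \<in> bounded_ops \<Longrightarrow> T (r *\<^sub>R x) = r *\<^sub>R T x"
  and bounded_ops_zero: "T \<in> bounded_ops \<Longrightarrow> T 0 = 0"
  and bounded_ops_diff: "T \<in> bounded_ops \<Longrightarrow> T (x - y) = T x - T y"
  and bounded_ops_minus: "T \<in> bounded_ops \<Longrightarrow> T (- x) = - T x"
  using bounded_ops_imp_bounded_linear[of T]
  by (auto simp: linear_simps bounded_linear.linear linear_scale linear_0 linear_diff linear_neg)

lemmas bounded_ops_linear = bounded_ops_add bounded_ops_scaleC bounded_ops_scaleR bounded_ops_zero
  bounded_ops_diff bounded_ops_minus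

lemma bounded_ops_tendsto: "T \<in> bounded_ops \<Longrightarrow> (g \<longlongrightarrow> l) F \<Longrightarrow> ((\<lambda>x. T (g x)) \<longlongrightarrow> T l) F"
  by (rule bounded_linear.tendsto[OF bounded_ops_imp_bounded_linear])

lemma bounded_ops_continuous_on:
  "T \<in> bounded_ops \<Longrightarrow> continuous_on S g \<Longrightarrow> continuous_on S (\<lambda>x. T (g x))"
  by (rule bounded_linear.continuous_on[OF bounded_ops_imp_bounded_linear])

lemma bounded_ops_ident: "(\<lambda>x. x) \<in> bounded_ops"
  by (rule bounded_opsI[of _ 1]) auto

lemma bounded_ops_const_zero: "(\<lambda>x. 0) \<in> bounded_ops"
  by (rule bounded_opsI[of _ 0]) auto

lemma bounded_ops_scaleC_op:
  assumes "T \<in> bounded_ops"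
  shows "(\<lambda>x. c *\<^sub>C T x) \<in> bounded_ops"
proof -
  obtain K where K: "\<And>x. norm (T x) \<le> K * norm x"
    using assms bounded_ops_bound by blast
  show ?thesis
  proof (rule bounded_opsI[of _ "cmod c * K"])
    show "norm (c *\<^sub>C T x) \<le> cmod c * K * norm x" for x
      using mult_left_mono[OF K, of "cmod c" x] by (simp add: norm_scaleC mult.assoc)
  qed (simp_all add: bounded_ops_add bounded_ops_scaleC assms scaleC_add_right scaleC_scaleC
      mult.commute)
qed

lemma bounded_ops_scaleR_op: "T \<in> bounded_ops \<Longrightarrow> (\<lambda>x. r *\<^sub>R T x) \<in> bounded_ops"
  by (simp add: scaleR_eq_scaleC bounded_ops_scaleC_op)

lemma bounded_ops_add_op:
  assumes "S \<in> bounded_ops" "T \<in> bounded_ops"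
  shows "(\<lambda>x. S x + T x) \<in> bounded_ops"
proof -
  obtain K where K: "\<And>x. norm (S x) \<le> K * norm x"
    using assms bounded_ops_bound by blast
  obtain J where J: "\<And>x. norm (T x) \<le> J * norm x"
    using assms bounded_ops_bound by blast
  show ?thesis
    by (rule bounded_opsI[of _ "K + J"])
      (auto simp: bounded_ops_linear assms scaleC_add_right distrib_right
        intro!: order_trans[OF norm_triangle_ineq] add_mono K J)
qed

lemma bounded_ops_diff_op:
  assumes "S \<in> bounded_ops" "T \<in> bounded_ops"
  shows "(\<lambda>x. S x - T x) \<in> bounded_ops"
  using bounded_ops_add_op[OF assms(1) bounded_ops_scaleR_op[OF assms(2), of "-1"]] by simp

lemma bounded_ops_compose:
  assumes "S \<in> bounded_ops" "T \<in> bounded_ops"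
  shows "(\<lambda>x. S (T x)) \<in> bounded_ops"
proof -
  obtain K where K: "K > 0" "\<And>x. norm (S x) \<le> K * norm x"
    using assms bounded_ops_bound by blast
  obtain J where J: "\<And>x. norm (T x) \<le> J * norm x"
    using assms bounded_ops_bound by blast
  show ?thesis
    by (rule bounded_opsI[of _ "K * J"])
      (use K in \<open>auto simp: bounded_ops_linear assms mult.assoc
        intro!: order_trans[OF K(2)] mult_left_mono J\<close>)
qed

lemmas bounded_ops_intros = bounded_ops_ident bounded_ops_const_zero bounded_ops_scaleC_op
  bounded_ops_scaleR_op bounded_ops_add_op bounded_ops_diff_op

text \<open>The kernel of a nonzero \<open>f\<close> is a closed hyperplane, and a suitable multiple
  of a vector orthogonal to it represents \<open>f\<close>.\<close>

theorem riesz_representation: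
  fixes f :: "'a::complex_hilbert_space \<Rightarrow> complex"
  assumes add: "\<And>x y. f (x + y) = f x + f y" and scale: "\<And>c x. f (c *\<^sub>C x) = c * f x"
    and bound: "\<And>x. cmod (f x) \<le> K * norm x"
  shows "\<exists>y. \<forall>x. f x = cinner x y"
proof (cases "\<forall>x. f x = 0")
  case True
  then show ?thesis
    by (intro exI[of _ 0]) simp
next
  case False
  then obtain z where z: "f z \<noteq> 0"
    by blast
  let ?M = "{x. f x = 0}"
  have bl: "bounded_linear f"
    by (rule bounded_linear_intro[of _ K])
      (auto simp: add scale scaleR_eq_scaleC scaleC_complex_def bound mult.commute)
  have M: "complex_vector.subspace ?M"
    by (auto simp: complex_vector.subspace_def add scale bl linear_0 bounded_linear.linear)
  have cl: "closed ?M"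
    by (intro closed_Collect_eq bounded_linear.continuous_on[OF bl] continuous_intros)
  define u where "u = z - ortho_proj ?M z"
  have u: "f u = f z"
    using ortho_proj_in[OF M cl, of z] bl by (simp add: u_def linear_diff bounded_linear.linear)
  then have nu: "norm u \<noteq> 0"
    using z linear_0[OF bounded_linear.linear[OF bl]] by auto
  have "f x = cinner x ((cnj (f u) / complex_of_real ((norm u)\<^sup>2)) *\<^sub>C u)" for x
  proof -
    \<comment> \<open>Subtracting the multiple of \<open>u\<close> that has the same value under
      \<open>f\<close> leaves a vector of the kernel, to which \<open>u\<close> is
      orthogonal.\<close>
    have "f (x - (f x / f u) *\<^sub>C u) = 0"
      using z u bl by (simp add: linear_diff bounded_linear.linear scale)
    then have "cinner u (x - (f x / f u) *\<^sub>C u) = 0"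
      unfolding u_def by (intro ortho_proj_orthogonal[OF M cl]) simp
    then have "cinner (x - (f x / f u) *\<^sub>C u) u = 0"
      by (simp add: cinner_eq_0_iff_commute)
    then have "cinner x u = (f x / f u) * complex_of_real ((norm u)\<^sup>2)"
      by (simp add: cinner_diff_left cinner_scaleC_left cinner_self)
    then show ?thesis
      using z u nu by (simp add: cinner_scaleC_right)
  qed
  then show ?thesis
    by blast
qed

text \<open>For fixed \<open>x\<close> the conjugate of \<open>F x\<close> is linear, and Riesz
  representation supplies \<open>T x\<close>. Adjoints, weak limits and compressions are all
  obtained from this.\<close>

theorem sesquilinear_representation:
  fixes F :: "'a::complex_hilbert_space \<Rightarrow> 'a \<Rightarrow> complex"
  assumes "\<And>x x' y. F (x + x') y = F x y + F x' y" and "\<And>c x y. F (c *\<^sub>C x) y = c * F x y"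
    and "\<And>x y y'. F x (y + y') = F x y + F x y'" and "\<And>c x y. F x (c *\<^sub>C y) = cnj c * F x y"
    and "\<And>x y. cmod (F x y) \<le> K * norm x * norm y"
  shows "\<exists>T\<in>bounded_ops. \<forall>x y. F x y = cinner (T x) y"
proof -
  have "\<exists>t. \<forall>y. cnj (F x y) = cinner y t" for x
    by (rule riesz_representation[of _ "K * norm x"]) (auto simp: assms)
  then obtain T where T: "\<And>x y. cnj (F x y) = cinner y (T x)"
    by metis
  have FT: "F x y = cinner (T x) y" for x y
    by (metis T cinner_commute complex_cnj_cnj)
  have "T \<in> bounded_ops"
  proof (rule bounded_opsI[of _ K])
    show "T (x + y) = T x + T y" for x y
      by (rule cinner_left_eqI) (simp add: FT[symmetric] cinner_add_left assms)
    show "T (c *\<^sub>C x) = c *\<^sub>C T x" for c x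
      by (rule cinner_left_eqI) (simp add: FT[symmetric] cinner_scaleC_left assms)
    show "norm (T x) \<le> K * norm x" for x
    proof (cases "T x = 0")
      case True
      \<comment> \<open>The sign of \<open>K\<close> is not given; the bound itself, taken at
        \<open>y = x\<close>, yields \<open>K * norm x \<ge> 0\<close>.\<close>
      have "0 \<le> K * norm x * norm y" for y :: 'a
        using order_trans[OF norm_ge_zero assms(5)] .
      then show ?thesis
        using True by (cases "x = 0") (auto dest: spec[of _ x] simp: zero_le_mult_iff)
    next
      case False
      have "norm (T x) * norm (T x) \<le> (K * norm x) * norm (T x)"
        using assms(5)[of x "T x"] by (simp add: FT cinner_self norm_mult power2_eq_square)
      then show ?thesis
        using False by simp
    qed
  qed
  then show ?thesis
    using FT by blast
qed

lemma exists_adjoint: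
  fixes T :: "'a::complex_hilbert_space \<Rightarrow> 'a"
  assumes T: "T \<in> bounded_ops"
  shows "\<exists>S\<in>bounded_ops. is_adjoint S T"
proof -
  obtain K where K: "K > 0" "\<And>x. norm (T x) \<le> K * norm x"
    using T bounded_ops_bound by blast
  have "\<exists>S\<in>bounded_ops. \<forall>x y. cinner x (T y) = cinner (S x) y"
  proof (rule sesquilinear_representation[of "\<lambda>x y. cinner x (T y)" K])
    show "cmod (cinner x (T y)) \<le> K * norm x * norm y" for x y
      using order_trans[OF cmod_cinner_le mult_left_mono[OF K(2) norm_ge_zero], of x y]
      by (simp add: mult_ac)
  qed (auto simp: T bounded_ops_linear cinner_add_left cinner_add_right cinner_scaleC_left
      cinner_scaleC_right)
  then show ?thesis
    unfolding is_adjoint_def by (metis cinner_commute)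
qed

section \<open>Rules for adjoints\<close>

lemma is_adjoint_commute: "is_adjoint S T \<longleftrightarrow> is_adjoint T S"
  unfolding is_adjoint_def by (metis cinner_commute)

lemma is_adjoint_unique: "is_adjoint S T \<Longrightarrow> is_adjoint S' T \<Longrightarrow> S x = S' x"
  unfolding is_adjoint_commute[of _ T] by (metis cinner_left_eqI is_adjoint_def)

lemma is_adjoint_compose:
  "is_adjoint S T \<Longrightarrow> is_adjoint S' T' \<Longrightarrow> is_adjoint (\<lambda>x. S' (S x)) (\<lambda>x. T (T' x))"
  by (simp add: is_adjoint_def)

lemma is_adjoint_add:
  "is_adjoint S T \<Longrightarrow> is_adjoint S' T' \<Longrightarrow> is_adjoint (\<lambda>x. S x + S' x) (\<lambda>x. T x + T' x)"
  by (simp add: is_adjoint_def cinner_add_left cinner_add_right)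

lemma is_adjoint_diff:
  "is_adjoint S T \<Longrightarrow> is_adjoint S' T' \<Longrightarrow> is_adjoint (\<lambda>x. S x - S' x) (\<lambda>x. T x - T' x)"
  by (simp add: is_adjoint_def cinner_diff_left cinner_diff_right)

lemma is_adjoint_scaleC: "is_adjoint S T \<Longrightarrow> is_adjoint (\<lambda>x. cnj c *\<^sub>C S x) (\<lambda>x. c *\<^sub>C T x)"
  by (simp add: is_adjoint_def cinner_scaleC_left cinner_scaleC_right)

lemma is_adjoint_scaleR: "is_adjoint S T \<Longrightarrow> is_adjoint (\<lambda>x. r *\<^sub>R S x) (\<lambda>x. r *\<^sub>R T x)"
  by (simp add: is_adjoint_def cinner_scaleR_left cinner_scaleR_right)

lemma is_adjoint_ident: "is_adjoint (\<lambda>x. x) (\<lambda>x. x)"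
  by (simp add: is_adjoint_def)

lemma ortho_proj_bounded_ops:
  assumes M: "complex_vector.subspace M" "closed M"
  shows "ortho_proj M \<in> bounded_ops"
proof (rule bounded_opsI[of _ 1])
  note adj = is_adjoint_ortho_proj[OF M, unfolded is_adjoint_def, rule_format]
  show "ortho_proj M (x + y) = ortho_proj M x + ortho_proj M y" for x y
    by (rule cinner_left_eqI) (simp add: adj cinner_add_left)
  show "ortho_proj M (c *\<^sub>C x) = c *\<^sub>C ortho_proj M x" for c x
    by (rule cinner_left_eqI) (simp add: adj cinner_scaleC_left)
qed (simp add: norm_ortho_proj_le[OF M])

text \<open>Invariance of \<open>M\<close> under the adjoint \<open>S\<close> makes \<open>T\<close>
  preserve the orthogonal complement of \<open>M\<close>, so \<open>T\<close> respects the
  orthogonal decomposition of \<open>x\<close>.\<close>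

lemma ortho_proj_commute:
  assumes M: "complex_vector.subspace M" "closed M"
    and "is_adjoint S T" and T: "\<And>x. x \<in> M \<Longrightarrow> T x \<in> M" and S: "\<And>x. x \<in> M \<Longrightarrow> S x \<in> M"
  shows "ortho_proj M (T x) = T (ortho_proj M x)"
proof (rule ortho_proj_unique[OF M])
  show "T (ortho_proj M x) \<in> M"
    by (intro T ortho_proj_in M)
  have ST: "cinner (T x) y = cinner x (S y)" for x y
    using assms(3) by (simp add: is_adjoint_def)
  show "cinner (T x - T (ortho_proj M x)) y = 0" if "y \<in> M" for y
    using ortho_proj_orthogonal[OF M S[OF that], of x] by (simp add: cinner_diff_left ST)
qed

subsection \<open>Maximal abelian selfadjoint algebras\<close>

definition commutant :: "('a::complex_inner \<Rightarrow> 'a) set \<Rightarrow> ('a \<Rightarrow> 'a) set" where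
  "commutant C = {T \<in> bounded_ops. \<forall>S\<in>C. \<forall>x. S (T x) = T (S x)}"

lemma commutant_bounded_ops: "T \<in> commutant C \<Longrightarrow> T \<in> bounded_ops"
  and commutantD: "T \<in> commutant C \<Longrightarrow> S \<in> C \<Longrightarrow> S (T x) = T (S x)"
  by (simp_all add: commutant_def)

lemma commutant_mono: "B \<subseteq> C \<Longrightarrow> commutant C \<subseteq> commutant B"
  by (auto simp: commutant_def)

lemma subset_double_commutant: "C \<subseteq> bounded_ops \<Longrightarrow> C \<subseteq> commutant (commutant C)"
  by (auto simp: commutant_def)

lemma operator_subalgebra_commutant:
  assumes "C \<subseteq> bounded_ops"
  shows "operator_subalgebra (commutant C)"
proof -
  have B: "S \<in> bounded_ops" if "S \<in> C" for S
    using assms that by blast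
  show ?thesis
    unfolding operator_subalgebra_def operator_subspace_def comp_def
    by (intro conjI ballI allI subsetI)
      (simp_all add: commutant_def bounded_ops_intros bounded_ops_compose B bounded_ops_add
        bounded_ops_scaleC bounded_ops_zero)
qed

text \<open>For \<open>R\<close> in \<open>C\<close> with adjoint \<open>Q\<close> in
  \<open>C\<close>, taking adjoints in \<open>Q T = T Q\<close> shows that the adjoint of
  \<open>T\<close> commutes with \<open>R\<close>.\<close>

lemma selfadjoint_commutant:
  fixes C :: "('a::complex_hilbert_space \<Rightarrow> 'a) set"
  assumes "selfadjoint_set C"
  shows "selfadjoint_set (commutant C)"
  unfolding selfadjoint_set_def
proof
  fix T assume T: "T \<in> commutant C"
  then obtain S where S: "S \<in> bounded_ops" "is_adjoint S T"
    using exists_adjoint commutant_bounded_ops by blast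
  have "R (S x) = S (R x)" if R: "R \<in> C" for R x
  proof -
    obtain Q where Q: "Q \<in> C" "is_adjoint Q R"
      using assms R by (auto simp: selfadjoint_set_def)
    then have QR: "is_adjoint R Q"
      by (simp add: is_adjoint_commute)
    have "(\<lambda>x. Q (T x)) = (\<lambda>x. T (Q x))"
      using commutantD[OF T Q(1)] by auto
    then show ?thesis
      using is_adjoint_unique[OF is_adjoint_compose[OF S(2) QR], of "\<lambda>x. S (R x)" x]
        is_adjoint_compose[OF QR S(2)] by simp
  qed
  then have "S \<in> commutant C"
    using S by (simp add: commutant_def)
  then show "\<exists>S\<in>commutant C. is_adjoint S T"
    using S(2) by blast
qed

lemma masaD:
  assumes "masa D"
  shows masa_subset_bounded_ops: "D \<subseteq> bounded_ops"
    and masa_selfadjoint: "selfadjoint_set D"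
    and masa_commute: "S \<in> D \<Longrightarrow> T \<in> D \<Longrightarrow> S (T x) = T (S x)"
    and masa_add: "S \<in> D \<Longrightarrow> T \<in> D \<Longrightarrow> (\<lambda>x. S x + T x) \<in> D"
    and masa_scaleC: "T \<in> D \<Longrightarrow> (\<lambda>x. c *\<^sub>C T x) \<in> D"
    and masa_compose: "S \<in> D \<Longrightarrow> T \<in> D \<Longrightarrow> (\<lambda>x. S (T x)) \<in> D"
proof -
  have *: "operator_subalgebra D" "selfadjoint_set D" "\<And>S T. S \<in> D \<Longrightarrow> T \<in> D \<Longrightarrow> S \<circ> T = T \<circ> S"
    using assms by (auto simp: masa_def abelian_selfadjoint_subalgebra_def)
  show "D \<subseteq> bounded_ops" "selfadjoint_set D"
    "S \<in> D \<Longrightarrow> T \<in> D \<Longrightarrow> (\<lambda>x. S x + T x) \<in> D" "T \<in> D \<Longrightarrow> (\<lambda>x. c *\<^sub>C T x) \<in> D"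
    using * by (simp_all add: operator_subalgebra_def operator_subspace_def)
  show "S (T x) = T (S x)" if "S \<in> D" "T \<in> D"
    using *(3)[OF that] by (metis comp_apply)
  show "(\<lambda>x. S (T x)) \<in> D" if "S \<in> D" "T \<in> D"
    using *(1) that by (auto simp: operator_subalgebra_def comp_def)
qed

text \<open>A selfadjoint \<open>S\<close> commuting with \<open>D\<close> makes \<open>D \<union> {S}\<close> commutative, so that its double
  commutant is again an abelian selfadjoint algebra.\<close>

lemma masa_maximal_selfadjoint:
  fixes D :: "('a::complex_hilbert_space \<Rightarrow> 'a) set"
  assumes D: "masa D" and S: "S \<in> commutant D" "is_adjoint S S"
  shows "S \<in> D"
proof -
  define C where "C = insert S D"
  have C: "C \<subseteq> bounded_ops"
    using S masa_subset_bounded_ops[OF D] commutant_bounded_ops by (auto simp: C_def)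
  have "selfadjoint_set C"
    using masa_selfadjoint[OF D] S(2) by (auto simp: C_def selfadjoint_set_def)
  then have sa: "selfadjoint_set (commutant (commutant C))"
    by (intro selfadjoint_commutant)
  \<comment> \<open>\<open>C\<close> is commutative, so it lies in its commutant. Hence the double
    commutant lies in the commutant too, and its elements commute with each other.\<close>
  have CC: "C \<subseteq> commutant C"
    using C S(1) masa_commute[OF D] by (auto simp: C_def commutant_def)
  then have CCC: "commutant (commutant C) \<subseteq> commutant C"
    by (rule commutant_mono)
  have comm: "T \<circ> T' = T' \<circ> T"
    if "T \<in> commutant (commutant C)" "T' \<in> commutant (commutant C)" for T T'
    using that CCC by (auto simp: fun_eq_iff dest: commutantD)
  have "commutant C \<subseteq> bounded_ops"
    by (auto simp: commutant_bounded_ops)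
  then have "operator_subalgebra (commutant (commutant C))"
    by (rule operator_subalgebra_commutant)
  then have "abelian_selfadjoint_subalgebra (commutant (commutant C))"
    using sa comm by (auto simp: abelian_selfadjoint_subalgebra_def)
  moreover have "C \<subseteq> commutant (commutant C)"
    by (rule subset_double_commutant[OF C])
  ultimately have "commutant (commutant C) = D"
    using D by (auto simp: masa_def C_def)
  then show ?thesis
    using \<open>C \<subseteq> commutant (commutant C)\<close> by (auto simp: C_def)
qed

text \<open>Used with \<open>s\<close> the value of the adjoint of an operator and \<open>t\<close>
  the value of the operator: \<open>s + t\<close> and \<open>\<i> *\<^sub>C (s - t)\<close> are then
  values of selfadjoint operators.\<close>

lemma real_imaginary_part_decomposition:
  fixes s t :: "'a::complex_inner"
  shows "(1/2) *\<^sub>C (s + t) + (\<i>/2) *\<^sub>C (\<i> *\<^sub>C (s - t)) = t"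
proof -
  have "\<i>/2 * \<i> = - (1/2 :: complex)"
    by simp
  then have "(\<i>/2) *\<^sub>C (\<i> *\<^sub>C (s - t)) = (1/2) *\<^sub>C t - (1/2) *\<^sub>C s"
    by (simp only: scaleC_scaleC complex_vector.scale_minus_left
        complex_vector.scale_right_diff_distrib) simp
  then have "(1/2) *\<^sub>C (s + t) + (\<i>/2) *\<^sub>C (\<i> *\<^sub>C (s - t)) = (1/2) *\<^sub>C t + (1/2) *\<^sub>C t"
    by (simp only: scaleC_add_right) simp
  also have "\<dots> = (1/2 + 1/2) *\<^sub>C t"
    by (rule scaleC_add_left[symmetric])
  finally show ?thesis
    by (simp add: scaleC_one)
qed

text \<open>The commutant of \<open>D\<close> is selfadjoint, so it contains the real and imaginary
  parts of \<open>T\<close>; these lie in \<open>D\<close> by the selfadjoint case.\<close>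

lemma masa_maximal:
  fixes D :: "('a::complex_hilbert_space \<Rightarrow> 'a) set"
  assumes D: "masa D" and T: "T \<in> commutant D"
  shows "T \<in> D"
proof -
  obtain S where S: "S \<in> commutant D" "is_adjoint S T"
    using selfadjoint_commutant[OF masa_selfadjoint[OF D]] T by (auto simp: selfadjoint_set_def)
  note ST = S(2)[unfolded is_adjoint_commute[of S]]
  have *: "(\<lambda>x. S x + T x) \<in> commutant D" "(\<lambda>x. \<i> *\<^sub>C (S x - T x)) \<in> commutant D"
    using T S(1) subsetD[OF masa_subset_bounded_ops[OF D]]
    by (simp_all add: commutant_def bounded_ops_add bounded_ops_diff bounded_ops_scaleC
        bounded_ops_intros)
  have "is_adjoint (\<lambda>x. S x + T x) (\<lambda>x. S x + T x)"
    using is_adjoint_add[OF ST S(2)] by (simp add: add.commute)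
  then have 1: "(\<lambda>x. S x + T x) \<in> D"
    using * masa_maximal_selfadjoint[OF D] by blast
  have "is_adjoint (\<lambda>x. \<i> *\<^sub>C (S x - T x)) (\<lambda>x. \<i> *\<^sub>C (S x - T x))"
    using is_adjoint_scaleC[OF is_adjoint_diff[OF ST S(2)], of \<i>]
    by (simp add: complex_vector.scale_right_diff_distrib complex_vector.scale_minus_left)
  then have 2: "(\<lambda>x. \<i> *\<^sub>C (S x - T x)) \<in> D"
    using * masa_maximal_selfadjoint[OF D] by blast
  have "T = (\<lambda>x. (1/2) *\<^sub>C (S x + T x) + (\<i>/2) *\<^sub>C (\<i> *\<^sub>C (S x - T x)))"
    by (simp only: real_imaginary_part_decomposition)
  then show ?thesis
    using masa_add[OF D masa_scaleC[OF D 1, of "1/2"] masa_scaleC[OF D 2, of "\<i>/2"]] by metis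
qed

lemma masa_ident:
  fixes D :: "('a::complex_hilbert_space \<Rightarrow> 'a) set"
  shows "masa D \<Longrightarrow> (\<lambda>x. x) \<in> D"
  by (rule masa_maximal) (auto simp: commutant_def bounded_ops_ident)

lemma masa_diff:
  assumes D: "masa D" and "S \<in> D" "T \<in> D"
  shows "(\<lambda>x. S x - T x) \<in> D"
  using masa_add[OF D \<open>S \<in> D\<close> masa_scaleC[OF D \<open>T \<in> D\<close>, of "-1"]]
  by (simp add: complex_vector.scale_minus_left scaleC_one)

lemma masa_scaleR: "masa D \<Longrightarrow> T \<in> D \<Longrightarrow> (\<lambda>x. r *\<^sub>R T x) \<in> D"
  by (simp add: scaleR_eq_scaleC masa_scaleC)

section \<open>Orthogonal projections as operators\<close>

definition is_projection :: "('a::complex_inner \<Rightarrow> 'a) \<Rightarrow> bool" where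
  "is_projection P \<longleftrightarrow> P \<in> bounded_ops \<and> is_adjoint P P \<and> (\<forall>x. P (P x) = P x)"

lemma is_projectionD:
  assumes "is_projection P"
  shows projection_bounded_ops: "P \<in> bounded_ops"
    and projection_adjoint: "is_adjoint P P"
    and projection_cinner: "cinner (P x) y = cinner x (P y)"
    and projection_idem: "P (P x) = P x"
  using assms by (auto simp: is_projection_def is_adjoint_def)

lemma is_projection_ortho_proj:
  "complex_vector.subspace M \<Longrightarrow> closed M \<Longrightarrow> is_projection (ortho_proj M)"
  by (simp add: is_projection_def ortho_proj_bounded_ops is_adjoint_ortho_proj ortho_proj_ident
      ortho_proj_in)

lemma is_projection_compl:
  assumes "is_projection P"
  shows "is_projection (\<lambda>x. x - P x)"
  using is_projectionD[OF assms] unfolding is_projection_def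
  by (simp add: bounded_ops_diff bounded_ops_diff_op bounded_ops_ident is_adjoint_diff
      is_adjoint_ident)

lemma is_projection_compose:
  assumes "is_projection P" "is_projection Q" "\<And>x. P (Q x) = Q (P x)"
  shows "is_projection (\<lambda>x. P (Q x))"
proof -
  have "is_adjoint (\<lambda>x. P (Q x)) (\<lambda>x. P (Q x))"
    using is_adjoint_compose[of P P Q Q] assms by (simp add: projection_adjoint)
  moreover have "P (Q (P (Q x))) = P (Q x)" for x
    using assms by (metis projection_idem)
  ultimately show ?thesis
    unfolding is_projection_def
    using bounded_ops_compose[OF projection_bounded_ops projection_bounded_ops] assms by blast
qed

lemma projection_norm_add:
  assumes "is_projection P"
  shows "(norm x)\<^sup>2 = (norm (P x))\<^sup>2 + (norm (x - P x))\<^sup>2"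
proof -
  have "cinner (P x) (x - P x) = 0"
    using is_projectionD[OF assms] by (simp add: bounded_ops_linear)
  from norm_add_Pythagorean[OF this] show ?thesis
    by simp
qed

lemma projection_norm_le: "is_projection P \<Longrightarrow> norm (P x) \<le> norm x"
  using projection_norm_add[of P x] by (auto intro: power2_le_imp_le[OF _ norm_ge_zero])

subsection \<open>Spectral projections\<close>

text \<open>The quadratic polynomial in \<open>t\<close> given by the form of \<open>B\<close> at
  \<open>x + t *\<^sub>R y\<close> is nonnegative, so its discriminant is nonpositive.\<close>

lemma positive_operator_cauchy_schwarz:
  fixes B :: "'a::complex_inner \<Rightarrow> 'a"
  assumes B: "B \<in> bounded_ops" "is_adjoint B B" and pos: "\<And>x. 0 \<le> Re (cinner (B x) x)"
  shows "(Re (cinner (B x) y))\<^sup>2 \<le> Re (cinner (B x) x) * Re (cinner (B y) y)"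
proof -
  let ?a = "Re (cinner (B x) x)" and ?b = "Re (cinner (B x) y)" and ?c = "Re (cinner (B y) y)"
  have sym: "Re (cinner (B y) x) = ?b"
    using B(2) inner_commute[of y "B x"] by (simp add: is_adjoint_def inner_eq_Re_cinner)
  have quad: "0 \<le> ?a + 2 * t * ?b + t\<^sup>2 * ?c" for t
  proof -
    have "Re (cinner (B (x + t *\<^sub>R y)) (x + t *\<^sub>R y)) = ?a + 2 * t * ?b + t\<^sup>2 * ?c"
      by (simp add: B bounded_ops_linear cinner_add_left cinner_add_right cinner_scaleR_left
          cinner_scaleR_right sym power2_eq_square algebra_simps)
    then show ?thesis
      using pos by metis
  qed
  show ?thesis
  proof (cases "?c = 0")
    case True
    have "?b = 0"
    proof (rule ccontr)
      assume "?b \<noteq> 0"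
      \<comment> \<open>With \<open>?c = 0\<close> the polynomial is affine in \<open>t\<close>, and
        this \<open>t\<close> would give it the value -1.\<close>
      then have "2 * (- (?a + 1) / (2 * ?b)) * ?b = - (?a + 1)"
        by simp
      then show False
        using quad[of "- (?a + 1) / (2 * ?b)"] True by simp
    qed
    then show ?thesis
      using True by simp
  next
    case False
    then have "?c > 0"
      using pos[of y] by simp
    have "2 * (- ?b / ?c) * ?b + (- ?b / ?c)\<^sup>2 * ?c = - (?b\<^sup>2 / ?c)"
      using False by (simp add: power2_eq_square)
    then have "?b\<^sup>2 / ?c \<le> ?a"
      using quad[of "- ?b / ?c"] by linarith
    then show ?thesis
      using \<open>?c > 0\<close> by (simp add: pos_divide_le_eq)
  qed
qed

text \<open>Cauchy-Schwarz for the form of \<open>B\<close>, applied to the pair \<open>x\<close>,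
  \<open>B x\<close>, bounds the fourth power of \<open>norm (B x)\<close> by
  \<open>r^2 (norm x)^2 (norm (B x))^2\<close>.\<close>

lemma positive_operator_norm_le:
  fixes B :: "'a::complex_inner \<Rightarrow> 'a"
  assumes B: "B \<in> bounded_ops" "is_adjoint B B" and pos: "\<And>x. 0 \<le> Re (cinner (B x) x)"
    and le: "\<And>x. Re (cinner (B x) x) \<le> r * (norm x)\<^sup>2"
  shows "norm (B x) \<le> r * norm x"
proof (cases "B x = 0")
  case True
  have "0 \<le> r * (norm x)\<^sup>2"
    using pos[of x] le[of x] by linarith
  then show ?thesis
    using True by (cases "x = 0") (auto simp: zero_le_mult_iff)
next
  case False
  then have "x \<noteq> 0"
    using B bounded_ops_zero by blast
  have "0 \<le> r * (norm x)\<^sup>2"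
    using pos[of x] le[of x] by linarith
  then have r: "r \<ge> 0"
    using \<open>x \<noteq> 0\<close> by (simp add: zero_le_mult_iff)
  have "((norm (B x))\<^sup>2)\<^sup>2 = (Re (cinner (B x) (B x)))\<^sup>2"
    by (simp add: cinner_self)
  also have "\<dots> \<le> Re (cinner (B x) x) * Re (cinner (B (B x)) (B x))"
    by (rule positive_operator_cauchy_schwarz[OF B pos])
  also have "\<dots> \<le> (r * (norm x)\<^sup>2) * (r * (norm (B x))\<^sup>2)"
    by (rule mult_mono[OF le le]) (use pos r in auto)
  finally have "(norm (B x))\<^sup>2 * (norm (B x))\<^sup>2 \<le> (r * norm x)\<^sup>2 * (norm (B x))\<^sup>2"
    by (simp add: power2_eq_square mult_ac)
  then have "(norm (B x))\<^sup>2 \<le> (r * norm x)\<^sup>2"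
    by (rule mult_right_le_imp_le) (use False in simp)
  then show ?thesis
    by (rule power2_le_imp_le) (use r in simp)
qed

text \<open>Writing the absolute value of a selfadjoint contraction \<open>A\<close> as \<open>1 - Y\<close>, the condition
  \<open>(1 - Y)\<^sup>2 = A\<^sup>2\<close> becomes the fixed point equation \<open>Y = (Z + Y\<^sup>2) / 2\<close> with \<open>Z = 1 - A\<^sup>2\<close>. The
  iterates of its right hand side are dominated by those of the scalar map \<open>r \<mapsto> (1 + r\<^sup>2) / 2\<close>.\<close>

fun sqrt_iter :: "('a::real_vector \<Rightarrow> 'a) \<Rightarrow> nat \<Rightarrow> 'a \<Rightarrow> 'a" where
  "sqrt_iter Z 0 = (\<lambda>x. 0)"
| "sqrt_iter Z (Suc n) = (\<lambda>x. (1/2) *\<^sub>R (Z x + sqrt_iter Z n (sqrt_iter Z n x)))"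

fun sqrt_bound :: "nat \<Rightarrow> real" where
  "sqrt_bound 0 = 0"
| "sqrt_bound (Suc n) = (1 + (sqrt_bound n)\<^sup>2) / 2"

lemma sqrt_bound_range: "0 \<le> sqrt_bound n \<and> sqrt_bound n \<le> 1"
  by (induction n) (auto simp: power_le_one)

lemma sqrt_bound_mono: "mono sqrt_bound"
proof (rule incseq_SucI)
  show "sqrt_bound n \<le> sqrt_bound (Suc n)" for n
    using zero_le_power2[of "1 - sqrt_bound n"] by (simp add: power2_diff)
qed

section \<open>Convergence of the square root iteration\<close>

context
  fixes Z :: "'a::complex_hilbert_space \<Rightarrow> 'a"
  assumes Z: "Z \<in> bounded_ops" "is_adjoint Z Z" "\<And>x. norm (Z x) \<le> norm x"
begin

lemma sqrt_iter_bounded_ops: "sqrt_iter Z n \<in> bounded_ops"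
  by (induction n) (simp_all add: bounded_ops_intros bounded_ops_compose Z)

lemma sqrt_iter_adjoint: "is_adjoint (sqrt_iter Z n) (sqrt_iter Z n)"
  by (induction n)
    (simp_all add: is_adjoint_def[of "\<lambda>x. 0"] is_adjoint_add is_adjoint_compose is_adjoint_scaleR Z)

text \<open>Each iterate is a polynomial in \<open>Z\<close>. In particular the iterates commute
  with one another.\<close>

lemma sqrt_iter_commute:
  assumes "C \<in> bounded_ops" "\<And>x. C (Z x) = Z (C x)"
  shows "C (sqrt_iter Z n x) = sqrt_iter Z n (C x)"
  using assms by (induction n arbitrary: x) (simp_all add: bounded_ops_linear)

lemma sqrt_iter_commute_self: "sqrt_iter Z m (sqrt_iter Z n x) = sqrt_iter Z n (sqrt_iter Z m x)"
  by (intro sqrt_iter_commute sqrt_iter_bounded_ops sqrt_iter_commute[symmetric] Z refl)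

lemma sqrt_iter_norm_le: "norm (sqrt_iter Z n x) \<le> sqrt_bound n * norm x"
proof (induction n arbitrary: x)
  case (Suc n)
  let ?w = "Z x + sqrt_iter Z n (sqrt_iter Z n x)"
  have "norm (sqrt_iter Z n (sqrt_iter Z n x)) \<le> sqrt_bound n * (sqrt_bound n * norm x)"
    using order_trans[OF Suc mult_left_mono[OF Suc]] sqrt_bound_range by blast
  then have "norm ?w \<le> norm x + sqrt_bound n * (sqrt_bound n * norm x)"
    using norm_triangle_ineq[of "Z x" "sqrt_iter Z n (sqrt_iter Z n x)"] Z(3)[of x] by linarith
  moreover have "norm (sqrt_iter Z (Suc n) x) = norm ?w / 2"
    by (simp del: scaleR_right_distrib scaleR_add_right)
  ultimately show ?case
    by (simp add: power2_eq_square field_simps del: sqrt_iter.simps)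
qed simp

text \<open>Commuting iterates give \<open>Y'^2 - Y^2 = (Y' - Y) (Y' + Y)\<close>; the scalar
  sequence obeys the same factorization with equality, so the estimate propagates.\<close>

lemma sqrt_iter_diff_Suc:
  "norm (sqrt_iter Z (Suc n) x - sqrt_iter Z n x) \<le> (sqrt_bound (Suc n) - sqrt_bound n) * norm x"
proof (induction n arbitrary: x)
  case 0
  show ?case
    using Z(3)[of x] by simp
next
  case (Suc n)
  let ?Y = "sqrt_iter Z n" and ?Y' = "sqrt_iter Z (Suc n)"
  let ?w = "?Y' x + ?Y x"
  have "sqrt_iter Z (Suc (Suc n)) x - ?Y' x = (1/2) *\<^sub>R (?Y' (?Y' x) - ?Y (?Y x))"
    by (simp add: scaleR_right_diff_distrib scaleR_right_distrib)
  also have "?Y' (?Y' x) - ?Y (?Y x) = ?Y' ?w - ?Y ?w"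
    by (simp only: bounded_ops_add[OF sqrt_iter_bounded_ops] sqrt_iter_commute_self[of n "Suc n"])
      simp
  finally have "norm (sqrt_iter Z (Suc (Suc n)) x - ?Y' x) = norm (?Y' ?w - ?Y ?w) / 2"
    by simp
  also have "\<dots> \<le> (sqrt_bound (Suc n) - sqrt_bound n) * norm ?w / 2"
    using Suc[of ?w] by simp
  also have "\<dots> \<le> (sqrt_bound (Suc n) - sqrt_bound n)
      * (sqrt_bound (Suc n) * norm x + sqrt_bound n * norm x) / 2"
    using sqrt_bound_mono[THEN monoD, of n "Suc n"]
    by (intro divide_right_mono mult_left_mono order_trans[OF norm_triangle_ineq] add_mono
        sqrt_iter_norm_le) auto
  also have "\<dots> = (sqrt_bound (Suc (Suc n)) - sqrt_bound (Suc n)) * norm x"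
    by (simp add: power2_eq_square field_simps)
  finally show ?case .
qed

lemma sqrt_iter_diff:
  "m \<le> n \<Longrightarrow> norm (sqrt_iter Z n x - sqrt_iter Z m x) \<le> (sqrt_bound n - sqrt_bound m) * norm x"
proof (induction n rule: dec_induct)
  case (step n)
  have "norm (sqrt_iter Z (Suc n) x - sqrt_iter Z m x)
      \<le> norm (sqrt_iter Z (Suc n) x - sqrt_iter Z n x) + norm (sqrt_iter Z n x - sqrt_iter Z m x)"
    using norm_triangle_ineq[of "sqrt_iter Z (Suc n) x - sqrt_iter Z n x"
        "sqrt_iter Z n x - sqrt_iter Z m x"] by (simp del: sqrt_iter.simps)
  then show ?case
    using step.IH sqrt_iter_diff_Suc[of n x] by (simp only: left_diff_distrib)
qed simp

text \<open>Differences of iterates are dominated by those of \<open>sqrt_bound\<close>, which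
  converges because it is increasing and bounded by 1.\<close>

lemma sqrt_iter_convergent: "convergent (\<lambda>n. sqrt_iter Z n x)"
proof -
  have "Bseq sqrt_bound"
    by (rule BseqI'[of _ 1]) (use sqrt_bound_range in \<open>auto simp: abs_le_iff intro: order_trans\<close>)
  then have "convergent sqrt_bound"
    using sqrt_bound_mono by (intro Bseq_monoseq_convergent) (simp_all add: monoseq_iff)
  then have C: "Cauchy (\<lambda>n. sqrt_bound n * norm x)"
    by (intro convergent_Cauchy convergent_mult convergent_const)
  have le: "dist (sqrt_iter Z m x) (sqrt_iter Z n x) \<le> dist (sqrt_bound m * norm x) (sqrt_bound n * norm x)"
    for m n
    using sqrt_iter_diff[of m n x] sqrt_iter_diff[of n m x]
    by (cases m n rule: le_cases) (auto simp: dist_norm norm_minus_commute left_diff_distrib)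
  have "Cauchy (\<lambda>n. sqrt_iter Z n x)"
  proof (rule metric_CauchyI)
    fix e :: real assume "e > 0"
    then show "\<exists>N. \<forall>m\<ge>N. \<forall>n\<ge>N. dist (sqrt_iter Z m x) (sqrt_iter Z n x) < e"
      using C le_less_trans[OF le] unfolding Cauchy_def by fast
  qed
  then show ?thesis
    by (rule Cauchy_convergent)
qed

lemma exists_sqrt_iter_limit:
  "\<exists>Y\<in>bounded_ops. is_adjoint Y Y \<and> (\<forall>x. norm (Y x) \<le> norm x) \<and>
     (\<forall>x. Y x = (1/2) *\<^sub>R (Z x + Y (Y x))) \<and>
     (\<forall>C\<in>bounded_ops. (\<forall>x. C (Z x) = Z (C x)) \<longrightarrow> (\<forall>x. C (Y x) = Y (C x)))"
proof -
  define Y where "Y x = lim (\<lambda>n. sqrt_iter Z n x)" for x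
  have lim: "(\<lambda>n. sqrt_iter Z n x) \<longlonglongrightarrow> Y x" for x
    unfolding Y_def using sqrt_iter_convergent by (simp add: convergent_LIMSEQ_iff)
  note uniq = LIMSEQ_unique[OF lim]
  have le: "norm (sqrt_iter Z n x) \<le> norm x" for n x
    using sqrt_iter_norm_le[of n x] sqrt_bound_range[of n] mult_right_mono[of "sqrt_bound n" 1 "norm x"]
    by simp
  have nY: "norm (Y x) \<le> norm x" for x
    by (rule Lim_bounded[OF tendsto_norm[OF lim]]) (use le in auto)
  have YB: "Y \<in> bounded_ops"
  proof (rule bounded_opsI[of _ 1])
    show "Y (x + y) = Y x + Y y" for x y
      by (rule uniq) (use tendsto_add[OF lim lim, of x y] in
          \<open>simp add: bounded_ops_add[OF sqrt_iter_bounded_ops]\<close>)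
    show "Y (c *\<^sub>C x) = c *\<^sub>C Y x" for c x
      by (rule uniq) (use tendsto_scaleC[OF lim, of c x] in
          \<open>simp add: bounded_ops_scaleC[OF sqrt_iter_bounded_ops]\<close>)
  qed (simp add: nY)
  have adj: "is_adjoint Y Y"
    unfolding is_adjoint_def
  proof (intro allI)
    show "cinner (Y x) y = cinner x (Y y)" for x y
      using LIMSEQ_unique[OF tendsto_cinner[OF lim[of x] tendsto_const[of y]]]
        tendsto_cinner[OF tendsto_const[of x] lim[of y]] sqrt_iter_adjoint
      by (simp add: is_adjoint_def)
  qed
  \<comment> \<open>The iterates are uniformly bounded, so in
    \<open>Y_n (Y_n x - Y x) + Y_n (Y x)\<close> the first summand tends to 0.\<close>
  have sq: "(\<lambda>n. sqrt_iter Z n (sqrt_iter Z n x)) \<longlonglongrightarrow> Y (Y x)" for x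
  proof -
    have "(\<lambda>n. sqrt_iter Z n (sqrt_iter Z n x - Y x)) \<longlonglongrightarrow> 0"
    proof (rule Lim_null_comparison)
      show "\<forall>\<^sub>F n in sequentially. norm (sqrt_iter Z n (sqrt_iter Z n x - Y x))
          \<le> norm (sqrt_iter Z n x - Y x)"
        using le by simp
      show "(\<lambda>n. norm (sqrt_iter Z n x - Y x)) \<longlonglongrightarrow> 0"
        using lim LIM_zero_iff tendsto_norm_zero by blast
    qed
    from tendsto_add[OF this lim[of "Y x"]] show ?thesis
      by (simp add: bounded_ops_diff[OF sqrt_iter_bounded_ops])
  qed
  have "Y x = (1/2) *\<^sub>R (Z x + Y (Y x))" for x
  proof -
    have "(\<lambda>n. sqrt_iter Z (Suc n) x) \<longlonglongrightarrow> (1/2) *\<^sub>R (Z x + Y (Y x))"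
      by (simp only: sqrt_iter.simps) (intro tendsto_intros sq)
    then show ?thesis
      using LIMSEQ_unique[OF LIMSEQ_Suc[OF lim]] by blast
  qed
  moreover have "C (Y x) = Y (C x)"
    if "C \<in> bounded_ops" "\<And>x. C (Z x) = Z (C x)" for C x
    using uniq[of "C x"] bounded_ops_tendsto[OF that(1) lim[of x]] sqrt_iter_commute[OF that]
    by simp
  ultimately show ?thesis
    using YB adj nY by blast
qed

end

text \<open>After \<open>A\<close> is scaled to a contraction, \<open>B = K (1 - Y)\<close> with
  \<open>Y\<close> the fixed point squares to \<open>A^2\<close>, and it is positive because
  \<open>Y\<close> is a contraction. The last clause is what later places \<open>B\<close> in
  \<open>D\<close>.\<close>

theorem exists_absolute_value:
  fixes A :: "'a::complex_hilbert_space \<Rightarrow> 'a"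
  assumes A: "A \<in> bounded_ops" "is_adjoint A A"
  shows "\<exists>B\<in>bounded_ops. is_adjoint B B \<and> (\<forall>x. 0 \<le> Re (cinner (B x) x)) \<and>
     (\<forall>x. B (B x) = A (A x)) \<and>
     (\<forall>C\<in>bounded_ops. (\<forall>x. C (A x) = A (C x)) \<longrightarrow> (\<forall>x. C (B x) = B (C x)))"
proof -
  obtain K where K: "K > 0" "\<And>x. norm (A x) \<le> K * norm x"
    using A bounded_ops_bound by blast
  define A' where "A' = (\<lambda>x. (1/K) *\<^sub>R A x)"
  define Z where "Z = (\<lambda>x. x - A' (A' x))"
  have A': "A' \<in> bounded_ops" "is_adjoint A' A'" "\<And>x. norm (A' x) \<le> norm x"
    using K(1) K(2) A by (simp_all add: A'_def bounded_ops_scaleR_op is_adjoint_scaleR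
        divide_le_eq mult.commute)
  have ZB: "Z \<in> bounded_ops" and Zadj: "is_adjoint Z Z"
    unfolding Z_def by (simp_all add: bounded_ops_intros bounded_ops_compose is_adjoint_diff
        is_adjoint_ident is_adjoint_compose A')
  have Zn: "norm (Z x) \<le> norm x" for x
  proof -
    have "(norm (Z x))\<^sup>2 = (norm x)\<^sup>2 - 2 * inner x (A' (A' x)) + (norm (A' (A' x)))\<^sup>2"
      by (simp add: Z_def power2_norm_eq_inner inner_diff inner_commute)
    also have "inner x (A' (A' x)) = (norm (A' x))\<^sup>2"
      using A'(2) by (metis inner_eq_Re_cinner is_adjoint_def power2_norm_eq_inner)
    also have "(norm (A' (A' x)))\<^sup>2 \<le> (norm (A' x))\<^sup>2"
      by (intro power_mono A') simp
    finally have "(norm (Z x))\<^sup>2 \<le> (norm x)\<^sup>2"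
      using zero_le_power2[of "norm (A' x)"] by linarith
    then show ?thesis
      by simp
  qed
  obtain Y where Y: "Y \<in> bounded_ops" "is_adjoint Y Y" "\<And>x. norm (Y x) \<le> norm x"
    and fix_Y: "\<And>x. Y x = (1/2) *\<^sub>R (Z x + Y (Y x))"
    and comm: "\<And>C x. C \<in> bounded_ops \<Longrightarrow> (\<And>x. C (Z x) = Z (C x)) \<Longrightarrow> C (Y x) = Y (C x)"
    using exists_sqrt_iter_limit[OF ZB Zadj Zn] by metis
  define B where "B = (\<lambda>x. K *\<^sub>R (x - Y x))"
  have "B \<in> bounded_ops" "is_adjoint B B"
    unfolding B_def by (simp_all add: bounded_ops_intros is_adjoint_diff is_adjoint_ident
        is_adjoint_scaleR Y)
  moreover have "0 \<le> Re (cinner (B x) x)" for x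
  proof -
    have "inner (Y x) x \<le> norm x * norm x"
      using order_trans[OF norm_cauchy_schwarz mult_right_mono[OF Y(3) norm_ge_zero]] .
    then have "0 \<le> K * (inner x x - inner (Y x) x)"
      using K by (simp add: power2_norm_eq_inner[symmetric] power2_eq_square)
    then show ?thesis
      by (simp add: B_def cinner_scaleR_left cinner_diff_left inner_eq_Re_cinner)
  qed
  moreover have "B (B x) = A (A x)" for x
  proof -
    have "2 *\<^sub>R Y x = Z x + Y (Y x)"
      by (subst fix_Y) simp
    then have "x - 2 *\<^sub>R Y x + Y (Y x) = A' (A' x)"
      by (simp add: Z_def)
    then have "x - Y x - Y (x - Y x) = A' (A' x)"
      by (simp add: Y bounded_ops_linear scaleR_2 algebra_simps)
    moreover have "B (B x) = (K * K) *\<^sub>R (x - Y x - Y (x - Y x))"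
      by (simp add: B_def Y bounded_ops_linear scaleR_right_diff_distrib)
    moreover have "(K * K) *\<^sub>R A' (A' x) = A (A x)"
      using K(1) by (simp add: A'_def A bounded_ops_linear)
    ultimately show ?thesis
      by simp
  qed
  moreover have "C (B x) = B (C x)" if C: "C \<in> bounded_ops" "\<And>x. C (A x) = A (C x)" for C x
  proof -
    have "C (Z x) = Z (C x)" for x
      by (simp add: Z_def A'_def C A bounded_ops_linear)
    then show ?thesis
      by (simp add: B_def comm C bounded_ops_linear)
  qed
  ultimately show ?thesis
    by blast
qed

section \<open>Spectral projections inside \<open>D\<close>\<close>

lemma masa_ortho_proj:
  fixes D :: "('a::complex_hilbert_space \<Rightarrow> 'a) set"
  assumes D: "masa D" and M: "complex_vector.subspace M" "closed M"
    and inv: "\<And>T x. T \<in> D \<Longrightarrow> x \<in> M \<Longrightarrow> T x \<in> M"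
  shows "ortho_proj M \<in> D"
proof (rule masa_maximal[OF D])
  \<comment> \<open>\<open>D\<close> is selfadjoint, so its invariant subspace \<open>M\<close> is
    also invariant under the adjoint of \<open>T\<close>.\<close>
  have "T (ortho_proj M x) = ortho_proj M (T x)" if T: "T \<in> D" for T x
  proof -
    obtain S where "S \<in> D" "is_adjoint S T"
      using masa_selfadjoint[OF D] T by (auto simp: selfadjoint_set_def)
    then show ?thesis
      using ortho_proj_commute[OF M, of S T x] inv T by metis
  qed
  then show "ortho_proj M \<in> commutant D"
    by (simp add: commutant_def ortho_proj_bounded_ops M)
qed

text \<open>With \<open>B = \<bar>A\<bar>\<close>, the projection onto the kernel of \<open>B - A\<close> separates the positive from the
  negative part of \<open>A\<close>, because \<open>(B - A) (B + A) = 0\<close>.\<close>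

theorem spectral_split:
  fixes D :: "('a::complex_hilbert_space \<Rightarrow> 'a) set"
  assumes D: "masa D" and A: "A \<in> D" "is_adjoint A A"
  shows "\<exists>P\<in>D. is_projection P \<and> (\<forall>x. 0 \<le> Re (cinner (A (P x)) (P x))) \<and>
     (\<forall>x. Re (cinner (A (x - P x)) (x - P x)) \<le> 0)"
proof -
  have DB: "T \<in> bounded_ops" if "T \<in> D" for T
    using that masa_subset_bounded_ops[OF D] by blast
  obtain B where B: "B \<in> bounded_ops" "is_adjoint B B" "\<And>x. 0 \<le> Re (cinner (B x) x)"
    and BB: "\<And>x. B (B x) = A (A x)"
    and comm: "\<And>C x. C \<in> bounded_ops \<Longrightarrow> (\<And>x. C (A x) = A (C x)) \<Longrightarrow> C (B x) = B (C x)"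
    using exists_absolute_value[OF DB[OF A(1)] A(2)] by metis
  note AB = DB[OF A(1)]
  have BD: "B \<in> D"
    using comm DB masa_commute[OF D] A(1) B(1)
    by (intro masa_maximal[OF D]) (auto simp: commutant_def)
  define M where "M = {x. B x = A x}"
  have M: "complex_vector.subspace M"
    by (auto simp: M_def complex_vector.subspace_def B(1) AB bounded_ops_linear)
  have cl: "closed M"
    unfolding M_def
    by (intro closed_Collect_eq bounded_ops_continuous_on[OF B(1)] bounded_ops_continuous_on[OF AB]
        continuous_on_id)
  define P where "P = ortho_proj M"
  have PD: "P \<in> D"
    unfolding P_def
  proof (rule masa_ortho_proj[OF D M cl])
    show "T x \<in> M" if "T \<in> D" "x \<in> M" for T x
      using that masa_commute[OF D BD that(1), of x] masa_commute[OF D A(1) that(1), of x]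
      by (simp add: M_def)
  qed
  have P: "is_projection P"
    unfolding P_def by (rule is_projection_ortho_proj[OF M cl])
  have P_in: "B (P x) = A (P x)" for x
    using ortho_proj_in[OF M cl, of x] by (simp add: P_def M_def)
  have "B (x - P x) = - A (x - P x)" for x
  proof -
    \<comment> \<open>Since \<open>A\<close> and \<open>B\<close> commute and have equal squares,
      \<open>B + A\<close> maps into \<open>M\<close>. So \<open>P\<close> fixes its values, and
      \<open>B + A\<close> vanishes on the orthogonal complement of \<open>M\<close>.\<close>
    have "B (B x + A x) = A (B x + A x)"
      by (simp add: bounded_ops_linear B AB BB masa_commute[OF D A(1) BD])
    then have "P (B x + A x) = B x + A x"
      unfolding P_def by (intro ortho_proj_ident[OF M cl]) (simp add: M_def)
    moreover have "P (B x + A x) = B (P x) + A (P x)"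
      by (simp add: bounded_ops_linear projection_bounded_ops[OF P] masa_commute[OF D PD BD]
          masa_commute[OF D PD A(1)])
    moreover have "B (x - P x) + A (x - P x) = B x + A x - (B (P x) + A (P x))"
      by (simp add: bounded_ops_diff[OF B(1)] bounded_ops_diff[OF AB])
    ultimately have "B (x - P x) + A (x - P x) = 0"
      by simp
    then show ?thesis
      by (simp add: eq_neg_iff_add_eq_0)
  qed
  then have "A (x - P x) = - B (x - P x)" for x
    by simp
  then have "Re (cinner (A (x - P x)) (x - P x)) \<le> 0" for x
    using B(3)[of "x - P x"] by (simp only: flip: inner_eq_Re_cinner) simp
  moreover have "0 \<le> Re (cinner (A (P x)) (P x))" for x
    using B(3)[of "P x"] P_in by simp
  ultimately show ?thesis
    using PD P by blast
qed

text \<open>This is the split at 0 for \<open>A - m\<close>: \<open>P\<close> projects onto a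
  subspace where \<open>A\<close> is at least \<open>m\<close>, its complement onto one where
  \<open>A\<close> is at most \<open>m\<close>.\<close>

lemma spectral_split_at:
  fixes D :: "('a::complex_hilbert_space \<Rightarrow> 'a) set"
  assumes D: "masa D" and A: "A \<in> D" "is_adjoint A A"
  shows "\<exists>P\<in>D. is_projection P \<and> (\<forall>x. m * (norm (P x))\<^sup>2 \<le> Re (cinner (A (P x)) (P x))) \<and>
     (\<forall>x. Re (cinner (A (x - P x)) (x - P x)) \<le> m * (norm (x - P x))\<^sup>2)"
proof -
  let ?A = "\<lambda>x. A x - m *\<^sub>R x"
  have "?A \<in> D"
    by (intro masa_diff[OF D] masa_scaleR[OF D] masa_ident[OF D] A)
  moreover have "is_adjoint ?A ?A"
    by (intro is_adjoint_diff is_adjoint_scaleR is_adjoint_ident A)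
  moreover have "Re (cinner (?A y) y) = Re (cinner (A y) y) - m * (norm y)\<^sup>2" for y
    by (simp add: cinner_diff_left cinner_scaleR_left cinner_self)
  ultimately show ?thesis
    using spectral_split[OF D, of ?A] by simp
qed

text \<open>As \<open>Q\<close> commutes with \<open>A\<close>, the operator
  \<open>A Q - a Q\<close> is selfadjoint with quadratic form between 0 and \<open>r\<close>, so its
  norm is at most \<open>r\<close>.\<close>

lemma spectral_slice_norm_le:
  fixes A :: "'a::complex_inner \<Rightarrow> 'a"
  assumes A: "A \<in> bounded_ops" "is_adjoint A A"
    and Q: "is_projection Q" "\<And>x. A (Q x) = Q (A x)"
    and ge: "\<And>x. a * (norm (Q x))\<^sup>2 \<le> Re (cinner (A (Q x)) (Q x))"
    and le: "\<And>x. Re (cinner (A (Q x)) (Q x)) \<le> (a + r) * (norm (Q x))\<^sup>2" and "r \<ge> 0"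
  shows "norm (A (Q x) - a *\<^sub>R Q x) \<le> r * norm x"
proof (rule positive_operator_norm_le[where B = "\<lambda>x. A (Q x) - a *\<^sub>R Q x"])
  note QB = is_projectionD[OF Q(1)]
  show "(\<lambda>x. A (Q x) - a *\<^sub>R Q x) \<in> bounded_ops"
    by (intro bounded_ops_diff_op bounded_ops_scaleR_op bounded_ops_compose[OF A(1)] QB)
  show "is_adjoint (\<lambda>x. A (Q x) - a *\<^sub>R Q x) (\<lambda>x. A (Q x) - a *\<^sub>R Q x)"
    using is_adjoint_diff[OF is_adjoint_compose[OF A(2) QB(2)] is_adjoint_scaleR[OF QB(2), of a]]
    by (simp only: Q(2)[symmetric])
  have eq: "Re (cinner (A (Q x) - a *\<^sub>R Q x) x) = Re (cinner (A (Q x)) (Q x)) - a * (norm (Q x))\<^sup>2"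
    for x
  proof -
    have "cinner (A (Q x)) x = cinner (A (Q x)) (Q x)" "cinner (Q x) x = cinner (Q x) (Q x)"
      by (metis Q(2) QB(3) QB(4))+
    then show ?thesis
      by (simp add: cinner_diff_left cinner_scaleR_left cinner_self)
  qed
  show "0 \<le> Re (cinner (A (Q x) - a *\<^sub>R Q x) x)" for x
    using ge[of x] by (simp add: eq)
  show "Re (cinner (A (Q x) - a *\<^sub>R Q x) x) \<le> r * (norm x)\<^sup>2" for x
  proof -
    have "r * (norm (Q x))\<^sup>2 \<le> r * (norm x)\<^sup>2"
      using projection_norm_le[OF Q(1), of x] \<open>r \<ge> 0\<close> by (intro mult_left_mono power_mono) auto
    then show ?thesis
      using le[of x] by (simp add: eq algebra_simps)
  qed
qed

text \<open>Bisecting the spectral interval of \<open>A\<close> on the range of \<open>Q\<close>.\<close>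

lemma commutator_bisection:
  fixes D :: "('a::complex_hilbert_space \<Rightarrow> 'a) set"
  assumes D: "masa D" and A: "A \<in> D" "is_adjoint A A"
    and T: "T \<in> bounded_ops" "\<And>P x. P \<in> D \<Longrightarrow> is_projection P \<Longrightarrow> P (T x) = T (P x)"
    and K: "K \<ge> 0" "\<And>x. norm (T x) \<le> K * norm x"
  shows "Q \<in> D \<Longrightarrow> is_projection Q \<Longrightarrow> r \<ge> 0 \<Longrightarrow>
    (\<And>x. a * (norm (Q x))\<^sup>2 \<le> Re (cinner (A (Q x)) (Q x))) \<Longrightarrow>
    (\<And>x. Re (cinner (A (Q x)) (Q x)) \<le> (a + r) * (norm (Q x))\<^sup>2) \<Longrightarrow>
    norm (T (A (Q x)) - A (T (Q x))) \<le> 2 * K * (r / 2 ^ n) * norm (Q x)"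
proof (induction n arbitrary: a r Q x)
  case 0
  note Q = is_projectionD[OF 0(2)]
  have DB: "A \<in> bounded_ops"
    using A(1) masa_subset_bounded_ops[OF D] by blast
  let ?R = "\<lambda>x. A (Q x) - a *\<^sub>R Q x"
  have R: "norm (?R x) \<le> r * norm x" for x
    using 0 DB A masa_commute[OF D A(1) 0(1)] by (intro spectral_slice_norm_le) auto
  \<comment> \<open>The scalar \<open>a\<close> drops out of the commutator because \<open>T\<close>
    commutes with \<open>Q\<close>; what remains involves only \<open>?R\<close>, of norm at most
    \<open>r\<close>.\<close>
  have "T (A (Q x)) - A (T (Q x)) = T (?R (Q x)) - ?R (T (Q x))"
    by (simp add: T bounded_ops_linear Q 0)
  also have "norm \<dots> \<le> norm (T (?R (Q x))) + norm (?R (T (Q x)))"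
    by (rule norm_triangle_ineq4)
  also have "\<dots> \<le> K * (r * norm (Q x)) + r * (K * norm (Q x))"
    using K 0 by (intro add_mono order_trans[OF K(2)] order_trans[OF R] mult_left_mono R K) auto
  finally show ?case
    by (simp add: algebra_simps)
next
  case (Suc n)
  note Q = is_projectionD[OF Suc.prems(2)]
  have AB: "A \<in> bounded_ops"
    using A(1) masa_subset_bounded_ops[OF D] by blast
  obtain P where PD: "P \<in> D" and P: "is_projection P"
    and ge: "\<And>x. (a + r / 2) * (norm (P x))\<^sup>2 \<le> Re (cinner (A (P x)) (P x))"
    and le: "\<And>x. Re (cinner (A (x - P x)) (x - P x)) \<le> (a + r / 2) * (norm (x - P x))\<^sup>2"
    using spectral_split_at[OF D A, of "a + r / 2"] by blast
  note P' = is_projectionD[OF P]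
  define P1 where "P1 = (\<lambda>x. P (Q x))"
  define P2 where "P2 = (\<lambda>x. Q x - P (Q x))"
  have PQ: "P (Q x) = Q (P x)" for x
    by (rule masa_commute[OF D PD Suc.prems(1)])
  have P1: "P1 \<in> D" "is_projection P1"
    unfolding P1_def
    by (rule masa_compose[OF D PD Suc.prems(1)], rule is_projection_compose[OF P Suc.prems(2) PQ])
  have P2eq: "P2 = (\<lambda>x. (\<lambda>y. y - P y) (Q x))"
    by (simp add: P2_def)
  have P2: "P2 \<in> D" "is_projection P2"
    using masa_diff[OF D Suc.prems(1) P1(1)]
      is_projection_compose[OF is_projection_compl[OF P] Suc.prems(2)]
    by (auto simp: P2_def P1_def Q bounded_ops_linear PQ)
  have QP1: "Q (P1 x) = P1 x" and QP2: "Q (P2 x) = P2 x" for x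
    by (simp_all add: P1_def P2_def Q bounded_ops_linear flip: PQ)
  let ?C = "\<lambda>x. T (A x) - A (T x)"
  have 1: "norm (?C (P1 x)) \<le> 2 * K * (r / 2 / 2 ^ n) * norm (P1 x)"
  proof (rule Suc.IH[OF P1])
    show "(a + r / 2) * (norm (P1 x))\<^sup>2 \<le> Re (cinner (A (P1 x)) (P1 x))" for x
      using ge[of "Q x"] by (simp add: P1_def)
    show "Re (cinner (A (P1 x)) (P1 x)) \<le> (a + r / 2 + r / 2) * (norm (P1 x))\<^sup>2" for x
      using Suc.prems(5)[of "P1 x"] by (simp add: QP1 add.commute)
  qed (use Suc.prems in simp)
  have 2: "norm (?C (P2 x)) \<le> 2 * K * (r / 2 / 2 ^ n) * norm (P2 x)"
  proof (rule Suc.IH[OF P2])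
    show "a * (norm (P2 x))\<^sup>2 \<le> Re (cinner (A (P2 x)) (P2 x))" for x
      using Suc.prems(4)[of "P2 x"] by (simp add: QP2)
    show "Re (cinner (A (P2 x)) (P2 x)) \<le> (a + r / 2) * (norm (P2 x))\<^sup>2" for x
      using le[of "Q x"] by (simp add: P2_def)
  qed (use Suc.prems in simp)
  \<comment> \<open>The commutator itself commutes with \<open>P\<close>, so its values on the two
    halves are orthogonal. Squared norms add, and the bound is halved without picking up a factor
    from the number of pieces.\<close>
  have PC: "P (?C y) = ?C (P y)" for y
    by (simp add: bounded_ops_linear P'(1) masa_commute[OF D PD A(1)] T(2)[OF PD P])
  have CP1: "?C (P1 x) = P (?C (Q x))"
    by (simp only: PC P1_def)
  have "?C (P2 x) = ?C (Q x) - P (?C (Q x))"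
    unfolding PC by (simp add: P2_def bounded_ops_linear T(1) AB)
  then have "(norm (?C (Q x)))\<^sup>2 = (norm (?C (P1 x)))\<^sup>2 + (norm (?C (P2 x)))\<^sup>2"
    using projection_norm_add[OF P, of "?C (Q x)"] CP1 by metis
  also have "\<dots> \<le> (2 * K * (r / 2 / 2 ^ n) * norm (P1 x))\<^sup>2 + (2 * K * (r / 2 / 2 ^ n) * norm (P2 x))\<^sup>2"
    by (intro add_mono power_mono 1 2) auto
  also have "\<dots> = (2 * K * (r / 2 / 2 ^ n))\<^sup>2 * ((norm (P1 x))\<^sup>2 + (norm (P2 x))\<^sup>2)"
    by (simp only: power_mult_distrib distrib_left)
  also have "(norm (P1 x))\<^sup>2 + (norm (P2 x))\<^sup>2 = (norm (Q x))\<^sup>2"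
    using projection_norm_add[OF P, of "Q x"] by (simp add: P1_def P2_def)
  finally have "(norm (?C (Q x)))\<^sup>2 \<le> (2 * K * (r / 2 ^ Suc n) * norm (Q x))\<^sup>2"
    by (simp only: power_mult_distrib power_Suc divide_divide_eq_left)
  then show ?case
    by (rule power2_le_imp_le) (use K Suc.prems in auto)
qed

text \<open>Bisection makes the commutator of \<open>T\<close> with a selfadjoint \<open>A\<close>
  in \<open>D\<close> arbitrarily small; real and imaginary parts reduce general elements of
  \<open>D\<close> to this case, and maximality of \<open>D\<close> concludes.\<close>

theorem masa_commute_projections:
  fixes D :: "('a::complex_hilbert_space \<Rightarrow> 'a) set"
  assumes D: "masa D" and T: "T \<in> bounded_ops"
    and comm: "\<And>P x. P \<in> D \<Longrightarrow> is_projection P \<Longrightarrow> P (T x) = T (P x)"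
  shows "T \<in> D"
proof -
  obtain K where K: "K > 0" "\<And>x. norm (T x) \<le> K * norm x"
    using T bounded_ops_bound by blast
  have sa: "T (A x) = A (T x)" if A: "A \<in> D" "is_adjoint A A" for A x
  proof -
    obtain J where J: "J > 0" "\<And>x. norm (A x) \<le> J * norm x"
      using A masa_subset_bounded_ops[OF D] bounded_ops_bound by blast
    have *: "\<bar>Re (cinner (A x) x)\<bar> \<le> J * (norm x)\<^sup>2" for x
      using order_trans[OF abs_Re_le_cmod order_trans[OF cmod_cinner_le
            mult_right_mono[OF J(2) norm_ge_zero]], of x x]
      by (simp add: power2_eq_square mult.assoc)
    have id: "is_projection (\<lambda>x :: 'a. x)"
      by (simp add: is_projection_def bounded_ops_ident is_adjoint_ident)
    \<comment> \<open>The bisection starts with \<open>Q\<close> the identity and the interval from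
      \<open>-J\<close> to \<open>J\<close>, of length \<open>2 * J\<close>.\<close>
    have "norm (T (A x) - A (T x)) \<le> 2 * K * (2 * J / 2 ^ n) * norm x" for n
    proof (rule commutator_bisection[where Q = "\<lambda>x. x" and a = "- J", OF D A T comm])
      show "- J * (norm x)\<^sup>2 \<le> Re (cinner (A x) x)" for x
        using *[of x] by simp
      show "Re (cinner (A x) x) \<le> (- J + 2 * J) * (norm x)\<^sup>2" for x
        using *[of x] by simp
    qed (use K J masa_ident[OF D] id in auto)
    moreover have "(\<lambda>n. 2 * K * (2 * J / 2 ^ n) * norm x) \<longlonglongrightarrow> 0"
      by (rule tendsto_eq_intros LIMSEQ_divide_realpow_zero | simp)+
    ultimately have "norm (T (A x) - A (T x)) \<le> 0"
      by (intro LIMSEQ_le_const[of _ 0]) auto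
    then show ?thesis
      by simp
  qed
  have "S (T x) = T (S x)" if S: "S \<in> D" for S x
  proof -
    obtain R where R: "R \<in> D" "is_adjoint R S"
      using masa_selfadjoint[OF D] S by (auto simp: selfadjoint_set_def)
    then have RS: "is_adjoint S R"
      by (simp add: is_adjoint_commute)
    define A where "A = (\<lambda>x. R x + S x)"
    define B where "B = (\<lambda>x. \<i> *\<^sub>C (R x - S x))"
    have "A \<in> D" "B \<in> D"
      unfolding A_def B_def by (intro masa_add[OF D] masa_scaleC[OF D] masa_diff[OF D] R S)+
    moreover have "is_adjoint A A"
      using is_adjoint_add[OF RS R(2)] by (simp add: A_def add.commute)
    moreover have "is_adjoint B B"
      using is_adjoint_scaleC[OF is_adjoint_diff[OF RS R(2)], of \<i>]
      by (simp add: B_def complex_vector.scale_right_diff_distrib complex_vector.scale_minus_left)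
    ultimately have "T (A x) = A (T x)" "T (B x) = B (T x)"
      using sa by blast+
    moreover have S_eq: "S x = (1/2) *\<^sub>C A x + (\<i>/2) *\<^sub>C B x" for x
      by (simp only: A_def B_def real_imaginary_part_decomposition)
    ultimately show ?thesis
      by (simp add: T bounded_ops_linear)
  qed
  then show ?thesis
    using T by (intro masa_maximal[OF D]) (simp add: commutant_def)
qed

subsection \<open>The Hilbert space of square-summable sequences\<close>

lemma square_summable_zero: "square_summable (\<lambda>n. 0)"
  by (simp add: square_summable_def)

lemma square_summable_bounded_image:
  assumes "square_summable x" and "\<And>n. norm (y n) \<le> K * norm (x n)"
  shows "square_summable y"
  unfolding square_summable_def
proof (rule summable_comparison_test')
  show "summable (\<lambda>n. K\<^sup>2 * (norm (x n))\<^sup>2)"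
    using assms(1) by (simp add: square_summable_def summable_mult)
  show "norm ((norm (y n))\<^sup>2) \<le> K\<^sup>2 * (norm (x n))\<^sup>2" for n
    using power_mono[OF assms(2)[of n], of 2] by (simp add: power_mult_distrib)
qed

lemma square_summable_add:
  assumes "square_summable x" "square_summable y"
  shows "square_summable (\<lambda>n. x n + y n)"
  unfolding square_summable_def
proof (rule summable_comparison_test')
  show "summable (\<lambda>n. 2 * (norm (x n))\<^sup>2 + 2 * (norm (y n))\<^sup>2)"
    using assms by (intro summable_add summable_mult) (auto simp: square_summable_def)
  show "norm ((norm (x n + y n))\<^sup>2) \<le> 2 * (norm (x n))\<^sup>2 + 2 * (norm (y n))\<^sup>2" for n
  proof -
    have "(norm (x n + y n))\<^sup>2 \<le> (norm (x n) + norm (y n))\<^sup>2"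
      by (intro power_mono norm_triangle_ineq) simp
    also have "\<dots> \<le> 2 * (norm (x n))\<^sup>2 + 2 * (norm (y n))\<^sup>2"
      using zero_le_power2[of "norm (x n) - norm (y n)"] unfolding power2_sum power2_diff by linarith
    finally show ?thesis
      by simp
  qed
qed

lemma square_summable_scaleC: "square_summable x \<Longrightarrow> square_summable (\<lambda>n. c *\<^sub>C x n)"
  by (erule square_summable_bounded_image[of _ _ "cmod c"]) (simp add: norm_scaleC)

lemma square_summable_scaleR: "square_summable x \<Longrightarrow> square_summable (\<lambda>n. c *\<^sub>R x n)"
  by (simp add: scaleR_eq_scaleC square_summable_scaleC)

lemma square_summable_minus: "square_summable x \<Longrightarrow> square_summable (\<lambda>n. - x n)"
  by (erule square_summable_bounded_image[of _ _ 1]) simp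

lemma square_summable_diff:
  "square_summable x \<Longrightarrow> square_summable y \<Longrightarrow> square_summable (\<lambda>n. x n - y n)"
  using square_summable_add[of x "\<lambda>n. - y n"] square_summable_minus[of y] by simp

lemma summable_norm_mult:
  assumes "square_summable x" "square_summable y"
  shows "summable (\<lambda>n. norm (x n) * norm (y n))"
proof (rule summable_comparison_test')
  show "summable (\<lambda>n. (norm (x n))\<^sup>2 + (norm (y n))\<^sup>2)"
    using assms by (intro summable_add) (auto simp: square_summable_def)
  show "norm (norm (x n) * norm (y n)) \<le> (norm (x n))\<^sup>2 + (norm (y n))\<^sup>2" for n
  proof -
    have "0 \<le> norm (x n) * norm (y n)"
      by simp
    then show ?thesis
      using zero_le_power2[of "norm (x n) - norm (y n)"]
      unfolding power2_diff real_norm_def abs_mult abs_norm_cancel mult.assoc by linarith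
  qed
qed

lemma summable_cinner:
  assumes "square_summable x" "square_summable y"
  shows "summable (\<lambda>n. cinner (x n) (y n))"
  by (rule summable_comparison_test'[OF summable_norm_mult[OF assms]]) (rule cmod_cinner_le)

text \<open>A concrete model of \<open>H \<otimes> ell2\<close>. A pair \<open>w\<close>,
  \<open>z\<close> of its elements encodes the ultra-weakly continuous functional
  \<open>T \<mapsto> cinner (ell2_map T w) z\<close>.\<close>

typedef (overloaded) 'a ell2 = "{x :: nat \<Rightarrow> 'a::complex_inner. square_summable x}"
  morphisms ell2_nth Abs_ell2
  by (auto intro: square_summable_zero)

lemma square_summable_ell2_nth [simp]: "square_summable (ell2_nth x)"
  using ell2_nth by blast

lemma ell2_nth_Abs: "square_summable x \<Longrightarrow> ell2_nth (Abs_ell2 x) = x"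
  by (simp add: Abs_ell2_inverse)

lemma ell2_eqI: "(\<And>n. ell2_nth x n = ell2_nth y n) \<Longrightarrow> x = y"
  by (simp add: ell2_nth_inject[symmetric] fun_eq_iff)

instantiation ell2 :: (complex_inner) complex_inner
begin

definition "0 = Abs_ell2 (\<lambda>n. 0)"
definition "x + y = Abs_ell2 (\<lambda>n. ell2_nth x n + ell2_nth y n)"
definition "x - y = Abs_ell2 (\<lambda>n. ell2_nth x n - ell2_nth y n)"
definition "- x = Abs_ell2 (\<lambda>n. - ell2_nth x n)"
definition "r *\<^sub>R x = Abs_ell2 (\<lambda>n. r *\<^sub>R ell2_nth x n)"
definition "c *\<^sub>C x = Abs_ell2 (\<lambda>n. c *\<^sub>C ell2_nth x n)"
definition "cinner x y = (\<Sum>n. cinner (ell2_nth x n) (ell2_nth y n))"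
definition "inner x y = Re (cinner x y)" for x y :: "'a ell2"
definition "norm x = sqrt (inner x x)" for x :: "'a ell2"
definition "sgn x = inverse (norm x) *\<^sub>R x" for x :: "'a ell2"
definition "dist x y = norm (x - y)" for x y :: "'a ell2"
definition "(uniformity :: ('a ell2 \<times> 'a ell2) filter) = (INF e\<in>{0<..}. principal {(x, y). dist x y < e})"
definition "open U \<longleftrightarrow> (\<forall>x\<in>U. \<forall>\<^sub>F (x', y) in uniformity. x' = x \<longrightarrow> y \<in> U)" for U :: "'a ell2 set"

lemma ell2_nth_simps:
  "ell2_nth 0 n = 0"
  "ell2_nth (x + y) n = ell2_nth x n + ell2_nth y n"
  "ell2_nth (x - y) n = ell2_nth x n - ell2_nth y n"
  "ell2_nth (- x) n = - ell2_nth x n"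
  "ell2_nth (r *\<^sub>R x) n = r *\<^sub>R ell2_nth x n"
  "ell2_nth (c *\<^sub>C x) n = c *\<^sub>C ell2_nth x n"
  by (simp_all add: zero_ell2_def plus_ell2_def minus_ell2_def uminus_ell2_def scaleR_ell2_def
      scaleC_ell2_def ell2_nth_Abs square_summable_zero square_summable_add square_summable_diff
      square_summable_minus square_summable_scaleR square_summable_scaleC)

lemma ell2_summable_cinner: "summable (\<lambda>n. cinner (ell2_nth x n) (ell2_nth y n))"
  by (simp add: summable_cinner)

lemma ell2_summable_norm: "summable (\<lambda>n. (norm (ell2_nth x n))\<^sup>2)"
  using square_summable_ell2_nth unfolding square_summable_def .

lemma ell2_inner_self: "inner x x = (\<Sum>n. (norm (ell2_nth x n))\<^sup>2)" for x :: "'a ell2"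
  unfolding inner_ell2_def cinner_ell2_def cinner_self
  by (simp add: suminf_of_real[OF ell2_summable_norm, symmetric] del: of_real_power)

instance
proof
  fix x y z :: "'a ell2" and r s :: real and c d :: complex
  show "x + y + z = x + (y + z)" "x + y = y + x" "0 + x = x" "- x + x = 0" "x - y = x + - y"
    "r *\<^sub>R (x + y) = r *\<^sub>R x + r *\<^sub>R y" "(r + s) *\<^sub>R x = r *\<^sub>R x + s *\<^sub>R x"
    "r *\<^sub>R s *\<^sub>R x = (r * s) *\<^sub>R x" "1 *\<^sub>R x = x"
    "c *\<^sub>C (x + y) = c *\<^sub>C x + c *\<^sub>C y" "(c + d) *\<^sub>C x = c *\<^sub>C x + d *\<^sub>C x"
    "c *\<^sub>C d *\<^sub>C x = (c * d) *\<^sub>C x" "1 *\<^sub>C x = x" "r *\<^sub>R x = complex_of_real r *\<^sub>C x"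
    by (auto intro!: ell2_eqI simp: ell2_nth_simps algebra_simps scaleC_add_left scaleC_add_right
        scaleC_scaleC scaleC_one simp flip: scaleR_eq_scaleC)
  show "cinner x y = cnj (cinner y x)"
  proof -
    have "cnj (cinner y x) = (\<Sum>n. cnj (cinner (ell2_nth y n) (ell2_nth x n)))"
      unfolding cinner_ell2_def by (rule bounded_linear.suminf[OF bounded_linear_cnj ell2_summable_cinner])
    also have "\<dots> = cinner x y"
      unfolding cinner_ell2_def by (simp add: cinner_commute[symmetric])
    finally show ?thesis ..
  qed
  show add: "cinner (x + y) z = cinner x z + cinner y z" for x y z :: "'a ell2"
    unfolding cinner_ell2_def ell2_nth_simps cinner_add_left
    by (rule suminf_add[symmetric]) (rule ell2_summable_cinner)+
  show scale: "cinner (c *\<^sub>C x) y = c * cinner x y" for c and x y :: "'a ell2"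
    unfolding cinner_ell2_def ell2_nth_simps cinner_scaleC_left
    by (rule suminf_mult) (rule ell2_summable_cinner)
  show "inner x y = Re (cinner x y)"
    by (rule inner_ell2_def)
  have commute: "cinner x y = cnj (cinner y x)" by fact
  show "inner x y = inner y x"
    unfolding inner_ell2_def by (subst commute) simp
  show "inner (x + y) z = inner x z + inner y z"
    by (simp add: inner_ell2_def add)
  have "r *\<^sub>R x = complex_of_real r *\<^sub>C x" by fact
  then show "inner (r *\<^sub>R x) y = r * inner x y"
    by (simp add: inner_ell2_def scale)
  show "0 \<le> inner x x"
    unfolding ell2_inner_self by (intro suminf_nonneg ell2_summable_norm) simp
  show "inner x x = 0 \<longleftrightarrow> x = 0"
    unfolding ell2_inner_self
    by (subst suminf_eq_zero_iff[OF ell2_summable_norm])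
      (auto intro!: ell2_eqI simp: ell2_nth_simps)
  show "norm x = sqrt (inner x x)" "sgn x = inverse (norm x) *\<^sub>R x" "dist x y = norm (x - y)"
    by (rule norm_ell2_def sgn_ell2_def dist_ell2_def)+
qed (rule uniformity_ell2_def open_ell2_def)+

end

lemma ell2_norm_power2: "(norm x)\<^sup>2 = (\<Sum>n. (norm (ell2_nth x n))\<^sup>2)"
  by (simp add: power2_norm_eq_inner ell2_inner_self)

lemma ell2_sum_le: "(\<Sum>k<N. (norm (ell2_nth x k))\<^sup>2) \<le> (norm x)\<^sup>2"
  unfolding ell2_norm_power2 by (intro sum_le_suminf ell2_summable_norm) auto

lemma ell2_norm_nth_le: "norm (ell2_nth x n) \<le> norm x"
proof (rule power2_le_imp_le)
  have "(norm (ell2_nth x n))\<^sup>2 \<le> (\<Sum>k<Suc n. (norm (ell2_nth x k))\<^sup>2)"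
    by (rule member_le_sum) auto
  then show "(norm (ell2_nth x n))\<^sup>2 \<le> (norm x)\<^sup>2"
    using ell2_sum_le order_trans by blast
qed simp

instance ell2 :: (complex_hilbert_space) complex_hilbert_space
proof
  fix X :: "nat \<Rightarrow> 'a ell2"
  assume X: "Cauchy X"
  have "Cauchy (\<lambda>m. ell2_nth (X m) k)" for k
  proof (rule metric_CauchyI)
    fix e :: real assume "e > 0"
    then obtain M where M: "\<forall>m\<ge>M. \<forall>n\<ge>M. dist (X m) (X n) < e"
      using metric_CauchyD[OF X] by blast
    moreover have "dist (ell2_nth (X m) k) (ell2_nth (X n) k) \<le> dist (X m) (X n)" for m n
      using ell2_norm_nth_le[of "X m - X n" k] by (simp add: dist_norm ell2_nth_simps)
    ultimately show "\<exists>M. \<forall>m\<ge>M. \<forall>n\<ge>M. dist (ell2_nth (X m) k) (ell2_nth (X n) k) < e"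
      by (meson le_less_trans)
  qed
  then have "\<exists>l. (\<lambda>m. ell2_nth (X m) k) \<longlonglongrightarrow> l" for k
    using Cauchy_convergent convergent_def by blast
  then obtain l where l: "\<And>k. (\<lambda>m. ell2_nth (X m) k) \<longlonglongrightarrow> l k"
    by metis
  \<comment> \<open>The Cauchy estimate is passed to the coordinatewise limit in finite partial
    sums, where this is allowed; uniformity in \<open>N\<close> then yields both summability of
    \<open>l\<close> and convergence in norm.\<close>
  have tail: "\<exists>M. \<forall>m\<ge>M. \<forall>N. (\<Sum>k<N. (norm (ell2_nth (X m) k - l k))\<^sup>2) \<le> e\<^sup>2" if "e > 0" for e
  proof -
    obtain M where M: "\<forall>m\<ge>M. \<forall>n\<ge>M. dist (X m) (X n) < e"
      using metric_CauchyD[OF X \<open>e > 0\<close>] by blast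
    have "(\<Sum>k<N. (norm (ell2_nth (X m) k - l k))\<^sup>2) \<le> e\<^sup>2" if "m \<ge> M" for m N
    proof (rule Lim_bounded)
      show "(\<lambda>n. \<Sum>k<N. (norm (ell2_nth (X m) k - ell2_nth (X n) k))\<^sup>2)
          \<longlonglongrightarrow> (\<Sum>k<N. (norm (ell2_nth (X m) k - l k))\<^sup>2)"
        by (intro tendsto_intros l)
      show "\<forall>n\<ge>M. (\<Sum>k<N. (norm (ell2_nth (X m) k - ell2_nth (X n) k))\<^sup>2) \<le> e\<^sup>2"
      proof (intro allI impI)
        fix n assume "n \<ge> M"
        then have "(norm (X m - X n))\<^sup>2 \<le> e\<^sup>2"
          using M \<open>m \<ge> M\<close> by (intro power_mono) (auto simp: dist_norm intro: less_imp_le)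
        then show "(\<Sum>k<N. (norm (ell2_nth (X m) k - ell2_nth (X n) k))\<^sup>2) \<le> e\<^sup>2"
          using ell2_sum_le[where x = "X m - X n" and N = N] by (simp add: ell2_nth_simps)
      qed
    qed
    then show ?thesis
      by blast
  qed
  have diff: "square_summable (\<lambda>k. ell2_nth (X m) k - l k)"
    if "\<forall>N. (\<Sum>k<N. (norm (ell2_nth (X m) k - l k))\<^sup>2) \<le> c" for m c
    unfolding square_summable_def by (rule summableI_nonneg_bounded[where x = c]) (use that in auto)
  obtain M where "\<forall>N. (\<Sum>k<N. (norm (ell2_nth (X M) k - l k))\<^sup>2) \<le> 1\<^sup>2"
    using tail[of 1] by auto
  then have l_sq: "square_summable l"
    using square_summable_diff[OF square_summable_ell2_nth[of "X M"] diff[of M "1\<^sup>2"]] by simp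
  define L where "L = Abs_ell2 l"
  have L: "ell2_nth L = l"
    by (simp add: L_def ell2_nth_Abs l_sq)
  have "X \<longlonglongrightarrow> L"
  proof (rule metric_LIMSEQ_I)
    fix e :: real assume "e > 0"
    then obtain M where M: "\<And>m N. m \<ge> M \<Longrightarrow> (\<Sum>k<N. (norm (ell2_nth (X m) k - l k))\<^sup>2) \<le> (e/2)\<^sup>2"
      using tail[of "e/2"] by auto
    have "dist (X m) L < e" if "m \<ge> M" for m
    proof -
      have "(norm (X m - L))\<^sup>2 \<le> (e/2)\<^sup>2"
        unfolding ell2_norm_power2 using M[OF that]
        by (intro suminf_le_const ell2_summable_norm) (simp add: ell2_nth_simps L)
      then have "norm (X m - L) \<le> e/2"
        by (rule power2_le_imp_le) (use \<open>e > 0\<close> in simp)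
      then show ?thesis
        using \<open>e > 0\<close> by (simp add: dist_norm)
    qed
    then show "\<exists>M. \<forall>m\<ge>M. dist (X m) L < e"
      by blast
  qed
  then show "convergent X"
    by (rule convergentI)
qed

section \<open>Amplifications \<open>T \<otimes> 1\<close>\<close>

definition ell2_map :: "('a::complex_inner \<Rightarrow> 'a) \<Rightarrow> 'a ell2 \<Rightarrow> 'a ell2" where
  "ell2_map T x = Abs_ell2 (\<lambda>n. T (ell2_nth x n))"

lemma ell2_nth_map:
  assumes "T \<in> bounded_ops"
  shows "ell2_nth (ell2_map T x) n = T (ell2_nth x n)"
proof -
  obtain K where "\<And>x. norm (T x) \<le> K * norm x"
    using assms bounded_ops_bound by blast
  then have "square_summable (\<lambda>n. T (ell2_nth x n))"
    by (rule square_summable_bounded_image[OF square_summable_ell2_nth])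
  then show ?thesis
    by (simp add: ell2_map_def ell2_nth_Abs)
qed

lemma ell2_map_norm_le:
  assumes "T \<in> bounded_ops" "\<And>x. norm (T x) \<le> K * norm x" "K \<ge> 0"
  shows "norm (ell2_map T x) \<le> K * norm x"
proof (rule power2_le_imp_le)
  have "(norm (ell2_map T x))\<^sup>2 = (\<Sum>n. (norm (T (ell2_nth x n)))\<^sup>2)"
    by (simp add: ell2_norm_power2 ell2_nth_map assms)
  also have "\<dots> \<le> (\<Sum>n. K\<^sup>2 * (norm (ell2_nth x n))\<^sup>2)"
  proof (rule suminf_le)
    show "(norm (T (ell2_nth x n)))\<^sup>2 \<le> K\<^sup>2 * (norm (ell2_nth x n))\<^sup>2" for n
      using power_mono[OF assms(2), of "ell2_nth x n" 2] by (simp add: power_mult_distrib)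
    show "summable (\<lambda>n. (norm (T (ell2_nth x n)))\<^sup>2)"
      using ell2_summable_norm[of "ell2_map T x"] by (simp add: ell2_nth_map assms)
  qed (intro summable_mult ell2_summable_norm)
  also have "\<dots> = (K * norm x)\<^sup>2"
    by (simp add: suminf_mult ell2_summable_norm power_mult_distrib ell2_norm_power2)
  finally show "(norm (ell2_map T x))\<^sup>2 \<le> (K * norm x)\<^sup>2" .
qed (use assms in simp)

lemma ell2_map_bounded_ops:
  assumes "T \<in> bounded_ops"
  shows "ell2_map T \<in> bounded_ops"
proof -
  obtain K where K: "K > 0" "\<And>x. norm (T x) \<le> K * norm x"
    using assms bounded_ops_bound by blast
  show ?thesis
    by (rule bounded_opsI[of _ K])
      (auto intro!: ell2_eqI ell2_map_norm_le
        simp: ell2_nth_map ell2_nth_simps assms bounded_ops_linear K less_imp_le)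
qed

lemma ell2_map_add:
  assumes "S \<in> bounded_ops" "T \<in> bounded_ops"
  shows "ell2_map (\<lambda>x. S x + T x) w = ell2_map S w + ell2_map T w"
  by (rule ell2_eqI) (simp add: ell2_nth_map ell2_nth_simps assms bounded_ops_add_op)

lemma ell2_map_diff:
  assumes "S \<in> bounded_ops" "T \<in> bounded_ops"
  shows "ell2_map (\<lambda>x. S x - T x) w = ell2_map S w - ell2_map T w"
  by (rule ell2_eqI) (simp add: ell2_nth_map ell2_nth_simps assms bounded_ops_diff_op)

lemma ell2_map_scaleC:
  assumes "T \<in> bounded_ops"
  shows "ell2_map (\<lambda>x. c *\<^sub>C T x) w = c *\<^sub>C ell2_map T w"
  by (rule ell2_eqI) (simp add: ell2_nth_map ell2_nth_simps assms bounded_ops_scaleC_op)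

lemma ell2_map_compose:
  assumes "S \<in> bounded_ops" "T \<in> bounded_ops"
  shows "ell2_map (\<lambda>x. S (T x)) w = ell2_map S (ell2_map T w)"
  by (rule ell2_eqI) (simp add: ell2_nth_map assms bounded_ops_compose)

lemma ell2_map_zero: "ell2_map (\<lambda>x. 0) w = 0"
  by (rule ell2_eqI) (simp add: ell2_nth_map ell2_nth_simps bounded_ops_const_zero)

lemma ell2_map_ident: "ell2_map (\<lambda>x. x) w = w"
  by (rule ell2_eqI) (simp add: ell2_nth_map bounded_ops_ident)

lemma is_adjoint_ell2_map:
  assumes "S \<in> bounded_ops" "T \<in> bounded_ops" "is_adjoint S T"
  shows "is_adjoint (ell2_map S) (ell2_map T)"
  using assms(3) by (simp add: is_adjoint_def cinner_ell2_def ell2_nth_map assms(1,2))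

section \<open>The coordinate copies of \<open>H\<close> inside
  \<open>H \<otimes> ell2\<close>\<close>

definition ell2_single :: "nat \<Rightarrow> 'a::complex_inner \<Rightarrow> 'a ell2" where
  "ell2_single i h = Abs_ell2 (\<lambda>n. if n = i then h else 0)"

lemma ell2_nth_single: "ell2_nth (ell2_single i h) n = (if n = i then h else 0)"
proof -
  have "square_summable (\<lambda>n. if n = i then h else 0)"
    unfolding square_summable_def
    by (rule summable_finite[of "{i}"]) auto
  then show ?thesis
    by (simp add: ell2_single_def ell2_nth_Abs)
qed

lemma cinner_ell2_single: "cinner w (ell2_single i h) = cinner (ell2_nth w i) h"
proof -
  have "(\<lambda>n. cinner (ell2_nth w n) (ell2_nth (ell2_single i h) n))
      = (\<lambda>n. if n = i then cinner (ell2_nth w n) h else 0)"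
    by (auto simp: ell2_nth_single)
  then show ?thesis
    using suminf_finite[of "{i}" "\<lambda>n. if n = i then cinner (ell2_nth w n) h else 0"]
    by (simp add: cinner_ell2_def)
qed

lemma ell2_single_linear:
  "ell2_single i (h + k) = ell2_single i h + ell2_single i k"
  "ell2_single i (c *\<^sub>C h) = c *\<^sub>C ell2_single i h"
  by (auto intro!: ell2_eqI simp: ell2_nth_single ell2_nth_simps)

lemma norm_ell2_single: "norm (ell2_single i h) = norm h"
proof -
  have "inner (ell2_single i h) (ell2_single i h) = inner h h"
    by (simp add: inner_eq_Re_cinner cinner_ell2_single ell2_nth_single)
  then show ?thesis
    by (simp add: norm_eq_sqrt_inner)
qed

lemma ell2_map_single:
  "T \<in> bounded_ops \<Longrightarrow> ell2_map T (ell2_single i h) = ell2_single i (T h)"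
  by (rule ell2_eqI) (simp add: ell2_nth_map ell2_nth_single bounded_ops_zero)

subsection \<open>Compressing to the diagonal\<close>

text \<open>Weak compactness of operator balls: the forms \<open>cinner (Y x) y\<close> live in a
  product of closed discs, compact by Tychonoff, and a limiting form is again sesquilinear and
  bounded. The filter \<open>G\<close> keeps track of membership in \<open>B\<close> and in each
  \<open>S i\<close>.\<close>

lemma bounded_operators_cluster_point:
  fixes S :: "'i \<Rightarrow> ('a::complex_hilbert_space \<Rightarrow> 'a) set"
  assumes fip: "\<And>J. J \<subseteq> I \<Longrightarrow> finite J \<Longrightarrow> B \<inter> (\<Inter>i\<in>J. S i) \<noteq> {}"
    and B: "\<And>Y. Y \<in> B \<Longrightarrow> Y \<in> bounded_ops \<and> (\<forall>x. norm (Y x) \<le> K * norm x)"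
  shows "\<exists>G. \<exists>d\<in>bounded_ops. G \<noteq> bot \<and> eventually (\<lambda>Y. Y \<in> B) G \<and>
    (\<forall>i\<in>I. eventually (\<lambda>Y. Y \<in> S i) G) \<and>
    (\<forall>x y. ((\<lambda>Y. cinner (Y x) y) \<longlongrightarrow> cinner (d x) y) G)"
proof -
  define G0 where "G0 = inf (principal B) (INF i\<in>I. principal (S i))"
  \<comment> \<open>\<open>B\<close> joins the family under the index \<open>None\<close>, so that
    the finite intersection criterion applies to a single family.\<close>
  have G0_eq: "G0 = (INF i\<in>insert None (Some ` I). principal (case i of None \<Rightarrow> B | Some j \<Rightarrow> S j))"
    by (simp add: G0_def image_image)
  have "G0 \<noteq> bot"
    unfolding G0_eq
  proof (rule INF_filter_not_bot)
    fix X assume X: "X \<subseteq> insert None (Some ` I)" "finite X"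
    define J where "J = {j. Some j \<in> X}"
    have "finite (Some ` J)"
      using X(2) by (rule rev_finite_subset) (auto simp: J_def)
    then have "finite J"
      by (rule finite_imageD) simp
    moreover have "J \<subseteq> I"
      using X(1) by (auto simp: J_def)
    ultimately obtain Y where Y: "Y \<in> B" "\<And>j. j \<in> J \<Longrightarrow> Y \<in> S j"
      using fip[of J] by blast
    have "Y \<in> (\<Inter>i\<in>X. case i of None \<Rightarrow> B | Some j \<Rightarrow> S j)"
      using Y by (auto simp: J_def split: option.split)
    then show "(INF i\<in>X. principal (case i of None \<Rightarrow> B | Some j \<Rightarrow> S j)) \<noteq> bot"
      using X(2) by (simp only: INF_principal_finite principal_eq_bot_iff) blast
  qed
  define ev where "ev Y = (\<lambda>(x, y). cinner (Y x) y)" for Y :: "'a \<Rightarrow> 'a"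
  define \<Omega> :: "('a \<times> 'a \<Rightarrow> complex) set" where
    "\<Omega> = PiE UNIV (\<lambda>(x, y). cball 0 (K * norm x * norm y))"
  have "compactin (product_topology (\<lambda>_ :: 'a \<times> 'a. euclidean :: complex topology) UNIV) \<Omega>"
    unfolding \<Omega>_def compactin_PiE by auto
  then have comp: "compact \<Omega>"
    by (simp add: euclidean_product_topology)
  have bound: "cmod (cinner (Y x) y) \<le> K * norm x * norm y" if "Y \<in> B" for Y x y
    using order_trans[OF cmod_cinner_le mult_right_mono[OF _ norm_ge_zero]] B[OF that] by blast
  have B_G0: "eventually (\<lambda>Y. Y \<in> B) G0"
    unfolding G0_def by (rule filter_leD[OF inf_le1]) (simp add: eventually_principal)
  have S_G0: "eventually (\<lambda>Y. Y \<in> S i) G0" if "i \<in> I" for i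
    unfolding G0_def
    by (rule filter_leD[OF order_trans[OF inf_le2 INF_lower[OF that]]])
      (simp add: eventually_principal)
  have "eventually (\<lambda>F. F \<in> \<Omega>) (filtermap ev G0)"
    unfolding eventually_filtermap
    by (rule eventually_mono[OF B_G0]) (auto simp: ev_def \<Omega>_def PiE_iff bound)
  moreover have "filtermap ev G0 \<noteq> bot"
    using \<open>G0 \<noteq> bot\<close> by (simp add: filtermap_bot_iff)
  ultimately obtain F where F: "inf (nhds F) (filtermap ev G0) \<noteq> bot"
    using comp unfolding compact_filter by blast
  \<comment> \<open>Refining \<open>G0\<close> by the pulled back neighbourhoods of the cluster
    point \<open>F\<close> turns clustering into convergence.\<close>
  define G where "G = inf (filtercomap ev (nhds F)) G0"
  have "G \<noteq> bot"
  proof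
    assume "G = bot"
    then obtain P Q where P: "eventually P (nhds F)" and Q: "eventually Q G0"
      and PQ: "\<And>Y. P (ev Y) \<Longrightarrow> Q Y \<Longrightarrow> False"
      unfolding G_def trivial_limit_def eventually_inf eventually_filtercomap by blast
    have "eventually (\<lambda>Y. \<not> P (ev Y)) G0"
      by (rule eventually_mono[OF Q]) (use PQ in blast)
    then have "eventually (\<lambda>_. False) (inf (nhds F) (filtermap ev G0))"
      using P unfolding eventually_inf eventually_filtermap
      by (intro exI[of _ P] exI[of _ "\<lambda>F. \<not> P F"]) simp
    then show False
      using F by (simp add: trivial_limit_def)
  qed
  have G_G0: "G \<le> G0"
    by (simp add: G_def)
  have "filterlim ev (nhds F) G"
    unfolding G_def by (rule filterlim_mono[OF filterlim_filtercomap order_refl inf_le1])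
  then have "((\<lambda>Y. ev Y (x, y)) \<longlongrightarrow> F (x, y)) G" for x y
    using continuous_on_tendsto_compose[OF continuous_on_product_coordinates[of "(x, y)"]]
    by auto
  then have lim: "((\<lambda>Y. cinner (Y x) y) \<longlongrightarrow> F (x, y)) G" for x y
    by (simp add: ev_def)
  have B_G: "eventually (\<lambda>Y. Y \<in> B) G"
    using B_G0 G_G0 by (rule filter_leD[rotated])
  have limeq: "a = b" if "((\<lambda>Y. f Y) \<longlongrightarrow> a) G" "((\<lambda>Y. g Y) \<longlongrightarrow> b) G" "\<And>Y. Y \<in> B \<Longrightarrow> f Y = g Y"
    for a b :: complex and f g
  proof (rule tendsto_unique[OF \<open>G \<noteq> bot\<close> that(1)])
    show "(f \<longlongrightarrow> b) G"
      by (rule Lim_transform_eventually[OF that(2)])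
        (use B_G that(3) in \<open>auto elim: eventually_mono\<close>)
  qed
  have "\<exists>T\<in>bounded_ops. \<forall>x y. F (x, y) = cinner (T x) y"
  proof (rule sesquilinear_representation[of "\<lambda>x y. F (x, y)"])
    show "F (x + x', y) = F (x, y) + F (x', y)" for x x' y
      by (rule limeq[OF lim tendsto_add[OF lim lim]])
        (use B in \<open>simp add: bounded_ops_add cinner_add_left\<close>)
    show "F (c *\<^sub>C x, y) = c * F (x, y)" for c x y
      by (rule limeq[OF lim tendsto_mult[OF tendsto_const lim]])
        (use B in \<open>simp add: bounded_ops_scaleC cinner_scaleC_left\<close>)
    show "F (x, y + y') = F (x, y) + F (x, y')" for x y y'
      by (rule limeq[OF lim tendsto_add[OF lim lim]]) (simp add: cinner_add_right)
    show "F (x, c *\<^sub>C y) = cnj c * F (x, y)" for c x y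
      by (rule limeq[OF lim tendsto_mult[OF tendsto_const lim]]) (simp add: cinner_scaleC_right)
    show "cmod (F (x, y)) \<le> K * norm x * norm y" for x y
      by (rule tendsto_upperbound[OF tendsto_norm[OF lim] _ \<open>G \<noteq> bot\<close>])
        (use B_G bound in \<open>auto elim: eventually_mono\<close>)
  qed
  then obtain d where "d \<in> bounded_ops" "\<And>x y. F (x, y) = cinner (d x) y"
    by blast
  moreover have "\<forall>i\<in>I. eventually (\<lambda>Y. Y \<in> S i) G"
    using S_G0 filter_leD[OF G_G0] by blast
  ultimately show ?thesis
    using \<open>G \<noteq> bot\<close> B_G lim by metis
qed

text \<open>On norm bounded sets weak convergence is ultra-weak convergence: the series is dominated
  by the summable \<open>K * (norm (w k) * norm (z k))\<close>, and Tannery's theorem interchanges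
  limit and sum.\<close>

lemma ultraweak_tendsto_bounded:
  assumes "G \<noteq> bot"
    and bnd: "eventually (\<lambda>Y. Y \<in> bounded_ops \<and> (\<forall>x. norm (Y x) \<le> K * norm x)) G"
    and d: "d \<in> bounded_ops"
    and lim: "\<And>x y. ((\<lambda>Y. cinner (Y x) y) \<longlongrightarrow> cinner (d x) y) G"
  shows "((\<lambda>Y. cinner (ell2_map Y w) z) \<longlongrightarrow> cinner (ell2_map d w) z) G"
proof -
  let ?M = "\<lambda>k. K * (norm (ell2_nth w k) * norm (ell2_nth z k))"
  have "((\<lambda>Y. \<Sum>k. cinner (Y (ell2_nth w k)) (ell2_nth z k))
      \<longlongrightarrow> (\<Sum>k. cinner (d (ell2_nth w k)) (ell2_nth z k))) G"
  proof (rule tannerys_theorem[THEN conjunct2, THEN conjunct2])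
    show "((\<lambda>Y. cinner (Y (ell2_nth w k)) (ell2_nth z k))
        \<longlongrightarrow> cinner (d (ell2_nth w k)) (ell2_nth z k)) G" for k
      by (rule lim)
    show "\<forall>\<^sub>F (k, Y) in at_top \<times>\<^sub>F G. norm (cinner (Y (ell2_nth w k)) (ell2_nth z k)) \<le> ?M k"
    proof (rule eventually_mono[OF eventually_prodI[OF eventually_True bnd]], clarsimp)
      fix Y :: "'a \<Rightarrow> 'a" and k
      assume "\<forall>x. norm (Y x) \<le> K * norm x"
      then show "norm (cinner (Y (ell2_nth w k)) (ell2_nth z k)) \<le> ?M k"
        using order_trans[OF cmod_cinner_le mult_right_mono[OF _ norm_ge_zero]]
        by (metis mult.assoc)
    qed
    show "summable ?M"
      by (intro summable_mult summable_norm_mult) auto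
  qed fact
  then have "((\<lambda>Y. \<Sum>k. cinner (Y (ell2_nth w k)) (ell2_nth z k)) \<longlongrightarrow> cinner (ell2_map d w) z) G"
    by (simp add: cinner_ell2_def ell2_nth_map d)
  moreover have "\<forall>\<^sub>F Y in G. (\<Sum>k. cinner (Y (ell2_nth w k)) (ell2_nth z k)) = cinner (ell2_map Y w) z"
    using bnd by (auto elim!: eventually_mono simp: cinner_ell2_def ell2_nth_map)
  ultimately show ?thesis
    by (rule Lim_transform_eventually)
qed

section \<open>Block diagonal parts with respect to a projection\<close>

definition pinching :: "('a::complex_inner \<Rightarrow> 'a) \<Rightarrow> ('a \<Rightarrow> 'a) \<Rightarrow> 'a \<Rightarrow> 'a" where
  "pinching p Y = (\<lambda>x. p (Y (p x)) + (Y (x - p x) - p (Y (x - p x))))"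

lemma pinching_bounded_ops:
  assumes "p \<in> bounded_ops" "Y \<in> bounded_ops"
  shows "pinching p Y \<in> bounded_ops"
proof -
  have q: "(\<lambda>x. x - p x) \<in> bounded_ops"
    by (intro bounded_ops_diff_op bounded_ops_ident assms)
  show ?thesis
    unfolding pinching_def
    by (intro bounded_ops_add_op bounded_ops_diff_op bounded_ops_compose[OF assms(1)]
        bounded_ops_compose[OF assms(2)] assms(1) q)
qed

text \<open>The two diagonal blocks act between orthogonal pieces on both sides, so squared norms
  add.\<close>

lemma pinching_norm_le:
  assumes p: "is_projection p" and Y: "Y \<in> bounded_ops" "\<And>x. norm (Y x) \<le> K * norm x" and "K \<ge> 0"
  shows "norm (pinching p Y x) \<le> K * norm x"
proof (rule power2_le_imp_le)
  have "p (pinching p Y x) = p (Y (p x))" "pinching p Y x - p (pinching p Y x) = Y (x - p x) - p (Y (x - p x))"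
    using is_projectionD[OF p] by (simp_all add: pinching_def bounded_ops_add bounded_ops_diff)
  then have "(norm (pinching p Y x))\<^sup>2 = (norm (p (Y (p x))))\<^sup>2 + (norm (Y (x - p x) - p (Y (x - p x))))\<^sup>2"
    using projection_norm_add[OF p, of "pinching p Y x"] by simp
  also have "\<dots> \<le> (K * norm (p x))\<^sup>2 + (K * norm (x - p x))\<^sup>2"
    by (intro add_mono power_mono norm_ge_zero order_trans[OF projection_norm_le[OF p] Y(2)]
        order_trans[OF projection_norm_le[OF is_projection_compl[OF p]] Y(2)])
  also have "\<dots> = (K * norm x)\<^sup>2"
    using projection_norm_add[OF p, of x] by (simp add: power_mult_distrib flip: distrib_left)
  finally show "(norm (pinching p Y x))\<^sup>2 \<le> (K * norm x)\<^sup>2" .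
qed (use \<open>K \<ge> 0\<close> in simp)

lemma masa_projection_compl:
  assumes D: "masa D" and "p \<in> D" "is_projection p"
  shows "(\<lambda>x :: 'a::complex_hilbert_space. x - p x) \<in> D" "is_projection (\<lambda>x. x - p x)"
  using masa_diff[OF D masa_ident[OF D] \<open>p \<in> D\<close>] is_projection_compl[OF \<open>is_projection p\<close>] by auto

lemma masa_projection_compose:
  assumes D: "masa D" and "p \<in> D" "is_projection p" "q \<in> D" "is_projection q"
  shows "(\<lambda>x. p (q x)) \<in> D" "is_projection (\<lambda>x. p (q x))"
  using assms masa_compose[OF D] masa_commute[OF D \<open>p \<in> D\<close> \<open>q \<in> D\<close>]
  by (auto intro: is_projection_compose)

theorem off_diagonal_annihilator:
  fixes D :: "('a::complex_hilbert_space \<Rightarrow> 'a) set"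
  assumes D: "masa D" and X: "X \<in> bounded_ops"
    and diag: "\<And>A. A \<in> D \<Longrightarrow> cinner (ell2_map A w) z = 0"
    and off: "\<And>P Q. P \<in> D \<Longrightarrow> is_projection P \<Longrightarrow> Q \<in> D \<Longrightarrow> is_projection Q \<Longrightarrow>
      (\<And>x. P (Q x) = 0) \<Longrightarrow> cinner (ell2_map (\<lambda>x. P (X (Q x))) w) z = 0"
  shows "cinner (ell2_map X w) z = 0"
proof -
  define \<phi> where "\<phi> Y = cinner (ell2_map Y w) z" for Y
  have phi_add: "\<phi> (\<lambda>x. S x + T x) = \<phi> S + \<phi> T" if "S \<in> bounded_ops" "T \<in> bounded_ops" for S T
    by (simp add: \<phi>_def ell2_map_add that cinner_add_left)
  obtain K where K: "K > 0" "\<And>x. norm (X x) \<le> K * norm x"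
    using X bounded_ops_bound by blast
  define \<P> where "\<P> = {p \<in> D. is_projection p}"
  define off_zero where "off_zero Y \<longleftrightarrow>
    (\<forall>P\<in>\<P>. \<forall>Q\<in>\<P>. (\<forall>x. P (Q x) = 0) \<longrightarrow> \<phi> (\<lambda>x. P (Y (Q x))) = 0)" for Y
  \<comment> \<open>\<open>B\<close> collects what every pinching preserves: the norm bound, the
    vanishing of \<open>\<phi>\<close> on all corners, and the value of
    \<open>\<phi>\<close>.\<close>
  define B where "B = {Y \<in> bounded_ops. (\<forall>x. norm (Y x) \<le> K * norm x) \<and> off_zero Y \<and> \<phi> Y = \<phi> X}"
  define S where "S p = {Y. \<forall>x. p (Y x) = Y (p x)}" for p :: "'a \<Rightarrow> 'a"
  have pinching_B: "pinching p Y \<in> B" if p: "p \<in> \<P>" and Y: "Y \<in> B" for p Y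
  proof -
    have pD: "p \<in> D" "is_projection p" and YB: "Y \<in> bounded_ops" and Yo: "off_zero Y"
      using p Y by (auto simp: \<P>_def B_def)
    note pB = projection_bounded_ops[OF pD(2)]
    define q where "q = (\<lambda>x. x - p x)"
    have qD: "q \<in> D" "is_projection q"
      using masa_projection_compl[OF D pD] by (auto simp: q_def)
    note qB = projection_bounded_ops[OF qD(2)]
    note c3 = bounded_ops_compose[OF _ bounded_ops_compose[OF YB]]
    have pinch: "pinching p Y = (\<lambda>x. p (Y (p x)) + q (Y (q x)))"
      by (simp add: pinching_def q_def)
    have pq: "\<forall>x. p (q x) = 0" and qp: "\<forall>x. q (p x) = 0"
      by (simp_all add: q_def bounded_ops_diff[OF pB] projection_idem[OF pD(2)])
    have PP: "p \<in> \<P>" "q \<in> \<P>"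
      using pD qD by (auto simp: \<P>_def)
    \<comment> \<open>\<open>Y\<close> differs from its pinching by the two corners
      \<open>p Y q\<close> and \<open>q Y p\<close>, on which \<open>\<phi>\<close>
      vanishes.\<close>
    have "\<phi> Y = \<phi> (\<lambda>x. pinching p Y x + (p (Y (q x)) + q (Y (p x))))"
      by (rule arg_cong[of _ _ \<phi>])
        (simp add: fun_eq_iff pinch q_def bounded_ops_diff[OF YB] bounded_ops_diff[OF pB])
    also have "\<dots> = \<phi> (pinching p Y) + (\<phi> (\<lambda>x. p (Y (q x))) + \<phi> (\<lambda>x. q (Y (p x))))"
      by (simp only: phi_add pinching_bounded_ops pB YB c3 qB bounded_ops_add_op)
    also have "\<phi> (\<lambda>x. p (Y (q x))) = 0"
      using Yo pq PP unfolding off_zero_def by blast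
    also have "\<phi> (\<lambda>x. q (Y (p x))) = 0"
      using Yo qp PP unfolding off_zero_def by blast
    finally have "\<phi> (pinching p Y) = \<phi> Y"
      by simp
    moreover have "off_zero (pinching p Y)"
      unfolding off_zero_def
    proof (intro ballI impI)
      fix P Q assume PQ: "P \<in> \<P>" "Q \<in> \<P>" "\<forall>x. P (Q x) = 0"
      then have PD: "P \<in> D" "is_projection P" and QD: "Q \<in> D" "is_projection Q"
        by (auto simp: \<P>_def)
      \<comment> \<open>Projections of \<open>D\<close> commute, so \<open>P r\<close> and
        \<open>r Q\<close> are again projections in \<open>D\<close> with product 0, and
        \<open>P r Y r Q\<close> is a corner of \<open>Y\<close>.\<close>
      have *: "\<phi> (\<lambda>x. P (r (Y (r (Q x))))) = 0" if r: "r \<in> D" "is_projection r" for r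
      proof -
        have 1: "(\<lambda>x. P (r x)) \<in> \<P>" and 2: "(\<lambda>x. r (Q x)) \<in> \<P>"
          using masa_projection_compose[OF D PD r] masa_projection_compose[OF D r QD]
          by (auto simp: \<P>_def)
        have "P (r (r (Q x))) = 0" for x
          using PQ(3) masa_commute[OF D PD(1) r(1)] by (simp add: projection_idem[OF r(2)]
              bounded_ops_zero projection_bounded_ops[OF r(2)])
        then show ?thesis
          using Yo[unfolded off_zero_def, rule_format, OF 1 2] by simp
      qed
      have b: "(\<lambda>x. P (r (Y (r (Q x))))) \<in> bounded_ops" if "r \<in> bounded_ops" for r
        by (intro bounded_ops_compose[OF projection_bounded_ops[OF PD(2)]] bounded_ops_compose[OF that]
            bounded_ops_compose[OF YB] projection_bounded_ops[OF QD(2)])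
      have "\<phi> (\<lambda>x. P (pinching p Y (Q x))) = \<phi> (\<lambda>x. P (p (Y (p (Q x)))) + P (q (Y (q (Q x)))))"
        by (simp add: pinch bounded_ops_add projection_bounded_ops[OF PD(2)])
      also have "\<dots> = 0"
        by (simp only: phi_add b pB qB * pD qD add_0)
      finally show "\<phi> (\<lambda>x. P (pinching p Y (Q x))) = 0" .
    qed
    moreover have "norm (pinching p Y x) \<le> K * norm x" for x
      using Y K by (intro pinching_norm_le pD) (auto simp: B_def)
    ultimately show ?thesis
      using Y pinching_bounded_ops[OF pB YB] by (auto simp: B_def)
  qed
  have fip: "B \<inter> (\<Inter>p\<in>J. S p) \<noteq> {}" if "finite J" "J \<subseteq> \<P>" for J
    using that
  proof (induction J rule: finite_induct)
    case empty
    have "off_zero X"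
      using off by (auto simp: off_zero_def \<P>_def \<phi>_def)
    then show ?case
      using X K by (auto simp: B_def)
  next
    case (insert p J)
    then obtain Y where Y: "Y \<in> B" "\<And>q. q \<in> J \<Longrightarrow> Y \<in> S q"
      by auto
    have p: "p \<in> \<P>" "p \<in> D" "is_projection p"
      using insert.prems by (auto simp: \<P>_def)
    note pB = projection_bounded_ops[OF p(3)]
    have YB: "Y \<in> bounded_ops"
      using Y by (simp add: B_def)
    have "pinching p Y \<in> S p"
      by (simp add: S_def pinching_def bounded_ops_linear pB YB projection_idem[OF p(3)])
    \<comment> \<open>A further pinching keeps the commutation already achieved, because
      \<open>p\<close> and \<open>q\<close> commute.\<close>
    moreover have "pinching p Y \<in> S q" if "q \<in> J" for q
    proof -
      have q: "q \<in> D" "is_projection q"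
        using that insert.prems by (auto simp: \<P>_def)
      have "q (Y x) = Y (q x)" for x
        using Y(2)[OF that] by (simp add: S_def)
      then show ?thesis
        by (simp add: S_def pinching_def bounded_ops_add bounded_ops_diff
            projection_bounded_ops[OF q(2)] masa_commute[OF D q(1) p(2)])
    qed
    ultimately show ?case
      using pinching_B[OF p(1) Y(1)] by auto
  qed
  have "\<exists>G. \<exists>d\<in>bounded_ops. G \<noteq> bot \<and> eventually (\<lambda>Y. Y \<in> B) G \<and>
    (\<forall>p\<in>\<P>. eventually (\<lambda>Y. Y \<in> S p) G) \<and>
    (\<forall>x y. ((\<lambda>Y. cinner (Y x) y) \<longlongrightarrow> cinner (d x) y) G)"
  proof (rule bounded_operators_cluster_point)
    show "B \<inter> (\<Inter>p\<in>J. S p) \<noteq> {}" if "J \<subseteq> \<P>" "finite J" for J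
      using fip that by blast
  qed (auto simp: B_def)
  then obtain G d where d: "d \<in> bounded_ops" and G: "G \<noteq> bot" "eventually (\<lambda>Y. Y \<in> B) G"
    "\<And>p. p \<in> \<P> \<Longrightarrow> eventually (\<lambda>Y. Y \<in> S p) G"
    and lim: "\<And>x y. ((\<lambda>Y. cinner (Y x) y) \<longlongrightarrow> cinner (d x) y) G"
    by metis
  \<comment> \<open>Each projection of \<open>D\<close> commutes with \<open>Y\<close> eventually
    along \<open>G\<close>, and this passes to the weak limit.\<close>
  have "d \<in> D"
  proof (rule masa_commute_projections[OF D d])
    fix p x assume p: "p \<in> D" "is_projection p"
    show "p (d x) = d (p x)"
    proof (rule cinner_left_eqI)
      fix y
      have "((\<lambda>Y. cinner (p (Y x)) y) \<longlongrightarrow> cinner (p (d x)) y) G"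
        using lim[of x "p y"] by (simp add: projection_cinner[OF p(2)])
      moreover have "\<forall>\<^sub>F Y in G. cinner (p (Y x)) y = cinner (Y (p x)) y"
        using G(3)[of p] p by (auto simp: \<P>_def S_def elim: eventually_mono)
      ultimately have "((\<lambda>Y. cinner (Y (p x)) y) \<longlongrightarrow> cinner (p (d x)) y) G"
        by (rule Lim_transform_eventually)
      then show "cinner (p (d x)) y = cinner (d (p x)) y"
        using tendsto_unique[OF G(1)] lim by blast
    qed
  qed
  then have "\<phi> d = 0"
    by (simp add: \<phi>_def diag)
  have "(\<phi> \<longlongrightarrow> \<phi> d) G"
    unfolding \<phi>_def
    by (rule ultraweak_tendsto_bounded[OF G(1) _ d lim, of K])
      (use G(2) in \<open>auto simp: B_def elim: eventually_mono\<close>)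
  moreover have "\<forall>\<^sub>F Y in G. \<phi> Y = \<phi> X"
    using G(2) by (rule eventually_mono) (simp add: B_def)
  ultimately have "((\<lambda>_. \<phi> X) \<longlongrightarrow> \<phi> d) G"
    by (rule Lim_transform_eventually)
  then have "\<phi> X = \<phi> d"
    using G(1) by (simp add: tendsto_const_iff)
  then show ?thesis
    using \<open>\<phi> d = 0\<close> by (simp add: \<phi>_def)
qed

subsection \<open>Ultra-weak hulls\<close>

text \<open>Identifies the direct sum of two copies of the sequence space with one copy, so that a
  sum of two functionals is again given by a single pair.\<close>

definition ell2_interleave :: "'a::complex_inner ell2 \<Rightarrow> 'a ell2 \<Rightarrow> 'a ell2" where
  "ell2_interleave x y =
     Abs_ell2 (\<lambda>n. if even n then ell2_nth x (n div 2) else ell2_nth y ((n - 1) div 2))"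

lemma ell2_nth_interleave:
  "ell2_nth (ell2_interleave x y) n =
     (if even n then ell2_nth x (n div 2) else ell2_nth y ((n - 1) div 2))"
proof -
  let ?s = "\<lambda>n. if even n then ell2_nth x (n div 2) else ell2_nth y ((n - 1) div 2)"
  have "(\<lambda>n. (norm (?s n))\<^sup>2) = (\<lambda>n. if even n then (norm (ell2_nth x (n div 2)))\<^sup>2
      else (norm (ell2_nth y ((n - 1) div 2)))\<^sup>2)"
    by auto
  then have "square_summable ?s"
    using sums_if[OF summable_sums[OF ell2_summable_norm[of y]] summable_sums[OF ell2_summable_norm[of x]]]
    by (simp add: square_summable_def sums_iff)
  then show ?thesis
    by (simp add: ell2_interleave_def ell2_nth_Abs)
qed

lemma cinner_ell2_interleave:
  "cinner (ell2_interleave x y) (ell2_interleave u v) = cinner x u + cinner y v"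
proof -
  let ?f = "\<lambda>n. cinner (ell2_nth x n) (ell2_nth u n)"
  let ?g = "\<lambda>n. cinner (ell2_nth y n) (ell2_nth v n)"
  have "?f sums cinner x u" "?g sums cinner y v"
    unfolding cinner_ell2_def by (intro summable_sums ell2_summable_cinner)+
  then have Re: "(\<lambda>n. Re (?f n)) sums Re (cinner x u)" "(\<lambda>n. Re (?g n)) sums Re (cinner y v)"
    and Im: "(\<lambda>n. Im (?f n)) sums Im (cinner x u)" "(\<lambda>n. Im (?g n)) sums Im (cinner y v)"
    by (simp_all add: sums_complex_iff)
  have "(\<lambda>n. cinner (ell2_nth (ell2_interleave x y) n) (ell2_nth (ell2_interleave u v) n))
      sums (cinner x u + cinner y v)"
    unfolding sums_complex_iff
    using sums_if[OF Re(2) Re(1)] sums_if[OF Im(2) Im(1)]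
    by (auto simp: ell2_nth_interleave add.commute if_distrib cong: if_cong)
  then show ?thesis
    by (simp add: cinner_ell2_def sums_iff)
qed

lemma ell2_map_interleave:
  "T \<in> bounded_ops \<Longrightarrow>
    ell2_map T (ell2_interleave x y) = ell2_interleave (ell2_map T x) (ell2_map T y)"
  by (rule ell2_eqI) (simp add: ell2_nth_map ell2_nth_interleave)

lemma ultraweak_functional_add:
  "\<exists>w z. \<forall>T\<in>bounded_ops. cinner (ell2_map T w) z =
     cinner (ell2_map T w1) z1 + c * cinner (ell2_map T w2) z2"
  by (intro exI[of _ "ell2_interleave w1 w2"] exI[of _ "ell2_interleave z1 (cnj c *\<^sub>C z2)"])
    (simp add: ell2_map_interleave cinner_ell2_interleave cinner_scaleC_right)

text \<open>Moving \<open>X\<close> to the other side of the inner product gives a difference of two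
  functionals of \<open>Y\<close>, with vectors \<open>w\<close>, \<open>X' z\<close> and
  \<open>X w\<close>, \<open>z\<close>, where \<open>X'\<close> is the adjoint.\<close>

lemma ultraweak_functional_commutator:
  fixes X :: "'a::complex_hilbert_space \<Rightarrow> 'a"
  assumes X: "X \<in> bounded_ops"
  shows "\<exists>w' z'. \<forall>Y\<in>bounded_ops. cinner (ell2_map Y w') z' = cinner (ell2_map (commutator X Y) w) z"
proof -
  obtain X' where X': "X' \<in> bounded_ops" "is_adjoint X' X"
    using exists_adjoint[OF X] by blast
  note adj = is_adjoint_ell2_map[OF X'(1) X X'(2), unfolded is_adjoint_def, rule_format]
  obtain w' z' where "\<forall>Y\<in>bounded_ops. cinner (ell2_map Y w') z' =
     cinner (ell2_map Y w) (ell2_map X' z) + (-1) * cinner (ell2_map Y (ell2_map X w)) z"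
    using ultraweak_functional_add[of w "ell2_map X' z" "-1" "ell2_map X w" z] by blast
  then have "cinner (ell2_map Y w') z' = cinner (ell2_map (commutator X Y) w) z"
    if "Y \<in> bounded_ops" for Y
    using that by (simp add: commutator_def ell2_map_diff ell2_map_compose bounded_ops_compose X
        cinner_diff_left adj)
  then show ?thesis
    by blast
qed

text \<open>The double annihilator of \<open>L\<close>; by Hahn-Banach, for a linear subspace it is
  the ultra-weak closure. This form gives access to closure arguments without the topology.\<close>

definition ultraweak_hull :: "('a::complex_inner \<Rightarrow> 'a) set \<Rightarrow> ('a \<Rightarrow> 'a) set" where
  "ultraweak_hull L = {T \<in> bounded_ops. \<forall>w z.
     (\<forall>S\<in>L. cinner (ell2_map S w) z = 0) \<longrightarrow> cinner (ell2_map T w) z = 0}"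

lemma ultraweak_hull_bounded_ops: "T \<in> ultraweak_hull L \<Longrightarrow> T \<in> bounded_ops"
  by (simp add: ultraweak_hull_def)

lemma subset_ultraweak_hull: "L \<subseteq> bounded_ops \<Longrightarrow> L \<subseteq> ultraweak_hull L"
  by (auto simp: ultraweak_hull_def)

lemma ultraweak_hull_add:
  "S \<in> ultraweak_hull L \<Longrightarrow> T \<in> ultraweak_hull L \<Longrightarrow> (\<lambda>x. S x + T x) \<in> ultraweak_hull L"
  by (simp add: ultraweak_hull_def bounded_ops_add_op ell2_map_add cinner_add_left)

lemma ultraweak_hull_scaleC:
  "T \<in> ultraweak_hull L \<Longrightarrow> (\<lambda>x. c *\<^sub>C T x) \<in> ultraweak_hull L"
  by (simp add: ultraweak_hull_def bounded_ops_scaleC_op ell2_map_scaleC cinner_scaleC_left)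

lemma bounded_ops_commutator:
  "S \<in> bounded_ops \<Longrightarrow> T \<in> bounded_ops \<Longrightarrow> commutator S T \<in> bounded_ops"
  unfolding commutator_def
  by (rule bounded_ops_diff_op[OF bounded_ops_compose bounded_ops_compose])

text \<open>If bracketing with \<open>X\<close> sends \<open>L\<close> into the hull, then
  functionals killing \<open>L\<close> pull back to functionals killing \<open>L\<close>, so the
  whole hull is sent into itself. This is applied first with \<open>X\<close> in \<open>L\<close>
  and, after antisymmetry, with \<open>X\<close> in the hull.\<close>

lemma ultraweak_hull_commutator:
  fixes L :: "('a::complex_hilbert_space \<Rightarrow> 'a) set"
  assumes L: "operator_lie_algebra L" and X: "X \<in> ultraweak_hull L" and Y: "Y \<in> ultraweak_hull L"
  shows "commutator X Y \<in> ultraweak_hull L"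
proof -
  have LB: "L \<subseteq> bounded_ops"
    using L by (simp add: operator_lie_algebra_def operator_subspace_def)
  have kill: "commutator X Y \<in> ultraweak_hull L"
    if "X \<in> bounded_ops" "Y \<in> ultraweak_hull L" "\<And>S. S \<in> L \<Longrightarrow> commutator X S \<in> ultraweak_hull L"
    for X Y
  proof -
    have YB: "Y \<in> bounded_ops"
      using that by (simp add: ultraweak_hull_bounded_ops)
    have "cinner (ell2_map (commutator X Y) w) z = 0"
      if wz: "\<And>S. S \<in> L \<Longrightarrow> cinner (ell2_map S w) z = 0" for w z
    proof -
      obtain w' z' where *: "\<And>Y. Y \<in> bounded_ops \<Longrightarrow>
          cinner (ell2_map Y w') z' = cinner (ell2_map (commutator X Y) w) z"
        using ultraweak_functional_commutator[OF \<open>X \<in> bounded_ops\<close>, of w z] by blast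
      have "cinner (ell2_map S w') z' = 0" if S: "S \<in> L" for S
        using *[of S] S LB \<open>\<And>S. S \<in> L \<Longrightarrow> commutator X S \<in> ultraweak_hull L\<close>[OF S] wz
        by (auto simp: ultraweak_hull_def)
      then have "cinner (ell2_map Y w') z' = 0"
        using \<open>Y \<in> ultraweak_hull L\<close> by (simp add: ultraweak_hull_def)
      then show ?thesis
        using *[OF YB] by simp
    qed
    then show ?thesis
      using bounded_ops_commutator[OF \<open>X \<in> bounded_ops\<close> YB] by (simp add: ultraweak_hull_def)
  qed
  have "commutator X S \<in> ultraweak_hull L" if S: "S \<in> L" for S
  proof -
    have "commutator S R \<in> ultraweak_hull L" if "R \<in> L" for R
      using L S that subset_ultraweak_hull[OF LB] by (auto simp: operator_lie_algebra_def)
    then have "commutator S X \<in> ultraweak_hull L"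
      using kill[OF _ X] S LB by blast
    then have "(\<lambda>x. (-1) *\<^sub>C commutator S X x) \<in> ultraweak_hull L"
      by (rule ultraweak_hull_scaleC)
    moreover have "(\<lambda>x. (-1) *\<^sub>C commutator S X x) = commutator X S"
      by (simp add: fun_eq_iff commutator_def complex_vector.scale_minus_left scaleC_one)
    ultimately show ?thesis
      by simp
  qed
  then show ?thesis
    by (rule kill[OF ultraweak_hull_bounded_ops[OF X] Y])
qed

section \<open>The hull of a Lie algebra containing \<open>D\<close> is an associative
  algebra\<close>

context
  fixes D L :: "('a::complex_hilbert_space \<Rightarrow> 'a) set"
  assumes L: "operator_lie_algebra L" and D: "masa D" and DL: "D \<subseteq> L"
begin

lemma masa_subset_ultraweak_hull: "D \<subseteq> ultraweak_hull L"
  using DL subset_ultraweak_hull[of L] L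
  by (auto simp: operator_lie_algebra_def operator_subspace_def)

text \<open>The double bracket \<open>U = [[P, X], Q]\<close> equals \<open>P X Q + Q X P\<close>,
  while \<open>[P, U] = P X Q - Q X P\<close>; half the sum isolates the first corner.\<close>

lemma ultraweak_hull_off_diagonal:
  assumes X: "X \<in> ultraweak_hull L" and P: "P \<in> D" "is_projection P" and Q: "Q \<in> D" "is_projection Q"
    and PQ: "\<And>x. P (Q x) = 0"
  shows "(\<lambda>x. P (X (Q x))) \<in> ultraweak_hull L"
proof -
  note XB = ultraweak_hull_bounded_ops[OF X] and PB = projection_bounded_ops[OF P(2)]
    and QB = projection_bounded_ops[OF Q(2)]
  have PA: "P \<in> ultraweak_hull L" and QA: "Q \<in> ultraweak_hull L"
    using masa_subset_ultraweak_hull P Q by auto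
  have QP: "Q (P x) = 0" for x
    using PQ masa_commute[OF D P(1) Q(1)] by simp
  define U where "U = commutator (commutator P X) Q"
  have U: "U \<in> ultraweak_hull L"
    unfolding U_def by (intro ultraweak_hull_commutator[OF L] PA QA X)
  have U_eq: "U = (\<lambda>x. P (X (Q x)) + Q (X (P x)))"
    by (simp add: U_def commutator_def fun_eq_iff bounded_ops_diff[OF QB] bounded_ops_zero[OF XB] PQ QP)
  have "(\<lambda>x. (1/2) *\<^sub>C (U x + commutator P U x)) \<in> ultraweak_hull L"
    by (intro ultraweak_hull_scaleC ultraweak_hull_add U ultraweak_hull_commutator[OF L] PA)
  moreover have "(1/2) *\<^sub>C (U x + commutator P U x) = P (X (Q x))" for x
  proof -
    have "U x + commutator P U x = P (X (Q x)) + P (X (Q x))"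
      by (simp add: U_eq commutator_def bounded_ops_add[OF PB] bounded_ops_zero[OF XB]
          bounded_ops_zero[OF QB] bounded_ops_zero[OF PB] PQ QP projection_idem[OF P(2)])
    also have "(1/2) *\<^sub>C \<dots> = (1/2 + 1/2) *\<^sub>C P (X (Q x))"
      by (simp only: scaleC_add_left scaleC_add_right)
    finally show ?thesis
      by (simp add: scaleC_one)
  qed
  ultimately show ?thesis
    by simp
qed

lemma ultraweak_hull_from_off_diagonal:
  assumes X: "X \<in> bounded_ops"
    and "\<And>P Q. P \<in> D \<Longrightarrow> is_projection P \<Longrightarrow> Q \<in> D \<Longrightarrow> is_projection Q \<Longrightarrow>
      (\<And>x. P (Q x) = 0) \<Longrightarrow> (\<lambda>x. P (X (Q x))) \<in> ultraweak_hull L"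
  shows "X \<in> ultraweak_hull L"
proof -
  have "cinner (ell2_map X w) z = 0" if wz: "\<forall>S\<in>L. cinner (ell2_map S w) z = 0" for w z
  proof (rule off_diagonal_annihilator[OF D X])
    show "cinner (ell2_map A w) z = 0" if "A \<in> D" for A
      using that wz DL by blast
    show "cinner (ell2_map (\<lambda>x. P (X (Q x))) w) z = 0"
      if "P \<in> D" "is_projection P" "Q \<in> D" "is_projection Q" "\<And>x. P (Q x) = 0" for P Q
      using assms(2)[OF that] wz by (simp add: ultraweak_hull_def)
  qed
  then show ?thesis
    using X by (simp add: ultraweak_hull_def)
qed

text \<open>Each corner \<open>P A X Q\<close> is the bracket of \<open>A P\<close> with
  \<open>P X Q\<close>, as \<open>Q A P = 0\<close>.\<close>

lemma ultraweak_hull_masa_left: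
  assumes A: "A \<in> D" and X: "X \<in> ultraweak_hull L"
  shows "(\<lambda>x. A (X x)) \<in> ultraweak_hull L"
proof (rule ultraweak_hull_from_off_diagonal)
  note XB = ultraweak_hull_bounded_ops[OF X]
  have AB: "A \<in> bounded_ops"
    using A masa_subset_bounded_ops[OF D] by blast
  show "(\<lambda>x. A (X x)) \<in> bounded_ops"
    by (rule bounded_ops_compose[OF AB XB])
  fix P Q assume P: "P \<in> D" "is_projection P" and Q: "Q \<in> D" "is_projection Q"
    and PQ: "\<And>x. P (Q x) = 0"
  note PB = projection_bounded_ops[OF P(2)] and QB = projection_bounded_ops[OF Q(2)]
  have QAP: "Q (A (P x)) = 0" for x
    using PQ by (simp add: masa_commute[OF D Q(1)] A P(1) Q(1) bounded_ops_zero[OF AB])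
  have "commutator (\<lambda>x. A (P x)) (\<lambda>x. P (X (Q x))) \<in> ultraweak_hull L"
    by (rule ultraweak_hull_commutator[OF L
          subsetD[OF masa_subset_ultraweak_hull masa_compose[OF D A P(1)]]
          ultraweak_hull_off_diagonal[OF X P Q PQ]])
  moreover have "commutator (\<lambda>x. A (P x)) (\<lambda>x. P (X (Q x))) = (\<lambda>x. P (A (X (Q x))))"
    by (simp add: commutator_def fun_eq_iff projection_idem[OF P(2)] QAP
        bounded_ops_zero[OF XB] bounded_ops_zero[OF PB] masa_commute[OF D P(1) A])
  ultimately show "(\<lambda>x. P (A (X (Q x)))) \<in> ultraweak_hull L"
    by simp
qed

text \<open>Follows from the left case through \<open>X A = A X - [A, X]\<close>.\<close>

lemma ultraweak_hull_masa_right: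
  assumes A: "A \<in> D" and X: "X \<in> ultraweak_hull L"
  shows "(\<lambda>x. X (A x)) \<in> ultraweak_hull L"
proof -
  have "commutator A X \<in> ultraweak_hull L"
    using A masa_subset_ultraweak_hull by (intro ultraweak_hull_commutator[OF L] X) auto
  then have "(\<lambda>x. A (X x) + (-1) *\<^sub>C commutator A X x) \<in> ultraweak_hull L"
    by (intro ultraweak_hull_add[OF ultraweak_hull_masa_left[OF A X]] ultraweak_hull_scaleC)
  then show ?thesis
    by (simp add: commutator_def complex_vector.scale_minus_left scaleC_one)
qed

text \<open>The corner \<open>P X Y Q\<close> is the bracket of \<open>P X\<close> and
  \<open>Y Q\<close>, both in the hull since it is closed under multiplication by \<open>D\<close>
  on either side.\<close>

lemma ultraweak_hull_compose:
  assumes X: "X \<in> ultraweak_hull L" and Y: "Y \<in> ultraweak_hull L"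
  shows "(\<lambda>x. X (Y x)) \<in> ultraweak_hull L"
proof (rule ultraweak_hull_from_off_diagonal)
  note XB = ultraweak_hull_bounded_ops[OF X] and YB = ultraweak_hull_bounded_ops[OF Y]
  show "(\<lambda>x. X (Y x)) \<in> bounded_ops"
    by (rule bounded_ops_compose[OF XB YB])
  fix P Q assume P: "P \<in> D" "is_projection P" and Q: "Q \<in> D" "is_projection Q"
    and PQ: "\<And>x. P (Q x) = 0"
  have "commutator (\<lambda>x. P (X x)) (\<lambda>x. Y (Q x)) \<in> ultraweak_hull L"
    by (intro ultraweak_hull_commutator[OF L] ultraweak_hull_masa_left[OF P(1) X]
        ultraweak_hull_masa_right[OF Q(1) Y])
  moreover have "commutator (\<lambda>x. P (X x)) (\<lambda>x. Y (Q x)) = (\<lambda>x. P (X (Y (Q x))))"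
    using PQ masa_commute[OF D P(1) Q(1)] by (simp add: commutator_def bounded_ops_zero[OF YB])
  ultimately show "(\<lambda>x. P (X (Y (Q x)))) \<in> ultraweak_hull L"
    by simp
qed

end

subsection \<open>Transitive algebras containing a maximal abelian algebra\<close>

text \<open>The vectors whose whole orbit under \<open>A\<close> is killed by \<open>Q'\<close> form
  a closed invariant subspace containing the range of \<open>Q\<close>. If it is zero then
  \<open>Q = 0\<close>; if it is everything then \<open>Q' = 0\<close>.\<close>

lemma transitive_projections:
  fixes A :: "('a::complex_hilbert_space \<Rightarrow> 'a) set"
  assumes AB: "A \<subseteq> bounded_ops" and id: "(\<lambda>x. x) \<in> A"
    and comp: "\<And>S T. S \<in> A \<Longrightarrow> T \<in> A \<Longrightarrow> S \<circ> T \<in> A"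
    and trans: "\<And>M. invariant_subspace A M \<Longrightarrow> M = {0} \<or> M = UNIV"
    and Q: "Q' \<in> bounded_ops"
    and vanish: "\<And>T x. T \<in> A \<Longrightarrow> Q' (T (Q x)) = 0"
  shows "(\<forall>x. Q x = 0) \<or> (\<forall>x. Q' x = 0)"
proof -
  define N where "N = {y. \<forall>T\<in>A. Q' (T y) = 0}"
  have B: "T \<in> bounded_ops" if "T \<in> A" for T
    using that AB by blast
  have "complex_vector.subspace N"
    by (auto simp: complex_vector.subspace_def N_def B Q bounded_ops_zero bounded_ops_add
        bounded_ops_scaleC)
  moreover have "closed N"
  proof -
    have "N = (\<Inter>T\<in>A. {y. Q' (T y) = 0})"
      by (auto simp: N_def)
    moreover have "closed {y. Q' (T y) = 0}" if "T \<in> A" for T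
      by (intro closed_Collect_eq continuous_on_const
          bounded_ops_continuous_on[OF Q bounded_ops_continuous_on[OF B[OF that] continuous_on_id]])
    ultimately show ?thesis
      by (auto intro: closed_INT)
  qed
  moreover have "T ` N \<subseteq> N" if "T \<in> A" for T
  proof -
    have "Q' (S (T y)) = 0" if "S \<in> A" "y \<in> N" for S y
    proof -
      have "S \<circ> T \<in> A"
        using comp \<open>S \<in> A\<close> \<open>T \<in> A\<close> by blast
      then show ?thesis
        using \<open>y \<in> N\<close> by (auto simp: N_def)
    qed
    then show ?thesis
      by (auto simp: N_def)
  qed
  ultimately have "N = {0} \<or> N = UNIV"
    by (intro trans) (auto simp: invariant_subspace_def)
  moreover have "Q x \<in> N" for x
    by (simp add: N_def vanish)
  moreover have "Q' y = 0" if "y \<in> N" for y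
    using that id by (auto simp: N_def)
  ultimately show ?thesis
    by blast
qed

text \<open>With \<open>a\<close> and \<open>b\<close> the infimum and supremum of the form of
  \<open>f\<close> on unit vectors, a nonzero corner \<open>R T Q\<close> from the top of the
  spectrum to the bottom is compared with \<open>bound\<close> to give
  \<open>b \<le> sqrt (a b)\<close> in the limit.\<close>

lemma transitive_scalar_operator:
  fixes A D :: "('a::complex_hilbert_space \<Rightarrow> 'a) set"
  assumes AB: "A \<subseteq> bounded_ops" and D: "masa D" and DA: "D \<subseteq> A"
    and comp: "\<And>S T. S \<in> A \<Longrightarrow> T \<in> A \<Longrightarrow> S \<circ> T \<in> A"
    and trans: "\<And>M. invariant_subspace A M \<Longrightarrow> M = {0} \<or> M = UNIV"
    and f: "f \<in> D" "is_adjoint f f" and pos: "\<And>h. 0 \<le> Re (cinner (f h) h)"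
    and bound: "\<And>T K h k. T \<in> A \<Longrightarrow> (\<And>x. norm (T x) \<le> K * norm x) \<Longrightarrow> 0 \<le> K \<Longrightarrow>
      cmod (cinner (T (f h)) k) \<le> K * (sqrt (Re (cinner (f h) h)) * sqrt (Re (cinner (f k) k)))"
  shows "\<exists>a. \<forall>h. f h = a *\<^sub>R h"
proof (cases "UNIV = {0 :: 'a}")
  case True
  then have "f h = 0 *\<^sub>R h" for h
    by (metis UNIV_I singletonD)
  then show ?thesis
    by blast
next
  case False
  have fB: "f \<in> bounded_ops"
    using f masa_subset_bounded_ops[OF D] by blast
  obtain K where K: "K > 0" "\<And>x. norm (f x) \<le> K * norm x"
    using fB bounded_ops_bound by blast
  define q where "q h = Re (cinner (f h) h)" for h
  have q_scale: "q (r *\<^sub>R h) = r\<^sup>2 * q h" for r h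
    by (simp add: q_def bounded_ops_scaleR[OF fB] cinner_scaleR_left cinner_scaleR_right power2_eq_square)
  have q_le: "q h \<le> K * (norm h)\<^sup>2" for h
    using order_trans[OF complex_Re_le_cmod order_trans[OF cmod_cinner_le mult_right_mono[OF K(2) norm_ge_zero]]]
    by (simp add: q_def power2_eq_square mult.assoc)
  define S where "S = q ` {h. norm h = 1}"
  obtain h0 :: 'a where "h0 \<noteq> 0"
    using False by blast
  then have "(1 / norm h0) *\<^sub>R h0 \<in> {h. norm h = 1}"
    by simp
  then have S_ne: "S \<noteq> {}"
    unfolding S_def by blast
  have S_below: "bdd_below S"
    unfolding S_def by (rule bdd_belowI2[of _ 0]) (simp add: q_def pos)
  have S_above: "bdd_above S"
    unfolding S_def
  proof (rule bdd_aboveI2)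
    show "q h \<le> K" if "h \<in> {h. norm h = 1}" for h
      using q_le[of h] that by simp
  qed
  define a where "a = Inf S"
  define b where "b = Sup S"
  have unit: "a \<le> q h" "q h \<le> b" if "norm h = 1" for h
    unfolding a_def b_def using that S_below S_above
    by (auto simp: S_def intro!: cInf_lower cSup_upper)
  have range: "a * (norm h)\<^sup>2 \<le> q h" "q h \<le> b * (norm h)\<^sup>2" for h
  proof -
    have "a * (norm h)\<^sup>2 \<le> q h \<and> q h \<le> b * (norm h)\<^sup>2"
    proof (cases "h = 0")
      case False
      define u where "u = (1 / norm h) *\<^sub>R h"
      have "norm u = 1" and h: "h = norm h *\<^sub>R u"
        using False by (auto simp: u_def)
      have "q h = (norm h)\<^sup>2 * q u"
        by (subst h) (rule q_scale)
      then show ?thesis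
        using unit[OF \<open>norm u = 1\<close>] by (auto simp: mult.commute intro: mult_right_mono)
    qed (simp add: q_def bounded_ops_zero[OF fB])
    then show "a * (norm h)\<^sup>2 \<le> q h" "q h \<le> b * (norm h)\<^sup>2"
      by auto
  qed
  have "0 \<le> a"
    unfolding a_def S_def using S_ne by (intro cINF_greatest) (auto simp: S_def q_def pos)
  have "a \<le> b"
    using S_ne unit by (force simp: S_def)
  \<comment> \<open>Here \<open>Q\<close> cuts out the part of \<open>f\<close> above
    \<open>b - e\<close> and \<open>R\<close> the part below \<open>a + e\<close>; both are nonzero
    by the choice of \<open>a\<close> and \<open>b\<close>.\<close>
  have key: "b - e \<le> sqrt b * sqrt (a + e) + e" if e: "e > 0" for e
  proof (cases "b - e \<le> 0")
    case True
    also have "0 \<le> sqrt b * sqrt (a + e) + e"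
      using \<open>0 \<le> a\<close> \<open>a \<le> b\<close> e by (intro add_nonneg_nonneg mult_nonneg_nonneg) auto
    finally show ?thesis .
  next
    case False
    obtain Q where QD: "Q \<in> D" and Q: "is_projection Q"
      and Q_ge: "\<And>x. (b - e) * (norm (Q x))\<^sup>2 \<le> Re (cinner (f (Q x)) (Q x))"
      and Q_le: "\<And>x. Re (cinner (f (x - Q x)) (x - Q x)) \<le> (b - e) * (norm (x - Q x))\<^sup>2"
      using spectral_split_at[OF D f, of "b - e"] by metis
    obtain P where PD: "P \<in> D" and P: "is_projection P"
      and P_ge: "\<And>x. (a + e) * (norm (P x))\<^sup>2 \<le> Re (cinner (f (P x)) (P x))"
      and P_le: "\<And>x. Re (cinner (f (x - P x)) (x - P x)) \<le> (a + e) * (norm (x - P x))\<^sup>2"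
      using spectral_split_at[OF D f, of "a + e"] by metis
    define R where "R = (\<lambda>x. x - P x)"
    have RD: "R \<in> D" and R: "is_projection R"
      unfolding R_def using masa_projection_compl[OF D PD P] by auto
    note QB = projection_bounded_ops[OF Q] and RB = projection_bounded_ops[OF R]
    have "\<exists>x. Q x \<noteq> 0"
    proof (rule ccontr)
      assume "\<nexists>x. Q x \<noteq> 0"
      then have "q h \<le> b - e" if "norm h = 1" for h
        using Q_le[of h] that by (simp add: q_def)
      then have "s \<le> b - e" if "s \<in> S" for s
        using that by (auto simp: S_def)
      then have "b \<le> b - e"
        unfolding b_def using S_ne by (intro cSup_least) auto
      then show False
        using e by simp
    qed
    moreover have "\<exists>x. R x \<noteq> 0"
    proof (rule ccontr)
      assume "\<nexists>x. R x \<noteq> 0"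
      then have "P x = x" for x
        by (simp add: R_def)
      then have "a + e \<le> q h" if "norm h = 1" for h
        using P_ge[of h] that by (simp add: q_def)
      then have "a + e \<le> s" if "s \<in> S" for s
        using that by (auto simp: S_def)
      then have "a + e \<le> a"
        unfolding a_def using S_ne by (intro cInf_greatest) auto
      then show False
        using e by simp
    qed
    ultimately obtain T x0 where T: "T \<in> A" and x0: "R (T (Q x0)) \<noteq> 0"
      using transitive_projections[OF AB subsetD[OF DA masa_ident[OF D]] comp trans RB, of Q] by blast
    define T1 where "T1 = (\<lambda>x. R (T (Q x)))"
    have "T1 = R \<circ> (T \<circ> Q)"
      by (simp add: T1_def fun_eq_iff)
    then have T1A: "T1 \<in> A"
      using comp[OF subsetD[OF DA RD] comp[OF T subsetD[OF DA QD]]] by simp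
    then have T1B: "T1 \<in> bounded_ops"
      using AB by blast
    note T1_bl = bounded_ops_imp_bounded_linear[OF T1B]
    define t where "t = onorm T1"
    have t: "norm (T1 x) \<le> t * norm x" for x
      unfolding t_def by (rule onorm[OF T1_bl])
    have "t > 0"
      unfolding t_def onorm_pos_lt[OF T1_bl] using x0 by (auto simp: T1_def)
    let ?c = "sqrt b * sqrt (a + e) + e"
    have nonneg: "0 \<le> t * ?c / (b - e)"
      using \<open>t > 0\<close> \<open>0 \<le> a\<close> \<open>a \<le> b\<close> e False
      by (intro divide_nonneg_nonneg mult_nonneg_nonneg add_nonneg_nonneg) auto
    have "norm (T1 h) \<le> t * ?c / (b - e) * norm h" for h
    proof (cases "T1 h = 0")
      case True
      then show ?thesis
        using mult_nonneg_nonneg[OF nonneg norm_ge_zero] by simp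
    next
      case T1h: False
      define k where "k = T1 h"
      let ?g = "\<lambda>h. f (Q h) - (b - e) *\<^sub>R Q h"
      have T1Q: "T1 (Q x) = T1 x" and RT1: "R (T1 x) = T1 x" for x
        by (simp_all add: T1_def projection_idem[OF Q] projection_idem[OF R])
      \<comment> \<open>On the range of \<open>Q\<close> the operator \<open>f\<close> is within
        \<open>e\<close> of the scalar \<open>b - e\<close>, so the scalar is traded for
        \<open>f\<close> with error term \<open>?g\<close>.\<close>
      have "(b - e) *\<^sub>R T1 h = T1 (f (Q h)) - T1 (?g h)"
        by (simp add: bounded_ops_diff[OF T1B] bounded_ops_scaleR[OF T1B] T1Q)
      then have "complex_of_real (b - e) * cinner (T1 h) k = cinner (T1 (f (Q h))) k - cinner (T1 (?g h)) k"
        by (metis cinner_diff_left cinner_scaleR_left)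
      moreover have "cinner (T1 h) k = complex_of_real ((norm k)\<^sup>2)"
        by (simp add: k_def cinner_self)
      ultimately have "(b - e) * (norm k)\<^sup>2 = cmod (cinner (T1 (f (Q h))) k - cinner (T1 (?g h)) k)"
        using False by (metis abs_of_nonneg diff_gt_0_iff_gt less_eq_real_def linorder_not_less
            mult_nonneg_nonneg norm_of_real of_real_mult zero_le_power2)
      also have "\<dots> \<le> cmod (cinner (T1 (f (Q h))) k) + cmod (cinner (T1 (?g h)) k)"
        by (rule norm_triangle_ineq4)
      \<comment> \<open>The hypothesis \<open>bound\<close> applies to \<open>T1\<close>, and
        \<open>k\<close> lies in the range of \<open>R\<close>, where the form of \<open>f\<close>
        is at most \<open>a + e\<close>.\<close>
      also have "cmod (cinner (T1 (f (Q h))) k) \<le> t * (sqrt b * norm h * (sqrt (a + e) * norm k))"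
      proof -
        have "R k = k"
          by (simp add: k_def RT1)
        then have "q k \<le> (a + e) * (norm k)\<^sup>2"
          using P_le[of k] by (simp add: R_def q_def)
        then have "sqrt (q k) \<le> sqrt (a + e) * norm k"
          using real_sqrt_le_mono by (fastforce simp: real_sqrt_mult)
        moreover have "q (Q h) \<le> b * (norm h)\<^sup>2"
          using range(2)[of "Q h"] projection_norm_le[OF Q, of h] \<open>0 \<le> a\<close> \<open>a \<le> b\<close>
          by (elim order_trans) (auto intro!: mult_left_mono power_mono)
        then have "sqrt (q (Q h)) \<le> sqrt b * norm h"
          using real_sqrt_le_mono by (fastforce simp: real_sqrt_mult)
        ultimately have "sqrt (q (Q h)) * sqrt (q k) \<le> sqrt b * norm h * (sqrt (a + e) * norm k)"
          using \<open>0 \<le> a\<close> \<open>a \<le> b\<close> by (intro mult_mono) (auto simp: q_def pos)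
        moreover have "cmod (cinner (T1 (f (Q h))) k) \<le> t * (sqrt (q (Q h)) * sqrt (q k))"
          unfolding q_def using t \<open>t > 0\<close> by (intro bound T1A) auto
        ultimately show ?thesis
          using \<open>t > 0\<close> by (meson less_imp_le mult_left_mono order_trans)
      qed
      also have "cmod (cinner (T1 (?g h)) k) \<le> t * (e * norm h) * norm k"
      proof -
        have "norm (?g h) \<le> e * norm h"
          using Q_ge range(2) e
          by (intro spectral_slice_norm_le fB f(2) Q masa_commute[OF D f(1) QD]) (auto simp: q_def)
        then have "norm (T1 (?g h)) \<le> t * (e * norm h)"
          using \<open>t > 0\<close> by (intro order_trans[OF t] mult_left_mono) auto
        then show ?thesis
          by (intro order_trans[OF cmod_cinner_le] mult_right_mono) auto
      qed
      also have "t * (sqrt b * norm h * (sqrt (a + e) * norm k)) + t * (e * norm h) * norm k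
          = (t * ?c * norm h) * norm k"
        by (simp add: algebra_simps)
      finally have "((b - e) * norm k) * norm k \<le> (t * ?c * norm h) * norm k"
        by (simp add: power2_eq_square mult.assoc)
      then have "(b - e) * norm k \<le> t * ?c * norm h"
        by (rule mult_right_le_imp_le) (use T1h in \<open>simp add: k_def\<close>)
      then show ?thesis
        using False by (simp add: k_def pos_le_divide_eq mult.commute)
    qed
    then have "t \<le> t * ?c / (b - e)"
      using onorm_bound[OF nonneg] unfolding t_def by blast
    then have "t * (b - e) \<le> t * ?c"
      using False by (simp add: pos_le_divide_eq)
    then show ?thesis
      using \<open>t > 0\<close> by simp
  qed
  \<comment> \<open>Let \<open>e = 1 / Suc n\<close> tend to 0 in \<open>key\<close>.\<close>
  have "b \<le> sqrt b * sqrt a"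
  proof (rule LIMSEQ_le)
    have e: "(\<lambda>n. 1 / real (Suc n)) \<longlonglongrightarrow> 0"
      by (rule LIMSEQ_Suc[OF lim_1_over_n])
    show "(\<lambda>n. b - 1 / real (Suc n)) \<longlonglongrightarrow> b"
      by (rule tendsto_eq_intros e | simp)+
    show "(\<lambda>n. sqrt b * sqrt (a + 1 / real (Suc n)) + 1 / real (Suc n)) \<longlonglongrightarrow> sqrt b * sqrt a"
      by (rule tendsto_eq_intros e | simp)+
    show "\<exists>N. \<forall>n\<ge>N. b - 1 / real (Suc n) \<le> sqrt b * sqrt (a + 1 / real (Suc n)) + 1 / real (Suc n)"
      by (intro exI allI impI key) simp
  qed
  then have "sqrt b * sqrt b \<le> sqrt b * sqrt a"
    using \<open>0 \<le> a\<close> \<open>a \<le> b\<close> by simp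
  then have "b \<le> a"
  proof (cases "b = 0")
    case False
    then have "0 < sqrt b"
      using \<open>0 \<le> a\<close> \<open>a \<le> b\<close> by simp
    with \<open>sqrt b * sqrt b \<le> sqrt b * sqrt a\<close> have "sqrt b \<le> sqrt a"
      by (rule mult_left_le_imp_le)
    then show ?thesis
      by simp
  qed (use \<open>0 \<le> a\<close> in simp)
  have "norm (f h - a *\<^sub>R h) \<le> 0 * norm h" for h
  proof (rule positive_operator_norm_le[where B = "\<lambda>h. f h - a *\<^sub>R h"])
    show "(\<lambda>h. f h - a *\<^sub>R h) \<in> bounded_ops"
      by (intro bounded_ops_diff_op bounded_ops_scaleR_op bounded_ops_ident fB)
    show "is_adjoint (\<lambda>h. f h - a *\<^sub>R h) (\<lambda>h. f h - a *\<^sub>R h)"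
      by (intro is_adjoint_diff is_adjoint_scaleR is_adjoint_ident f)
    have "Re (cinner (f h - a *\<^sub>R h) h) = q h - a * (norm h)\<^sup>2" for h
      by (simp add: q_def cinner_diff_left cinner_scaleR_left cinner_self)
    then show "0 \<le> Re (cinner (f h - a *\<^sub>R h) h)" "Re (cinner (f h - a *\<^sub>R h) h) \<le> 0 * (norm h)\<^sup>2" for h
      using range[of h] mult_right_mono[OF \<open>b \<le> a\<close>, of "(norm h)\<^sup>2"] by auto
  qed
  then show ?thesis
    by auto
qed

text \<open>\<open>V\<close> intertwines \<open>T\<close> with \<open>T \<otimes> 1\<close>. The
  projection commutes with \<open>D \<otimes> 1\<close> because \<open>D\<close> is selfadjoint, so
  its compression \<open>f\<close> along \<open>V\<close> commutes with \<open>D\<close> and hence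
  lies in it.\<close>

lemma transitive_scalar_compression:
  fixes A D :: "('a::complex_hilbert_space \<Rightarrow> 'a) set"
  assumes AB: "A \<subseteq> bounded_ops" and D: "masa D" and DA: "D \<subseteq> A"
    and comp: "\<And>S T. S \<in> A \<Longrightarrow> T \<in> A \<Longrightarrow> S \<circ> T \<in> A"
    and trans: "\<And>M. invariant_subspace A M \<Longrightarrow> M = {0} \<or> M = UNIV"
    and M: "complex_vector.subspace M" "closed M"
    and inv: "\<And>T v. T \<in> A \<Longrightarrow> v \<in> M \<Longrightarrow> ell2_map T v \<in> M"
    and V_add: "\<And>x y. V (x + y) = V x + V y" and V_scale: "\<And>c x. V (c *\<^sub>C x) = c *\<^sub>C V x"
    and V_bound: "\<And>x. norm (V x) \<le> C * norm x"
    and V_map: "\<And>T x. T \<in> bounded_ops \<Longrightarrow> ell2_map T (V x) = V (T x)"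
  shows "\<exists>a. \<forall>h k. cinner (ortho_proj M (V h)) (V k) = complex_of_real a * cinner h k"
proof -
  define P where "P = ortho_proj M"
  have PB: "P \<in> bounded_ops"
    unfolding P_def by (rule ortho_proj_bounded_ops[OF M])
  have PP: "cinner (P u) v = cinner (P u) (P v)" for u v
    unfolding P_def by (rule cinner_ortho_proj[OF M])
  have Padj: "cinner (P u) v = cinner u (P v)" for u v
    using is_adjoint_ortho_proj[OF M] by (simp add: P_def is_adjoint_def)
  have P_le: "norm (P u) \<le> norm u" for u
    unfolding P_def by (rule norm_ortho_proj_le[OF M])
  have TB: "T \<in> bounded_ops" if "T \<in> A" for T
    using that AB by blast
  have "\<exists>f\<in>bounded_ops. \<forall>h k. cinner (P (V h)) (V k) = cinner (f h) k"
  proof (rule sesquilinear_representation)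
    show "cmod (cinner (P (V h)) (V k)) \<le> C * C * norm h * norm k" for h k
    proof -
      have "cmod (cinner (P (V h)) (V k)) \<le> norm (V h) * norm (V k)"
        by (intro order_trans[OF cmod_cinner_le] mult_right_mono P_le norm_ge_zero)
      also have "\<dots> \<le> (C * norm h) * (C * norm k)"
        by (intro mult_mono V_bound order_trans[OF norm_ge_zero V_bound] norm_ge_zero)
      finally show ?thesis
        by (simp add: mult_ac)
    qed
  qed (simp_all add: V_add V_scale bounded_ops_add[OF PB] bounded_ops_scaleC[OF PB] cinner_add_left
      cinner_add_right cinner_scaleC_left cinner_scaleC_right)
  then obtain f where fB: "f \<in> bounded_ops" and f: "\<And>h k. cinner (P (V h)) (V k) = cinner (f h) k"
    by metis
  have P_map: "P (ell2_map T v) = ell2_map T (P v)" if T: "T \<in> D" for T v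
  proof -
    obtain S where S: "S \<in> D" "is_adjoint S T"
      using masa_selfadjoint[OF D] T by (auto simp: selfadjoint_set_def)
    have "is_adjoint (ell2_map S) (ell2_map T)"
      using S T TB DA by (intro is_adjoint_ell2_map) auto
    then show ?thesis
      unfolding P_def using inv S T DA by (auto intro: ortho_proj_commute[OF M])
  qed
  have "T (f h) = f (T h)" if T: "T \<in> D" for T h
  proof (rule cinner_left_eqI)
    fix k
    have "T \<in> A"
      using T DA by blast
    obtain S where S: "S \<in> D" "is_adjoint S T"
      using masa_selfadjoint[OF D] T by (auto simp: selfadjoint_set_def)
    have SB: "S \<in> bounded_ops" and TB': "T \<in> bounded_ops"
      using S T TB DA by auto
    have "cinner (f (T h)) k = cinner (ell2_map T (P (V h))) (V k)"
      by (simp only: f[symmetric] V_map[OF TB', symmetric] P_map[OF T])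
    also have "\<dots> = cinner (P (V h)) (ell2_map S (V k))"
      using is_adjoint_ell2_map[OF SB TB' S(2)] by (simp add: is_adjoint_def)
    also have "\<dots> = cinner (T (f h)) k"
      using S(2) by (simp add: V_map[OF SB] f is_adjoint_def)
    finally show "cinner (T (f h)) k = cinner (f (T h)) k" ..
  qed
  then have fD: "f \<in> D"
    by (intro masa_maximal[OF D]) (simp add: commutant_def fB)
  have "is_adjoint f f"
    unfolding is_adjoint_def
  proof (intro allI)
    fix h k
    have "cinner (f h) k = cnj (cinner (P (V k)) (V h))"
      by (simp only: f[symmetric] Padj[of "V h"]) (rule cinner_commute)
    also have "\<dots> = cinner h (f k)"
      unfolding f by (rule cinner_commute[symmetric])
    finally show "cinner (f h) k = cinner h (f k)" .
  qed
  have f_self: "Re (cinner (f h) h) = (norm (P (V h)))\<^sup>2" for h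
    by (simp add: f[symmetric] PP[of "V h"] cinner_self)
  have "\<exists>a. \<forall>h. f h = a *\<^sub>R h"
  proof (rule transitive_scalar_operator[OF AB D DA comp trans fD \<open>is_adjoint f f\<close>])
    show "0 \<le> Re (cinner (f h) h)" for h
      by (simp add: f_self)
    fix T K h k
    assume T: "T \<in> A" and K: "\<And>x. norm (T x) \<le> K * norm x" "0 \<le> K"
    obtain S where S: "S \<in> bounded_ops" "is_adjoint S T"
      using exists_adjoint[OF TB[OF T]] by blast
    have "cinner (T (f h)) k = cinner (P (V h)) (V (S k))"
      using S(2) by (simp add: f is_adjoint_def)
    also have "\<dots> = cinner (ell2_map T (P (V h))) (V k)"
      using is_adjoint_ell2_map[OF S(1) TB[OF T] S(2)]
      by (simp add: is_adjoint_def V_map[OF S(1), symmetric])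
    \<comment> \<open>Invariance of \<open>M\<close> lets a second \<open>P\<close> be inserted and
      moved onto \<open>V k\<close>; this is the source of the geometric mean in the
      estimate.\<close>
    also have "ell2_map T (P (V h)) = P (ell2_map T (P (V h)))"
      unfolding P_def by (simp only: ortho_proj_ident[OF M inv[OF T ortho_proj_in[OF M]]])
    also have "cinner \<dots> (V k) = cinner (P (ell2_map T (P (V h)))) (P (V k))"
      by (rule PP)
    also have "cmod \<dots> \<le> norm (ell2_map T (P (V h))) * norm (P (V k))"
      by (intro order_trans[OF cmod_cinner_le] mult_right_mono P_le norm_ge_zero)
    also have "\<dots> \<le> K * norm (P (V h)) * norm (P (V k))"
      by (intro mult_right_mono ell2_map_norm_le TB[OF T] K norm_ge_zero)
    finally show "cmod (cinner (T (f h)) k)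
        \<le> K * (sqrt (Re (cinner (f h) h)) * sqrt (Re (cinner (f k) k)))"
      by (simp add: f_self mult.assoc)
  qed
  then show ?thesis
    unfolding P_def[symmetric] f by (auto simp: cinner_scaleR_left)
qed

text \<open>Compressing along
  \<open>h \<mapsto> ell2_single i h + c *\<^sub>C ell2_single j h\<close> for the four fourth roots
  of unity \<open>c\<close> and polarizing recovers the individual matrix entries.\<close>

lemma transitive_projection_entries:
  fixes A D :: "('a::complex_hilbert_space \<Rightarrow> 'a) set"
  assumes AB: "A \<subseteq> bounded_ops" and D: "masa D" and DA: "D \<subseteq> A"
    and comp: "\<And>S T. S \<in> A \<Longrightarrow> T \<in> A \<Longrightarrow> S \<circ> T \<in> A"
    and trans: "\<And>M. invariant_subspace A M \<Longrightarrow> M = {0} \<or> M = UNIV"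
    and M: "complex_vector.subspace M" "closed M"
    and inv: "\<And>T v. T \<in> A \<Longrightarrow> v \<in> M \<Longrightarrow> ell2_map T v \<in> M"
  shows "\<exists>a. \<forall>h k. cinner (ortho_proj M (ell2_single j h)) (ell2_single i k) = a * cinner h k"
proof -
  define P where "P = ortho_proj M"
  have PB: "P \<in> bounded_ops"
    unfolding P_def by (rule ortho_proj_bounded_ops[OF M])
  let ?V = "\<lambda>c h. ell2_single i h + c *\<^sub>C ell2_single j h"
  have V: "\<exists>a. \<forall>h k. cinner (P (?V c h)) (?V c k) = complex_of_real a * cinner h k" for c
    unfolding P_def
  proof (rule transitive_scalar_compression[OF AB D DA comp trans M inv])
    show "?V c (x + y) = ?V c x + ?V c y" for x y
      by (simp add: ell2_single_linear scaleC_add_right)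
    show "?V c (d *\<^sub>C x) = d *\<^sub>C ?V c x" for d x
      by (simp add: ell2_single_linear scaleC_add_right scaleC_scaleC mult.commute)
    show "norm (?V c x) \<le> (1 + cmod c) * norm x" for x
      by (rule order_trans[OF norm_triangle_ineq])
        (simp add: norm_scaleC norm_ell2_single distrib_right)
    show "ell2_map T (?V c x) = ?V c (T x)" if "T \<in> bounded_ops" for T x
      using ell2_map_bounded_ops[OF that]
      by (simp add: bounded_ops_add bounded_ops_scaleC ell2_map_single that)
  qed
  define G where "G i j h k = cinner (P (ell2_single i h)) (ell2_single j k)" for i j h k
  have expand: "cinner (P (?V c h)) (?V c k)
      = G i i h k + cnj c * G i j h k + c * G j i h k + c * cnj c * G j j h k" for c h k
    by (simp add: G_def bounded_ops_add[OF PB] bounded_ops_scaleC[OF PB] cinner_add_left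
        cinner_add_right cinner_scaleC_left cinner_scaleC_right algebra_simps)
  obtain s1 where s1: "\<And>h k. G i i h k + G i j h k + G j i h k + G j j h k = complex_of_real s1 * cinner h k"
    using V[of 1] unfolding expand by auto
  obtain s2 where s2: "\<And>h k. G i i h k - \<i> * G i j h k + \<i> * G j i h k + G j j h k = complex_of_real s2 * cinner h k"
    using V[of \<i>] unfolding expand by auto
  obtain s3 where s3: "\<And>h k. G i i h k - G i j h k - G j i h k + G j j h k = complex_of_real s3 * cinner h k"
    using V[of "-1"] unfolding expand by (auto simp: algebra_simps)
  obtain s4 where s4: "\<And>h k. G i i h k + \<i> * G i j h k - \<i> * G j i h k + G j j h k = complex_of_real s4 * cinner h k"
    using V[of "-\<i>"] unfolding expand by (auto simp: algebra_simps)
  have "G j i h k = ((s1 - s3) - \<i> * (s2 - s4)) / 4 * cinner h k" for h k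
  proof -
    have "4 * G j i h k = (G i i h k + G i j h k + G j i h k + G j j h k)
        - (G i i h k - G i j h k - G j i h k + G j j h k)
        - \<i> * ((G i i h k - \<i> * G i j h k + \<i> * G j i h k + G j j h k)
        - (G i i h k + \<i> * G i j h k - \<i> * G j i h k + G j j h k))"
      by (simp add: algebra_simps)
    also have "\<dots> = ((s1 - s3) - \<i> * (s2 - s4)) * cinner h k"
      unfolding s1 s2 s3 s4 by (simp add: algebra_simps)
    finally show ?thesis
      by (simp add: mult.commute)
  qed
  then show ?thesis
    unfolding G_def P_def by blast
qed

text \<open>The block matrix of the projection has scalar entries, and \<open>B \<otimes> 1\<close>
  is block diagonal with constant entry \<open>B\<close>, so they commute; adjoints reduce the check
  to single coordinates.\<close>

lemma ortho_proj_map_commute: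
  fixes B :: "'a::complex_hilbert_space \<Rightarrow> 'a"
  assumes M: "complex_vector.subspace M" "closed M"
    and entries: "\<And>i j. \<exists>a. \<forall>h k. cinner (ortho_proj M (ell2_single j h)) (ell2_single i k) = a * cinner h k"
    and B: "B \<in> bounded_ops"
  shows "ortho_proj M (ell2_map B v) = ell2_map B (ortho_proj M v)"
proof -
  define P where "P = ortho_proj M"
  have Padj: "cinner (P u) v = cinner u (P v)" for u v
    using is_adjoint_ortho_proj[OF M] by (simp add: P_def is_adjoint_def)
  obtain B' where B': "B' \<in> bounded_ops" "is_adjoint B' B"
    using exists_adjoint[OF B] by blast
  have Badj: "cinner (B x) y = cinner x (B' y)" for x y
    using B'(2) by (simp add: is_adjoint_def)
  have Badj': "cinner (B' x) y = cinner x (B y)" for x y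
    using B'(2) is_adjoint_commute[of B' B] by (simp add: is_adjoint_def)
  have mapadj: "cinner (ell2_map B u) v = cinner u (ell2_map B' v)" for u v
    using is_adjoint_ell2_map[OF B'(1) B B'(2)] by (simp add: is_adjoint_def)
  have commute_single: "ell2_map B' (P (ell2_single i k)) = P (ell2_map B' (ell2_single i k))" for i k
  proof (rule ell2_eqI, rule cinner_left_eqI)
    fix n y
    obtain a where a: "\<And>h k. cinner (P (ell2_single i h)) (ell2_single n k) = a * cinner h k"
      using entries[of i n] by (auto simp: P_def)
    show "cinner (ell2_nth (ell2_map B' (P (ell2_single i k))) n) y
        = cinner (ell2_nth (P (ell2_map B' (ell2_single i k))) n) y"
      using a[of k "B y"] a[of "B' k" y]
      by (simp add: ell2_nth_map[OF B'(1)] ell2_map_single[OF B'(1)] cinner_ell2_single Badj')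
  qed
  show ?thesis
    unfolding P_def[symmetric]
  proof (rule ell2_eqI, rule cinner_left_eqI)
    fix n y
    have "cinner (P (ell2_map B v)) (ell2_single n y) = cinner (ell2_map B (P v)) (ell2_single n y)"
      by (simp add: Padj mapadj commute_single)
    then show "cinner (ell2_nth (P (ell2_map B v)) n) y = cinner (ell2_nth (ell2_map B (P v)) n) y"
      by (simp add: cinner_ell2_single)
  qed
qed

theorem transitive_annihilator_zero:
  fixes A D :: "('a::complex_hilbert_space \<Rightarrow> 'a) set"
  assumes AB: "A \<subseteq> bounded_ops" and D: "masa D" and DA: "D \<subseteq> A"
    and comp: "\<And>S T. S \<in> A \<Longrightarrow> T \<in> A \<Longrightarrow> S \<circ> T \<in> A"
    and trans: "\<And>M. invariant_subspace A M \<Longrightarrow> M = {0} \<or> M = UNIV"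
    and kill: "\<And>T. T \<in> A \<Longrightarrow> cinner (ell2_map T w) z = 0" and B: "B \<in> bounded_ops"
  shows "cinner (ell2_map B w) z = 0"
proof -
  text \<open>The closure of the orbit of \<open>w\<close>, as a double orthogonal complement.\<close>
  define M where "M = {v. \<forall>u. (\<forall>T\<in>A. cinner (ell2_map T w) u = 0) \<longrightarrow> cinner v u = 0}"
  have id: "(\<lambda>x. x) \<in> A"
    using masa_ident[OF D] DA by blast
  have M: "complex_vector.subspace M"
    by (auto simp: M_def complex_vector.subspace_def cinner_add_left cinner_scaleC_left)
  have "M = (\<Inter>u\<in>{u. \<forall>T\<in>A. cinner (ell2_map T w) u = 0}. {v. cinner v u = 0})"
    by (auto simp: M_def)
  then have cl: "closed M"
    by (simp add: closed_INT closed_cinner_eq_0)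
  have inv: "ell2_map T v \<in> M" if T: "T \<in> A" and v: "v \<in> M" for T v
    unfolding M_def
  proof (intro CollectI allI impI)
    fix u assume u: "\<forall>T\<in>A. cinner (ell2_map T w) u = 0"
    have TB: "T \<in> bounded_ops"
      using T AB by blast
    obtain S where S: "S \<in> bounded_ops" "is_adjoint S T"
      using exists_adjoint[OF TB] by blast
    note adj = is_adjoint_ell2_map[OF S(1) TB S(2), unfolded is_adjoint_def, rule_format]
    \<comment> \<open>Since \<open>T R\<close> is again in \<open>A\<close>, the amplified adjoint
      of \<open>T\<close> preserves the orthogonal complement of the orbit, hence \<open>T\<close>
      preserves \<open>M\<close>.\<close>
    have "cinner (ell2_map R w) (ell2_map S u) = 0" if R: "R \<in> A" for R
    proof -
      have "R \<in> bounded_ops"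
        using R AB by blast
      then show ?thesis
        using u comp[OF T R] by (simp add: adj[symmetric] ell2_map_compose[OF TB, symmetric] comp_def)
    qed
    then show "cinner (ell2_map T v) u = 0"
      using v by (simp add: adj M_def)
  qed
  have "w \<in> M"
    using id by (auto simp: M_def ell2_map_ident dest: bspec[of A _ "\<lambda>x. x"])
  have "ortho_proj M (ell2_map B w) = ell2_map B (ortho_proj M w)"
    by (intro ortho_proj_map_commute[OF M cl] B
        transitive_projection_entries[OF AB D DA comp trans M cl inv])
  \<comment> \<open>The projection fixes \<open>w\<close> and commutes with
    \<open>B \<otimes> 1\<close>, so \<open>ell2_map B w\<close> stays in \<open>M\<close>; and
    \<open>z\<close> is one of the vectors \<open>u\<close> in the definition of
    \<open>M\<close>.\<close>
  then have "ortho_proj M (ell2_map B w) = ell2_map B w"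
    by (simp add: ortho_proj_ident[OF M cl \<open>w \<in> M\<close>])
  then have "ell2_map B w \<in> M"
    using ortho_proj_in[OF M cl] by metis
  then show ?thesis
    using kill by (auto simp: M_def)
qed

subsection \<open>Density in the ultra-weak topology\<close>

text \<open>If a functional \<open>\<psi>\<close> takes the value \<open>1\<close> at some \<open>S\<^sub>1 \<in> L\<close>, then the hypothesis passes to
  the kernel of \<open>\<psi>\<close> in \<open>L\<close> and to the operator \<open>T - \<psi>(T) S\<^sub>1\<close>: a functional \<open>\<phi>\<close> killing this kernel
  is corrected to \<open>\<phi> - \<phi>(S\<^sub>1) \<psi>\<close>, which kills \<open>L\<close>.\<close>

lemma ultraweak_interpolation:
  fixes \<Phi> :: "('a::complex_inner ell2 \<times> 'a ell2) set"
  assumes "finite \<Phi>" and "operator_subspace L" and "T \<in> bounded_ops"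
    and "\<And>w z. (\<forall>S\<in>L. cinner (ell2_map S w) z = 0) \<Longrightarrow> cinner (ell2_map T w) z = 0"
  shows "\<exists>S\<in>L. \<forall>(w, z)\<in>\<Phi>. cinner (ell2_map S w) z = cinner (ell2_map T w) z"
  using assms
proof (induction \<Phi> arbitrary: L T rule: finite_induct)
  case empty
  then show ?case
    by (auto simp: operator_subspace_def)
next
  case (insert p \<Phi>)
  obtain w0 z0 where p: "p = (w0, z0)"
    by (cases p)
  define \<psi> where "\<psi> S = cinner (ell2_map S w0) z0" for S
  note L = insert.prems(1) and T = insert.prems(2) and kill = insert.prems(3)
  have LB: "S \<in> bounded_ops" if "S \<in> L" for S
    using L that by (auto simp: operator_subspace_def)
  have L_add: "(\<lambda>x. R x + S x) \<in> L" if "R \<in> L" "S \<in> L" for R S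
    using L that by (simp add: operator_subspace_def)
  have L_scale: "(\<lambda>x. c *\<^sub>C S x) \<in> L" if "S \<in> L" for c S
    using L that by (simp add: operator_subspace_def)
  show ?case
  proof (cases "\<forall>S\<in>L. \<psi> S = 0")
    case True
    \<comment> \<open>A functional that kills \<open>L\<close> also kills \<open>T\<close>, so every
      element of \<open>L\<close> already matches it.\<close>
    then have "\<psi> T = 0"
      using kill unfolding \<psi>_def by blast
    obtain S where "S \<in> L" "\<forall>(w, z)\<in>\<Phi>. cinner (ell2_map S w) z = cinner (ell2_map T w) z"
      using insert.IH[OF L T kill] by blast
    then show ?thesis
      using True \<open>\<psi> T = 0\<close> by (auto simp: p \<psi>_def)
  next
    case False
    then obtain S0 where "S0 \<in> L" "\<psi> S0 \<noteq> 0"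
      by blast
    define S1 where "S1 = (\<lambda>x. (1 / \<psi> S0) *\<^sub>C S0 x)"
    have S1: "S1 \<in> L"
      using L \<open>S0 \<in> L\<close> by (simp add: S1_def operator_subspace_def)
    have "\<psi> S1 = 1"
      using \<open>\<psi> S0 \<noteq> 0\<close> LB[OF \<open>S0 \<in> L\<close>]
      by (simp add: S1_def \<psi>_def ell2_map_scaleC cinner_scaleC_left)
    have comb: "cinner (ell2_map (\<lambda>x. S x + c *\<^sub>C S1 x) w) z
        = cinner (ell2_map S w) z + c * cinner (ell2_map S1 w) z" if "S \<in> bounded_ops" for S c w z
      by (simp add: ell2_map_add[OF that bounded_ops_scaleC_op] ell2_map_scaleC LB[OF S1]
          cinner_add_left cinner_scaleC_left)
    define L' where "L' = {S \<in> L. \<psi> S = 0}"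
    define T' where "T' = (\<lambda>x. T x + (- \<psi> T) *\<^sub>C S1 x)"
    have T'B: "T' \<in> bounded_ops"
      unfolding T'_def by (intro bounded_ops_add_op bounded_ops_scaleC_op T LB[OF S1])
    have L': "operator_subspace L'"
      unfolding operator_subspace_def
    proof (intro conjI ballI allI)
      show "L' \<subseteq> bounded_ops"
        using LB by (auto simp: L'_def)
      show "(\<lambda>x. 0) \<in> L'"
        using L by (simp add: L'_def \<psi>_def ell2_map_zero operator_subspace_def)
      show "(\<lambda>x. R x + S x) \<in> L'" if "R \<in> L'" "S \<in> L'" for R S
        using L that LB by (auto simp: L'_def \<psi>_def ell2_map_add cinner_add_left operator_subspace_def)
      show "(\<lambda>x. c *\<^sub>C S x) \<in> L'" if "S \<in> L'" for c S
        using L that LB by (auto simp: L'_def \<psi>_def ell2_map_scaleC cinner_scaleC_left operator_subspace_def)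
    qed
    have "cinner (ell2_map T' w) z = 0" if wz: "\<forall>S\<in>L'. cinner (ell2_map S w) z = 0" for w z
    proof -
      define c where "c = cinner (ell2_map S1 w) z"
      obtain w' z' where w'z': "\<And>S. S \<in> bounded_ops \<Longrightarrow>
          cinner (ell2_map S w') z' = cinner (ell2_map S w) z + (- c) * \<psi> S"
        using ultraweak_functional_add[of w z "- c" w0 z0] unfolding \<psi>_def by blast
      have "cinner (ell2_map S w') z' = 0" if S: "S \<in> L" for S
      proof -
        let ?R = "\<lambda>x. S x + (- \<psi> S) *\<^sub>C S1 x"
        have "?R \<in> L"
          by (rule L_add[OF S L_scale[OF S1]])
        moreover have "\<psi> ?R = 0"
          using comb[OF LB[OF S], of "- \<psi> S" w0 z0] \<open>\<psi> S1 = 1\<close> by (simp add: \<psi>_def)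
        ultimately have "cinner (ell2_map ?R w) z = 0"
          using wz by (simp add: L'_def)
        then show ?thesis
          using comb[OF LB[OF S], of "- \<psi> S" w z] w'z'[OF LB[OF S]] by (simp add: c_def)
      qed
      then have "cinner (ell2_map T w') z' = 0"
        using kill by blast
      then show ?thesis
        using comb[OF T, of "- \<psi> T" w z] w'z'[OF T] by (simp add: T'_def c_def)
    qed
    then obtain S where S: "S \<in> L'" and
      eq: "\<And>w z. (w, z) \<in> \<Phi> \<Longrightarrow> cinner (ell2_map S w) z = cinner (ell2_map T' w) z"
      using insert.IH[OF L' T'B] by blast
    have SL: "S \<in> L" and SB: "S \<in> bounded_ops" and "\<psi> S = 0"
      using S LB by (auto simp: L'_def)
    \<comment> \<open>Adding back what was subtracted in \<open>T'\<close> restores the values of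
      \<open>T\<close> on \<open>\<Phi>\<close> and gives \<open>\<psi>\<close> the value
      \<open>\<psi> T\<close>.\<close>
    let ?R = "\<lambda>x. S x + \<psi> T *\<^sub>C S1 x"
    have "?R \<in> L"
      by (rule L_add[OF SL L_scale[OF S1]])
    moreover have "cinner (ell2_map ?R w0) z0 = cinner (ell2_map T w0) z0"
      using comb[OF SB, of "\<psi> T" w0 z0] \<open>\<psi> S = 0\<close> \<open>\<psi> S1 = 1\<close> by (simp add: \<psi>_def)
    moreover have "cinner (ell2_map ?R w) z = cinner (ell2_map T w) z" if "(w, z) \<in> \<Phi>" for w z
      using comb[OF SB, of "\<psi> T" w z] comb[OF T, of "- \<psi> T" w z] eq[OF that] by (simp add: T'_def)
    ultimately show ?thesis
      by (intro bexI[of _ ?R]) (auto simp: p)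
  qed
qed

text \<open>Membership in a subbasic set depends on one functional value, and finite intersections
  and unions need only finitely many at the point \<open>T\<close>. Exact agreement suffices, so no
  estimates are required for density.\<close>

lemma ultraweak_openin_finite:
  fixes W :: "('a::complex_inner \<Rightarrow> 'a) set"
  assumes "openin ultraweak_topology W" and "T \<in> W"
  shows "\<exists>\<Phi>. finite \<Phi> \<and> (\<forall>S\<in>bounded_ops.
    (\<forall>(w, z)\<in>\<Phi>. cinner (ell2_map S w) z = cinner (ell2_map T w) z) \<longrightarrow> S \<in> W)"
proof -
  have "generate_topology_on {{T \<in> bounded_ops. (\<Sum>n. cinner (T (x n)) (y n)) \<in> U} | x y U.
      square_summable x \<and> square_summable y \<and> open U} W"
    using assms(1) by (simp add: ultraweak_topology_def openin_topology_generated_by_iff)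
  then show ?thesis
    using \<open>T \<in> W\<close>
  proof (induction W rule: generate_topology_on.induct)
    case (Int V W)
    then obtain \<Phi> \<Psi> where
      "finite \<Phi>" "\<forall>S\<in>bounded_ops. (\<forall>(w, z)\<in>\<Phi>. cinner (ell2_map S w) z = cinner (ell2_map T w) z) \<longrightarrow> S \<in> V"
      "finite \<Psi>" "\<forall>S\<in>bounded_ops. (\<forall>(w, z)\<in>\<Psi>. cinner (ell2_map S w) z = cinner (ell2_map T w) z) \<longrightarrow> S \<in> W"
      by blast
    then show ?case
      by (intro exI[of _ "\<Phi> \<union> \<Psi>"]) blast
  next
    case (UN \<V>)
    then obtain V where "V \<in> \<V>" "T \<in> V"
      by blast
    then show ?case
      using UN.IH[of V] by blast
  next
    case (Basis s)
    then obtain x y U where s: "s = {T \<in> bounded_ops. (\<Sum>n. cinner (T (x n)) (y n)) \<in> U}"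
      and xy: "square_summable x" "square_summable y"
      by blast
    have eq: "(\<Sum>n. cinner (S (x n)) (y n)) = cinner (ell2_map S (Abs_ell2 x)) (Abs_ell2 y)"
      if "S \<in> bounded_ops" for S
      by (simp add: cinner_ell2_def ell2_nth_map[OF that] ell2_nth_Abs xy)
    have T: "T \<in> bounded_ops" "(\<Sum>n. cinner (T (x n)) (y n)) \<in> U"
      using Basis.prems by (auto simp: s)
    show ?case
      by (rule exI[of _ "{(Abs_ell2 x, Abs_ell2 y)}"]) (use T in \<open>auto simp: s eq\<close>)
  qed simp
qed

text \<open>Interpolating finitely many functionals at \<open>T\<close> by an element of
  \<open>L\<close> places that element in any given neighbourhood of \<open>T\<close>.\<close>

lemma ultraweak_dense:
  fixes L :: "('a::complex_inner \<Rightarrow> 'a) set"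
  assumes L: "operator_subspace L" and "bounded_ops \<subseteq> ultraweak_hull L"
  shows "ultraweak_topology closure_of L = bounded_ops"
proof
  show "ultraweak_topology closure_of L \<subseteq> bounded_ops"
    using closure_of_subset_topspace[of ultraweak_topology L] by simp
  show "bounded_ops \<subseteq> ultraweak_topology closure_of L"
  proof
    fix T :: "'a \<Rightarrow> 'a" assume T: "T \<in> bounded_ops"
    have "\<exists>S\<in>L. S \<in> W" if W: "openin ultraweak_topology W" "T \<in> W" for W
    proof -
      obtain \<Phi> where "finite \<Phi>" and \<Phi>: "\<forall>S\<in>bounded_ops.
          (\<forall>(w, z)\<in>\<Phi>. cinner (ell2_map S w) z = cinner (ell2_map T w) z) \<longrightarrow> S \<in> W"
        using ultraweak_openin_finite[OF W] by blast
      moreover obtain S where "S \<in> L" "\<forall>(w, z)\<in>\<Phi>. cinner (ell2_map S w) z = cinner (ell2_map T w) z"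
        using ultraweak_interpolation[OF \<open>finite \<Phi>\<close> L T] T assms(2)
        by (auto simp: ultraweak_hull_def subset_iff)
      ultimately show ?thesis
        using L by (auto simp: operator_subspace_def)
    qed
    then show "T \<in> ultraweak_topology closure_of L"
      using T by (auto simp: in_closure_of)
  qed
qed

theorem corollary6p5:
  fixes L D :: "('a::complex_hilbert_space \<Rightarrow> 'a) set"
  assumes "separable_space (euclidean :: 'a topology)"
    and "operator_lie_algebra L"
    and "masa D"
    and "D \<subseteq> L"
  shows "(\<exists>M. invariant_subspace L M \<and> M \<noteq> {0} \<and> M \<noteq> UNIV) \<or>
         ultraweak_topology closure_of L = bounded_ops"
proof (rule disjCI)
  assume "ultraweak_topology closure_of L \<noteq> bounded_ops"
  moreover have L: "operator_subspace L"
    using assms(2) by (simp add: operator_lie_algebra_def)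
  ultimately obtain B where "B \<in> bounded_ops" "B \<notin> ultraweak_hull L"
    using ultraweak_dense by blast
  then obtain w z where wz: "\<forall>S\<in>L. cinner (ell2_map S w) z = 0" and nz: "cinner (ell2_map B w) z \<noteq> 0"
    by (auto simp: ultraweak_hull_def)
  show "\<exists>M. invariant_subspace L M \<and> M \<noteq> {0} \<and> M \<noteq> UNIV"
  proof (rule ccontr)
    assume none: "\<nexists>M. invariant_subspace L M \<and> M \<noteq> {0} \<and> M \<noteq> UNIV"
    have LH: "L \<subseteq> ultraweak_hull L"
      using L by (intro subset_ultraweak_hull) (simp add: operator_subspace_def)
    have "cinner (ell2_map B w) z = 0"
    proof (rule transitive_annihilator_zero)
      show "ultraweak_hull L \<subseteq> bounded_ops"
        by (auto simp: ultraweak_hull_def)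
      show "D \<subseteq> ultraweak_hull L"
        using \<open>D \<subseteq> L\<close> LH by blast
      show "S \<circ> T \<in> ultraweak_hull L"
        if "S \<in> ultraweak_hull L" "T \<in> ultraweak_hull L" for S T
        unfolding comp_def by (rule ultraweak_hull_compose[OF assms(2-4) that])
      \<comment> \<open>The hull contains \<open>L\<close>, so its invariant subspaces are invariant
        for \<open>L\<close>, and transitivity passes to it.\<close>
      show "M = {0} \<or> M = UNIV" if "invariant_subspace (ultraweak_hull L) M" for M
      proof -
        have "invariant_subspace L M"
          using that LH unfolding invariant_subspace_def by blast
        then show ?thesis
          using none by blast
      qed
      show "cinner (ell2_map T w) z = 0" if "T \<in> ultraweak_hull L" for T
        using that wz by (simp add: ultraweak_hull_def)
    qed fact+
    then show False
      using nz by simp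
  qed
qed

end
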